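(* Let $\ell,m,n$ be positive integers. Let $f:N\to U$ be a $C^r$ immersion of a $C^r$ manifold $N$ of dimension $n$ into an open subset $U$ of $\mathbb{R}^m$. Let $F:U\to\mathbb{R}^\ell$ be a $C^r$ mapping and let $k$ be a positive integer satisfying $1\le k\le\min\{n,\ell\}$. If $$r>\max\{\dim N-\operatorname{codim}\Sigma^k(N,\mathbb{R}^\ell),\,0\}+1,$$ then there exists a subset $\Sigma$ of $\mathcal{L}(\mathbb{R}^m,\mathbb{R}^\ell)$ with Lebesgue measure zero such that for any $\pi\in\mathcal{L}(\mathbb{R}^m,\mathbb{R}^\ell)-\Sigma$, the mapping $j^1(F_\pi\circ f):N\to J^1(N,\mathbb{R}^\ell)$ is transverse to the submanifold $\Sigma^k(N,\mathbb{R}^\ell)$.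
   Context: All manifolds are without boundary and have countable bases; differentiability classes are $C^r$ with $r\ge 1$ ($r=\infty$ allowed). $\mathcal{L}(\mathbb{R}^m,\mathbb{R}^\ell)$ is the space of all linear mappings $\mathbb{R}^m\to\mathbb{R}^\ell$, naturally identified with $(\mathbb{R}^m)^\ell$ (matrix entries), which gives the meaning of Lebesgue measure zero. For $\pi\in\mathcal{L}(\mathbb{R}^m,\mathbb{R}^\ell)$, $F_\pi=F+\pi|_U:U\to\mathbb{R}^\ell$. For $r\ge2$, $J^1(N,\mathbb{R}^\ell)$ is the space of 1-jets of mappings of $N$ into $\mathbb{R}^\ell$; it is a $C^{r-1}$ manifold and, for a $C^r$ mapping $g:N\to\mathbb{R}^\ell$, the mapping $j^1g:N\to J^1(N,\mathbb{R}^\ell)$, $q\mapsto j^1g(q)$, is of class $C^{r-1}$. A chart $(U_\lambda,\varphi_\lambda)$ of $N$ gives a chart of $J^1(N,\mathbb{R}^\ell)$ over $U_\lambda\times\mathbb{R}^\ell$ with values in $\varphi_\lambda(U_\lambda)\times\mathbb{R}^\ell\times J^1(n,\ell)$, sending $j^1g(q)$ to $\varphi_\lambda(q)$, $g(q)$, and the 1-jet at $0$ of $g\circ\varphi_\lambda^{-1}$ translated in source and target so that $\varphi_\lambda(q)$ and $g(q)$ become the origins. Here $J^1(n,\ell)=\{j^1g(0)\mid g:(\mathbb{R}^n,0)\to(\mathbb{R}^\ell,0)\}$ (equivalently, $\ell\times n$ matrices). Put $\Sigma^k=\{j^1g(0)\in J^1(n,\ell)\mid\operatorname{corank}Jg(0)=k\}$,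 where $Jg(0)$ is the Jacobian matrix and $\operatorname{corank}Jg(0)=\min\{n,\ell\}-\operatorname{rank}Jg(0)$. Then $\Sigma^k(N,\mathbb{R}^\ell)\subset J^1(N,\mathbb{R}^\ell)$ is the set of those jets whose $J^1(n,\ell)$-component, in the charts of $J^1(N,\mathbb{R}^\ell)$ with values in $\varphi_\lambda(U_\lambda)\times\mathbb{R}^\ell\times J^1(n,\ell)$ induced by the charts $(U_\lambda,\varphi_\lambda)$ of $N$, lies in $\Sigma^k$. It is a submanifold of $J^1(N,\mathbb{R}^\ell)$ with $\operatorname{codim}\Sigma^k(N,\mathbb{R}^\ell)=(n-v+k)(\ell-v+k)$, where $v=\min\{n,\ell\}$. Transversality: a $C^1$ mapping $g:N\to P$ is transverse to a submanifold $Z\subset P$ if for every $q\in N$ with $g(q)\in Z$ one has $dg_q(T_qN)+T_{g(q)}Z=T_{g(q)}P$. *)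

theory Defs
  imports "HOL-Analysis.Analysis"
begin

section \<open>Maps of class C^r between Euclidean spaces\<close>

text \<open>Intended for open S and finite-dimensional spaces, where continuity of all iterated
  directional derivatives is the usual notion.\<close>

primrec Cn_on :: "nat \<Rightarrow> 'a::euclidean_space set \<Rightarrow> ('a \<Rightarrow> 'b::euclidean_space) \<Rightarrow> bool" where
  "Cn_on 0 S f \<longleftrightarrow> continuous_on S f"
| "Cn_on (Suc n) S f \<longleftrightarrow>
     (\<forall>x\<in>S. f differentiable (at x)) \<and> (\<forall>v. Cn_on n S (\<lambda>x. frechet_derivative f (at x) v))"

definition Cr_on :: "enat \<Rightarrow> 'a::euclidean_space set \<Rightarrow> ('a \<Rightarrow> 'b::euclidean_space) \<Rightarrow> bool" where
  "Cr_on r S f \<longleftrightarrow> (\<forall>n. enat n \<le> r \<longrightarrow> Cn_on n S f)"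

section \<open>Manifolds\<close>

text \<open>A manifold is given by an atlas, not necessarily maximal. The underlying set is the union of
  the chart domains and the topology is the one making all charts homeomorphisms onto open sets.
  A chart is a pair of its domain and a function that is only relevant on that domain.
  The model space is a Euclidean space, whose dimension is the dimension of the manifold.\<close>

type_synonym ('a, 'e) chart = "'a set \<times> ('a \<Rightarrow> 'e)"

definition points :: "('a, 'e) chart set \<Rightarrow> 'a set" where
  "points A = (\<Union>(U, \<phi>)\<in>A. U)"

definition atlas_topology :: "('a, 'e::euclidean_space) chart set \<Rightarrow> 'a topology" where
  "atlas_topology A =
     topology_generated_by {{p \<in> U. \<phi> p \<in> W} | U \<phi> W. (U, \<phi>) \<in> A \<and> open W}"

definition is_chart :: "('a, 'e::euclidean_space) chart \<Rightarrow> bool" where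
  "is_chart = (\<lambda>(U, \<phi>). inj_on \<phi> U \<and> open (\<phi> ` U))"

definition compatible ::
    "enat \<Rightarrow> ('a, 'e::euclidean_space) chart \<Rightarrow> ('a, 'e) chart \<Rightarrow> bool" where
  "compatible r = (\<lambda>(U, \<phi>) (V, \<psi>).
     open (\<phi> ` (U \<inter> V)) \<and> open (\<psi> ` (U \<inter> V)) \<and>
     Cr_on r (\<phi> ` (U \<inter> V)) (\<psi> \<circ> inv_into U \<phi>) \<and>
     Cr_on r (\<psi> ` (U \<inter> V)) (\<phi> \<circ> inv_into V \<psi>))"

definition Cr_atlas :: "enat \<Rightarrow> ('a, 'e::euclidean_space) chart set \<Rightarrow> bool" where
  "Cr_atlas r A \<longleftrightarrow> (\<forall>c\<in>A. is_chart c) \<and> (\<forall>c\<in>A. \<forall>d\<in>A. compatible r c d)"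

definition maximal_atlas ::
    "enat \<Rightarrow> ('a, 'e::euclidean_space) chart set \<Rightarrow> ('a, 'e) chart set" where
  "maximal_atlas r A =
     {c. is_chart c \<and> fst c \<subseteq> points A \<and> (\<forall>d\<in>A. compatible r c d)}"

definition Cr_manifold :: "enat \<Rightarrow> ('a, 'e::euclidean_space) chart set \<Rightarrow> bool" where
  "Cr_manifold r A \<longleftrightarrow>
     Cr_atlas r A \<and> Hausdorff_space (atlas_topology A) \<and> second_countable (atlas_topology A)"

definition Cr_map ::
    "enat \<Rightarrow> ('a, 'e::euclidean_space) chart set \<Rightarrow> ('a \<Rightarrow> 'b::euclidean_space) \<Rightarrow> bool" where
  "Cr_map r A f \<longleftrightarrow> (\<forall>(U, \<phi>)\<in>A. Cr_on r (\<phi> ` U) (f \<circ> inv_into U \<phi>))"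

definition Cr_immersion ::
    "enat \<Rightarrow> ('a, 'e::euclidean_space) chart set \<Rightarrow> ('a \<Rightarrow> 'b::euclidean_space) \<Rightarrow> bool" where
  "Cr_immersion r A f \<longleftrightarrow> Cr_map r A f \<and>
     (\<forall>(U, \<phi>)\<in>A. \<forall>x\<in>\<phi> ` U. inj (frechet_derivative (f \<circ> inv_into U \<phi>) (at x)))"

section \<open>Submanifolds and codimension\<close>

text \<open>Submanifolds are embedded: in suitable charts of the maximal atlas they are slices. The
  codimension is unique for a nonempty submanifold of class C^r with r at least 1.\<close>

definition submanifold ::
    "enat \<Rightarrow> ('a, 'e::euclidean_space) chart set \<Rightarrow> 'a set \<Rightarrow> nat \<Rightarrow> bool" where
  "submanifold r A Z c \<longleftrightarrow> Z \<subseteq> points A \<and>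
     (\<forall>z\<in>Z. \<exists>(V, \<psi>)\<in>maximal_atlas r A. z \<in> V \<and>
        (\<exists>L. subspace L \<and> dim L + c = DIM('e) \<and> \<psi> ` (V \<inter> Z) = \<psi> ` V \<inter> L))"

definition codim :: "enat \<Rightarrow> ('a, 'e::euclidean_space) chart set \<Rightarrow> 'a set \<Rightarrow> nat" where
  "codim r A Z = (THE c. submanifold r A Z c)"

section \<open>Tangent spaces and transversality\<close>

text \<open>Tangent vectors are velocities of C^1 curves. A velocity is encoded as the family of its
  coordinate vectors in all charts around the base point, so that curves are identified precisely
  when they are tangent to each other, and the vector space operations are pointwise.\<close>

definition curve_at ::
    "('a, 'e::euclidean_space) chart set \<Rightarrow> 'a set \<Rightarrow> 'a \<Rightarrow> (real \<Rightarrow> 'a) \<Rightarrow> bool" where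
  "curve_at A Z p \<gamma> \<longleftrightarrow> \<gamma> 0 = p \<and>
     (\<exists>(U, \<phi>)\<in>A. \<exists>\<epsilon>>0. \<gamma> ` {-\<epsilon><..<\<epsilon>} \<subseteq> Z \<inter> U \<and> Cr_on 1 {-\<epsilon><..<\<epsilon>} (\<phi> \<circ> \<gamma>))"

type_synonym ('a, 'e) tangent_vector = "('a, 'e) chart \<Rightarrow> 'e"

definition velocity ::
    "('a, 'e::euclidean_space) chart set \<Rightarrow> (real \<Rightarrow> 'a) \<Rightarrow> ('a, 'e) tangent_vector" where
  "velocity A \<gamma> = (\<lambda>(U, \<phi>).
     if (U, \<phi>) \<in> A \<and> \<gamma> 0 \<in> U then vector_derivative (\<phi> \<circ> \<gamma>) (at 0) else 0)"

text \<open>The tangent space at p of a submanifold Z of the manifold with atlas A, as a subspace of the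
  tangent space of the ambient manifold; the latter is the case where Z is all of points A.\<close>

definition tangent_space ::
    "('a, 'e::euclidean_space) chart set \<Rightarrow> 'a set \<Rightarrow> 'a \<Rightarrow> ('a, 'e) tangent_vector set" where
  "tangent_space A Z p = {velocity A \<gamma> | \<gamma>. curve_at A Z p \<gamma>}"

definition differential ::
    "('a, 'e::euclidean_space) chart set \<Rightarrow> ('b, 'd::euclidean_space) chart set \<Rightarrow> ('a \<Rightarrow> 'b) \<Rightarrow> 'a \<Rightarrow>
     ('a, 'e) tangent_vector \<Rightarrow> ('b, 'd) tangent_vector" where
  "differential A B g q v =
     (THE w. \<exists>\<gamma>. curve_at A (points A) q \<gamma> \<and> velocity A \<gamma> = v \<and> velocity B (g \<circ> \<gamma>) = w)"

definition transverse ::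
    "('a, 'e::euclidean_space) chart set \<Rightarrow> ('b, 'd::euclidean_space) chart set \<Rightarrow> ('a \<Rightarrow> 'b) \<Rightarrow>
     'b set \<Rightarrow> bool" where
  "transverse A B g Z \<longleftrightarrow>
     (\<forall>q\<in>points A. g q \<in> Z \<longrightarrow>
        {\<lambda>c. u c + w c | u w.
           u \<in> differential A B g q ` tangent_space A (points A) q \<and> w \<in> tangent_space B Z (g q)}
        = tangent_space B (points B) (g q))"

section \<open>The space of 1-jets\<close>

definition Cr_near ::
    "enat \<Rightarrow> ('a, 'e::euclidean_space) chart set \<Rightarrow> ('a \<Rightarrow> 'b::euclidean_space) \<Rightarrow> 'a \<Rightarrow> bool" where
  "Cr_near r A g q \<longleftrightarrow>
     (\<exists>(U, \<phi>)\<in>A. q \<in> U \<and>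
        (\<exists>T. open T \<and> \<phi> q \<in> T \<and> T \<subseteq> \<phi> ` U \<and> Cr_on r T (g \<circ> inv_into U \<phi>)))"

text \<open>A 1-jet consists of its source q and an equivalence class of maps of class C^r near q.\<close>

type_synonym ('a, 'l) jet = "'a \<times> ('a \<Rightarrow> real^'l) set"

definition j1 ::
    "enat \<Rightarrow> ('a, real^'n) chart set \<Rightarrow> ('a \<Rightarrow> real^'l::finite) \<Rightarrow> 'a \<Rightarrow> ('a, 'l) jet" where
  "j1 r A g q = (q, {h. Cr_near r A h q \<and> h q = g q \<and>
     (\<forall>(U, \<phi>)\<in>A. q \<in> U \<longrightarrow>
        frechet_derivative (h \<circ> inv_into U \<phi>) (at (\<phi> q)) =
        frechet_derivative (g \<circ> inv_into U \<phi>) (at (\<phi> q)))})"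

definition J1 :: "enat \<Rightarrow> ('a, real^'n) chart set \<Rightarrow> ('a, 'l::finite) jet set" where
  "J1 r A = {j1 r A g q | g q. q \<in> points A \<and> Cr_near r A g q}"

text \<open>The 1-jet at 0 of a map from R^n to R^l preserving the origin is encoded by its Jacobian
  matrix. The translations moving \<phi> q and g q to the origins do not change that matrix.\<close>

definition jet_coords ::
    "('a, real^'n) chart \<Rightarrow> ('a, 'l::finite) jet \<Rightarrow> (real^'n) \<times> (real^'l) \<times> (real^'n^'l)" where
  "jet_coords = (\<lambda>(U, \<phi>) (q, G). let g = (SOME g. g \<in> G) in
     (\<phi> q, g q, matrix (frechet_derivative (g \<circ> inv_into U \<phi>) (at (\<phi> q)))))"

definition jet_atlas ::
    "enat \<Rightarrow> ('a, real^'n) chart set \<Rightarrow>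
     (('a, 'l::finite) jet, (real^'n) \<times> (real^'l) \<times> (real^'n^'l)) chart set" where
  "jet_atlas r A = {({j \<in> J1 r A. fst j \<in> fst c}, jet_coords c) | c. c \<in> A}"

definition corank :: "real^'n^'l \<Rightarrow> nat" where
  "corank M = min CARD('n) CARD('l) - rank M"

definition Sigma_jets :: "enat \<Rightarrow> ('a, real^'n) chart set \<Rightarrow> nat \<Rightarrow> ('a, 'l::finite) jet set" where
  "Sigma_jets r A k =
     {j \<in> J1 r A. \<exists>c\<in>A. fst j \<in> fst c \<and> corank (snd (snd (jet_coords c j))) = k}"

end

(* In a chart and for fixed matrix P of pi, the matrix part of the jet is J(x) = DG(x) + P Df(x).
   Choosing n rows of Df(x) that form an invertible matrix N, the matrix J N^-1 moves by an arbitrary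
   translation when P moves in suitable directions, and near a matrix of rank rho with an invertible
   minor a the rank condition reads d - c a^-1 b = 0 for the Schur complement. Translating the block d
   translates the Schur complement, so by Fubini it suffices that almost every value of a C^(r-1) map
   from R^n to R^c, c = codim Sigma^k, is regular. This is Sard's theorem in its sharp form
   r - 1 >= max(n - c, 0) + 1.

   Sard's theorem is proved by Morse's vanishing argument. The zero set of a class of C^k functions splits
   into points where one of the functions has a nonzero derivative, which lie on hypersurfaces of smaller
   dimension, and points where all derivatives vanish, to which the statement for C^(k-1) applies. This
   yields |f x - f y| <= C |x - y|^k on countably many pieces. In the critical dimension such an estimate
   alone is not enough to make the image null; a refinement of the grid shows that most cells are so
   densely filled that chains of short steps improve the estimate. *)
theory Submission
  imports Defs
begin

section \<open>Calculus of C^k maps\<close>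

text \<open>A type fixes the dimension of its space, while the inductions behind Sard's theorem
  lower it. Smaller spaces therefore appear as \<open>span D\<close> for a set D of basis vectors of
  one type, and null sets in the coordinates D as full-dimensional cylinders. Blocks of a matrix are
  likewise kept inside full-size matrices.

  Fubini needs measurable sets. Criticality is expressed by a unit covector that annihilates the
  image of the derivative; the bad set is then a continuous image of a relatively closed subset of
  an open set, hence sigma-compact and Borel.

  The hypothesis on r contains \<open>codim\<close>, a definite description. Its value is known only
  after Sigma^k is shown to be a submanifold and codimensions are shown to be unique; if Sigma^k has
  no points, it stays unspecified but transversality is vacuous.

  One order of differentiability is spent on passing from a map to its jet, so Sard's theorem meets
  C^(r-1) maps. Tangent vectors of Sigma^k come from the curves (1 + tX) M (1 + tY), along which the
  rank is constant for small t.\<close>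

lemma Cn_on_Suc_iff: "Cn_on (Suc n) S f \<longleftrightarrow>
     (\<forall>x\<in>S. (f has_derivative frechet_derivative f (at x)) (at x)) \<and>
     (\<forall>v. Cn_on n S (\<lambda>x. frechet_derivative f (at x) v))"
  by (simp add: Cn_on.simps(2) frechet_derivative_works)

declare Cn_on.simps(2) [simp del] Cn_on_Suc_iff [simp]

lemma Cn_on_subset: "Cn_on n S f \<Longrightarrow> T \<subseteq> S \<Longrightarrow> Cn_on n T f"
  by (induction n arbitrary: f) (auto intro: continuous_on_subset)

lemma Cn_on_cong:
  assumes "open S" "Cn_on n S f" "\<And>x. x \<in> S \<Longrightarrow> f x = g x"
  shows "Cn_on n S g"
  using assms(2,3)
proof (induction n arbitrary: f g)
  case 0
  then show ?case using continuous_on_cong by (metis Cn_on.simps(1))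
next
  case (Suc n)
  have d: "(f has_derivative frechet_derivative f (at x)) (at x)" if "x \<in> S" for x
    using Suc.prems that Cn_on_Suc_iff by blast
  have g: "(g has_derivative frechet_derivative f (at x)) (at x)" if "x \<in> S" for x
    using has_derivative_transform_within_open[OF d[OF that] \<open>open S\<close> that] Suc.prems(2) by simp
  have eq: "frechet_derivative g (at x) = frechet_derivative f (at x)" if "x \<in> S" for x
    using frechet_derivative_at[OF g[OF that]] by simp
  show ?case
    unfolding Cn_on_Suc_iff
    using Suc.IH[of "\<lambda>x. frechet_derivative f (at x) v" "\<lambda>x. frechet_derivative g (at x) v" for v]
      Suc.prems(1) eq g by (auto simp: Cn_on_Suc_iff)
qed

text \<open>\<open>Cn_on\<close> refers to the operator \<open>frechet_derivative\<close>, whereas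
  differentiation rules produce some derivative \<open>f'\<close>. Uniqueness of derivatives
  identifies the two on S, and openness of S carries this to the higher derivatives. Most closure
  properties below enter through this rule.\<close>

lemma Cn_on_SucI:
  assumes "open S" "\<And>x. x \<in> S \<Longrightarrow> (f has_derivative f' x) (at x)"
    "\<And>v. Cn_on n S (\<lambda>x. f' x v)"
  shows "Cn_on (Suc n) S f"
proof -
  have "f' x = frechet_derivative f (at x)" if "x \<in> S" for x
    using frechet_derivative_at assms(2) that by blast
  then show ?thesis
    using assms Cn_on_cong[OF \<open>open S\<close> assms(3)] by (auto simp: Cn_on_Suc_iff)
qed

lemma Cn_on_SucD: "Cn_on (Suc n) S f \<Longrightarrow> Cn_on n S f"
proof (induction n arbitrary: f)
  case 0
  then show ?case
    by (auto simp: Cn_on_Suc_iff intro!: has_derivative_continuous_on[where f' = "\<lambda>x. frechet_derivative f (at x)"]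
       intro: has_derivative_at_withinI)
next
  case (Suc n)
  then show ?case by (metis Cn_on_Suc_iff)
qed

lemma Cn_on_le: "Cn_on n S f \<Longrightarrow> m \<le> n \<Longrightarrow> Cn_on m S f"
  by (induction n) (auto simp: le_Suc_eq dest: Cn_on_SucD simp del: Cn_on_Suc_iff)

lemma Cn_on_continuous: "Cn_on n S f \<Longrightarrow> continuous_on S f"
  using Cn_on_le[of n S f 0] by simp

lemma Cn_on_has_derivative:
  "Cn_on n S f \<Longrightarrow> 1 \<le> n \<Longrightarrow> x \<in> S \<Longrightarrow> (f has_derivative frechet_derivative f (at x)) (at x)"
  using Cn_on_le[of n S f 1] by simp

lemma Cn_on_derivative:
  "Cn_on (Suc n) S f \<Longrightarrow> Cn_on n S (\<lambda>x. frechet_derivative f (at x) v)"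
  by simp

lemma Cn_on_const [simp]: "Cn_on n S (\<lambda>x. c)"
proof (induction n arbitrary: c)
  case (Suc n)
  then show ?case using frechet_derivative_at[OF has_derivative_const[of c], symmetric] by simp
qed auto

lemma Cn_on_bounded_linear_compose:
  assumes "bounded_linear L" "open S" "Cn_on n S f"
  shows "Cn_on n S (\<lambda>x. L (f x))"
  using assms(3)
proof (induction n arbitrary: f)
  case 0
  then show ?case by (simp add: assms(1) bounded_linear.continuous_on)
next
  case (Suc n)
  show ?case
  proof (rule Cn_on_SucI[OF \<open>open S\<close>])
    show "((\<lambda>x. L (f x)) has_derivative (\<lambda>v. L (frechet_derivative f (at x) v))) (at x)" if "x \<in> S" for x
      using Suc.prems that by (auto simp: Cn_on_Suc_iff intro: bounded_linear.has_derivative[OF assms(1)])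
    show "Cn_on n S (\<lambda>x. L (frechet_derivative f (at x) v))" for v
      using Suc by auto
  qed
qed

lemma Cn_on_id: "open S \<Longrightarrow> Cn_on n S (\<lambda>x. x)"
proof (cases n)
  case (Suc m)
  assume "open S" then show ?thesis unfolding Suc
    by (auto intro!: Cn_on_SucI[where f' = "\<lambda>x v. v"])
qed auto

lemma Cn_on_linear_compose: "linear L \<Longrightarrow> open S \<Longrightarrow> Cn_on n S f \<Longrightarrow> Cn_on n S (\<lambda>x. L (f x))"
  by (simp add: Cn_on_bounded_linear_compose linear_conv_bounded_linear)

lemma Cn_on_add:
  assumes "open S" "Cn_on n S f" "Cn_on n S g"
  shows "Cn_on n S (\<lambda>x. f x + g x)"
  using assms(2,3)
proof (induction n arbitrary: f g)
  case 0
  then show ?case by (simp add: continuous_on_add)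
next
  case (Suc n)
  show ?case
    by (rule Cn_on_SucI[OF \<open>open S\<close>,
          where f' = "\<lambda>x v. frechet_derivative f (at x) v + frechet_derivative g (at x) v"])
      (use Suc in \<open>auto simp: Cn_on_Suc_iff intro!: has_derivative_add\<close>)
qed

lemma Cn_on_minus: "open S \<Longrightarrow> Cn_on n S f \<Longrightarrow> Cn_on n S (\<lambda>x. - f x)"
  using Cn_on_linear_compose[of uminus] by (simp add: linear_uminus)

lemma Cn_on_diff: "open S \<Longrightarrow> Cn_on n S f \<Longrightarrow> Cn_on n S g \<Longrightarrow> Cn_on n S (\<lambda>x. f x - g x)"
  using Cn_on_add[of S n f "\<lambda>x. - g x"] Cn_on_minus by auto

lemma Cn_on_sum:
  assumes "open S" "\<And>i. i \<in> I \<Longrightarrow> Cn_on n S (f i)"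
  shows "Cn_on n S (\<lambda>x. \<Sum>i\<in>I. f i x)"
  using assms(2)
  by (induction I rule: infinite_finite_induct) (auto intro!: Cn_on_add assms(1))

lemma Cn_on_bilinear:
  assumes B: "bounded_bilinear B" and "open S" "Cn_on n S f" "Cn_on n S g"
  shows "Cn_on n S (\<lambda>x. B (f x) (g x))"
  using assms(3,4)
proof (induction n arbitrary: f g)
  case 0
  then show ?case by (simp add: B bounded_bilinear.continuous_on)
next
  case (Suc n)
  have fg: "Cn_on n S f" "Cn_on n S g" using Suc.prems Cn_on_SucD by blast+
  show ?case
    by (rule Cn_on_SucI[OF \<open>open S\<close>,
          where f' = "\<lambda>x v. B (f x) (frechet_derivative g (at x) v) + B (frechet_derivative f (at x) v) (g x)"])
      (use Suc fg in \<open>auto simp: Cn_on_Suc_iff intro!: bounded_bilinear.FDERIV[OF B] Cn_on_add \<open>open S\<close>\<close>)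
qed

lemmas Cn_on_scaleR = Cn_on_bilinear[OF bounded_bilinear_scaleR]
lemmas Cn_on_mult = Cn_on_bilinear[OF bounded_bilinear_mult]
lemmas Cn_on_inner = Cn_on_bilinear[OF bounded_bilinear_inner]

lemma Cn_on_componentwise:
  assumes "open S"
  shows "Cn_on n S f \<longleftrightarrow> (\<forall>b\<in>Basis. Cn_on n S (\<lambda>x. f x \<bullet> b))"
proof
  assume "Cn_on n S f" then show "\<forall>b\<in>Basis. Cn_on n S (\<lambda>x. f x \<bullet> b)"
    by (auto intro!: Cn_on_inner assms)
next
  assume "\<forall>b\<in>Basis. Cn_on n S (\<lambda>x. f x \<bullet> b)"
  then have "Cn_on n S (\<lambda>x. \<Sum>b\<in>Basis. (f x \<bullet> b) *\<^sub>R b)"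
    by (auto intro!: Cn_on_sum Cn_on_scaleR assms)
  then show "Cn_on n S f" by (simp add: euclidean_representation)
qed

lemma linear_eq_sum_Basis:
  assumes "linear L" shows "L v = (\<Sum>b\<in>Basis. (v \<bullet> b) *\<^sub>R L b)"
  using linear_sum[OF assms, of "\<lambda>b. (v \<bullet> b) *\<^sub>R b" Basis]
  by (simp add: euclidean_representation linear_cmul[OF assms])

text \<open>In the chain rule the derivative of the outer map is applied to a vector that moves as
  well, while \<open>Cn_on\<close> speaks only of its values at fixed vectors. Expanding the vector
  in the basis reduces this to products of C^n functions.\<close>

lemma Cn_on_linear_apply:
  assumes "open S" "\<And>x. x \<in> S \<Longrightarrow> linear (L x)" "\<And>b. b \<in> Basis \<Longrightarrow> Cn_on n S (\<lambda>x. L x b)" "Cn_on n S g"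
  shows "Cn_on n S (\<lambda>x. L x (g x))"
proof (rule Cn_on_cong[OF \<open>open S\<close>])
  show "Cn_on n S (\<lambda>x. \<Sum>b\<in>Basis. (g x \<bullet> b) *\<^sub>R L x b)"
    by (auto intro!: Cn_on_sum Cn_on_scaleR Cn_on_inner assms)
  show "\<And>x. x \<in> S \<Longrightarrow> (\<Sum>b\<in>Basis. (g x \<bullet> b) *\<^sub>R L x b) = L x (g x)"
    using linear_eq_sum_Basis assms(2) by metis
qed

lemma Cn_on_compose:
  assumes "open S" "open T" "Cn_on n S f" "Cn_on n T g" "\<And>x. x \<in> S \<Longrightarrow> f x \<in> T"
  shows "Cn_on n S (\<lambda>x. g (f x))"
  using assms(3-)
proof (induction n arbitrary: f g)
  case 0
  then show ?case by (auto intro: continuous_on_compose2)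
next
  case (Suc n)
  have df: "(f has_derivative frechet_derivative f (at x)) (at x)" if "x \<in> S" for x
    using Suc.prems that Cn_on_Suc_iff by blast
  have dg: "(g has_derivative frechet_derivative g (at x)) (at x)" if "x \<in> T" for x
    using Suc.prems that Cn_on_Suc_iff by blast
  show ?case
  proof (rule Cn_on_SucI[OF \<open>open S\<close>])
    show "((\<lambda>x. g (f x)) has_derivative (\<lambda>v. frechet_derivative g (at (f x)) (frechet_derivative f (at x) v))) (at x)"
      if "x \<in> S" for x
      using diff_chain_at[OF df[OF that] dg] Suc.prems(3)[OF that] by (simp add: o_def)
    show "Cn_on n S (\<lambda>x. frechet_derivative g (at (f x)) (frechet_derivative f (at x) v))" for v
    proof (rule Cn_on_linear_apply[OF \<open>open S\<close>, where L = "\<lambda>x. frechet_derivative g (at (f x))"])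
      show "linear (frechet_derivative g (at (f x)))" if "x \<in> S" for x
        using dg Suc.prems(3) that has_derivative_linear by blast
      show "Cn_on n S (\<lambda>x. frechet_derivative g (at (f x)) b)" if "b \<in> Basis" for b
        using Suc.IH[of f "\<lambda>y. frechet_derivative g (at y) b"] Suc.prems Cn_on_SucD by auto
      show "Cn_on n S (\<lambda>x. frechet_derivative f (at x) v)" using Suc.prems by auto
    qed
  qed
qed

lemma Cn_on_inverse:
  fixes f :: "'a::euclidean_space \<Rightarrow> real"
  assumes "open S" "Cn_on n S f" "\<And>x. x \<in> S \<Longrightarrow> f x \<noteq> 0"
  shows "Cn_on n S (\<lambda>x. inverse (f x))"
  using assms(2)
proof (induction n)
  case 0
  then show ?case using assms(3) by (auto intro: continuous_on_inverse)
next
  case (Suc n)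
  have IH: "Cn_on n S (\<lambda>x. inverse (f x))" using Suc Cn_on_SucD by blast
  show ?case
  proof (rule Cn_on_SucI[OF \<open>open S\<close>])
    show "((\<lambda>x. inverse (f x)) has_derivative
         (\<lambda>v. - (inverse (f x) * frechet_derivative f (at x) v * inverse (f x)))) (at x)" if "x \<in> S" for x
      using Suc.prems that assms(3) by (intro Deriv.has_derivative_inverse) auto
    show "Cn_on n S (\<lambda>x. - (inverse (f x) * frechet_derivative f (at x) v * inverse (f x)))" for v
      using Suc.prems by (intro Cn_on_minus Cn_on_mult IH \<open>open S\<close>) auto
  qed
qed

lemma Cn_on_divide:
  fixes f :: "'a::euclidean_space \<Rightarrow> real"
  assumes "open S" "Cn_on n S g" "Cn_on n S f" "\<And>x. x \<in> S \<Longrightarrow> f x \<noteq> 0"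
  shows "Cn_on n S (\<lambda>x. g x / f x)"
  using Cn_on_mult[OF assms(1,2) Cn_on_inverse[OF assms(1,3,4)]] by (simp add: divide_inverse)

lemma Cn_on_Pair:
  assumes "open S" "Cn_on n S f" "Cn_on n S g"
  shows "Cn_on n S (\<lambda>x. (f x, g x))"
proof -
  have "Cn_on n S (\<lambda>x. (f x, 0) + (0, g x))"
    by (intro Cn_on_add assms Cn_on_linear_compose[of "\<lambda>y. (y,0)"] Cn_on_linear_compose[of "\<lambda>y. (0,y)"])
      (auto intro!: linearI)
  then show ?thesis by simp
qed

lemma Cn_on_fst: "open S \<Longrightarrow> Cn_on n S f \<Longrightarrow> Cn_on n S (\<lambda>x. fst (f x))"
  by (rule Cn_on_linear_compose) (auto intro: linear_fst)

lemma Cn_on_snd: "open S \<Longrightarrow> Cn_on n S f \<Longrightarrow> Cn_on n S (\<lambda>x. snd (f x))"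
  by (rule Cn_on_linear_compose) (auto intro: linear_snd)

lemma Cn_on_1_continuous_derivative:
  assumes "Cn_on n S f" "1 \<le> n"
  shows "continuous_on S (\<lambda>x. frechet_derivative f (at x) v)"
  using Cn_on_le[OF assms] by simp

section \<open>Bounded derivatives and local straightening of a real function\<close>

lemma frechet_derivative_bound:
  assumes "Cn_on 1 S f" "compact K" "K \<subseteq> S"
  obtains L where "0 \<le> L" "\<And>y h. y \<in> K \<Longrightarrow> norm (frechet_derivative f (at y) h) \<le> L * norm h"
proof -
  have "\<exists>M. \<forall>y\<in>K. norm (frechet_derivative f (at y) b) \<le> M" for b
  proof -
    have "continuous_on K (\<lambda>y. norm (frechet_derivative f (at y) b))"
      using Cn_on_1_continuous_derivative[OF assms(1)] assms(3)
      by (intro continuous_on_norm) (auto intro: continuous_on_subset)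
    then have "bounded ((\<lambda>y. norm (frechet_derivative f (at y) b)) ` K)"
      using assms(2) compact_continuous_image compact_imp_bounded by blast
    then show ?thesis by (auto simp: bounded_iff)
  qed
  then obtain M where M: "\<And>b y. y \<in> K \<Longrightarrow> norm (frechet_derivative f (at y) b) \<le> M b" by metis
  let ?L = "\<Sum>b\<in>Basis. \<bar>M b\<bar>"
  have "norm (frechet_derivative f (at y) h) \<le> ?L * norm h" if "y \<in> K" for y h
  proof -
    have lin: "linear (frechet_derivative f (at y))"
      using Cn_on_has_derivative[OF assms(1)] that assms(3) has_derivative_linear by blast
    have "norm (frechet_derivative f (at y) h) \<le> (\<Sum>b\<in>Basis. norm ((h \<bullet> b) *\<^sub>R frechet_derivative f (at y) b))"
      unfolding linear_eq_sum_Basis[OF lin, of h] by (rule norm_sum)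
    also have "\<dots> \<le> (\<Sum>b\<in>Basis. \<bar>M b\<bar> * norm h)"
    proof (rule sum_mono)
      fix b :: 'a assume "b \<in> Basis"
      have "norm (frechet_derivative f (at y) b) \<le> \<bar>M b\<bar>" using M[OF that, of b] by linarith
      then show "norm ((h \<bullet> b) *\<^sub>R frechet_derivative f (at y) b) \<le> \<bar>M b\<bar> * norm h"
        using mult_mono[of "norm (frechet_derivative f (at y) b)" "\<bar>M b\<bar>" "\<bar>h \<bullet> b\<bar>" "norm h"]
          Basis_le_norm[OF \<open>b \<in> Basis\<close>, of h] by (simp add: mult.commute)
    qed
    finally show ?thesis by (simp add: sum_distrib_right)
  qed
  moreover have "0 \<le> ?L" by (simp add: sum_nonneg)
  ultimately show thesis using that by blast
qed

text \<open>The map \<Psi> replaces the coordinate along b by the value of g. Its derivative is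
  invertible where g has nonzero derivative along b, so the inverse function theorem provides
  \<Phi>, in whose coordinates g is the coordinate along b. The domain W is an open ball whose
  closed ball still lies in the domain of \<Phi>; compactness makes the bound L uniform.\<close>

lemma straighten:
  fixes g :: "'a::euclidean_space \<Rightarrow> real"
  assumes "open V" "a \<in> V" and g: "Cn_on k V g" and "1 \<le> k" and b: "b \<in> Basis"
    and nz: "frechet_derivative g (at a) b \<noteq> 0"
  obtains V' W \<Phi> L where "open V'" "a \<in> V'" "V' \<subseteq> V" "open W"
    "\<And>x. x \<in> V' \<Longrightarrow> frechet_derivative g (at x) b \<noteq> 0"
    "\<And>x. x \<in> V' \<Longrightarrow> x + (g x - x \<bullet> b) *\<^sub>R b \<in> W"
    "\<And>x. x \<in> V' \<Longrightarrow> \<Phi> (x + (g x - x \<bullet> b) *\<^sub>R b) = x"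
    "\<And>y. y \<in> W \<Longrightarrow> \<Phi> y \<in> V'" "\<And>y. y \<in> W \<Longrightarrow> g (\<Phi> y) = y \<bullet> b"
    "\<And>y i. y \<in> W \<Longrightarrow> i \<in> Basis \<Longrightarrow> i \<noteq> b \<Longrightarrow> \<Phi> y \<bullet> i = y \<bullet> i"
    "Cn_on k W \<Phi>" "0 \<le> L" "\<And>y h. y \<in> W \<Longrightarrow> norm (frechet_derivative \<Phi> (at y) h) \<le> L * norm h"
proof -
  define D where "D = (\<lambda>x. frechet_derivative g (at x))"
  define V1 where "V1 = {x\<in>V. D x b \<noteq> 0}"
  have contD: "continuous_on V (\<lambda>x. D x v)" for v
    unfolding D_def using Cn_on_1_continuous_derivative[OF g \<open>1 \<le> k\<close>] .
  have "open (V \<inter> (\<lambda>x. D x b) -` (- {0}))"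
    using continuous_open_preimage[OF contD \<open>open V\<close>, of "- {0}"] by (auto simp: open_Compl)
  moreover have "V1 = V \<inter> (\<lambda>x. D x b) -` (- {0})" by (auto simp: V1_def)
  ultimately have "open V1" by simp
  have "V1 \<subseteq> V" "a \<in> V1" using nz assms by (auto simp: V1_def D_def)
  have bb: "b \<bullet> b = 1" using b by simp
  have gd: "(g has_derivative D x) (at x)" if "x \<in> V" for x
    using Cn_on_has_derivative[OF g \<open>1 \<le> k\<close> that] by (simp add: D_def)
  have Dbl: "bounded_linear (D x)" if "x \<in> V" for x using gd[OF that] has_derivative_bounded_linear by blast
  have Dl: "D x (u + v) = D x u + D x v" "D x (u - v) = D x u - D x v" "D x (c *\<^sub>R v) = c * D x v"
    if "x \<in> V" for x u v c
    using Dbl[OF that] by (auto simp: linear_simps)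
  define \<Psi> where "\<Psi> = (\<lambda>x. x + (g x - x \<bullet> b) *\<^sub>R b)"
  define \<Psi>' where "\<Psi>' = (\<lambda>x v. v + (D x v - v \<bullet> b) *\<^sub>R b)"
  \<comment> \<open>The inverse of \<open>\<Psi>' x\<close>: a vector v and its image w agree off b,
    and w has b-component \<open>D x v\<close>; this equation is solved for the b-component of
    v.\<close>
  define I where "I = (\<lambda>x w. (w - (w \<bullet> b) *\<^sub>R b) + ((w \<bullet> b - D x (w - (w \<bullet> b) *\<^sub>R b)) / D x b) *\<^sub>R b)"
  have Id: "I x (\<Psi>' x v) = v" if "x \<in> V1" for x v
    using that \<open>V1 \<subseteq> V\<close> bb
    by (auto simp: I_def \<Psi>'_def Dl V1_def subset_iff inner_add_left inner_diff_left field_simps)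
  have Id2: "\<Psi>' x (I x w) = w" if "x \<in> V1" for x w
    using that \<open>V1 \<subseteq> V\<close> bb
    by (auto simp: I_def \<Psi>'_def Dl V1_def subset_iff inner_add_left inner_diff_left field_simps)
  have \<Psi>'bl: "bounded_linear (\<Psi>' x)" if "x \<in> V" for x
    unfolding \<Psi>'_def using Dbl[OF that]
    by (intro bounded_linear_add bounded_linear_ident bounded_linear_scaleR_const bounded_linear_sub
         bounded_linear_inner_left)
  have Ibl: "bounded_linear (I x)" if "x \<in> V" for x
    unfolding I_def divide_inverse using Dbl[OF that]
    by (intro bounded_linear_add bounded_linear_ident bounded_linear_scaleR_const bounded_linear_sub
         bounded_linear_inner_left bounded_linear_mult_const bounded_linear_compose[OF Dbl[OF that]])
  define \<Psi>b where "\<Psi>b = (\<lambda>x. Blinfun (\<Psi>' x))"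
  have \<Psi>b: "blinfun_apply (\<Psi>b x) = \<Psi>' x" if "x \<in> V" for x
    by (simp add: \<Psi>b_def bounded_linear_Blinfun_apply \<Psi>'bl that)
  have d\<Psi>: "(\<Psi> has_derivative \<Psi>' x) (at x)" if "x \<in> V" for x
    unfolding \<Psi>_def \<Psi>'_def by (auto intro!: derivative_eq_intros gd that)
  have d\<Psi>b: "(\<Psi> has_derivative blinfun_apply (\<Psi>b x)) (at x)" if "x \<in> V1" for x
    using d\<Psi> \<Psi>b that \<open>V1 \<subseteq> V\<close> by auto
  have cb: "continuous_on V1 \<Psi>b"
  proof (rule continuous_on_blinfun_componentwise)
    fix i :: 'a
    have "continuous_on V1 (\<lambda>x. \<Psi>' x i)" unfolding \<Psi>'_def
      by (intro continuous_intros continuous_on_subset[OF contD \<open>V1 \<subseteq> V\<close>])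
    then show "continuous_on V1 (\<lambda>x. blinfun_apply (\<Psi>b x) i)"
      using \<open>V1 \<subseteq> V\<close> by (subst continuous_on_cong[OF refl, where g = "\<lambda>x. \<Psi>' x i"]) (auto simp: \<Psi>b)
  qed
  have invf: "Blinfun (I a) o\<^sub>L \<Psi>b a = id_blinfun"
    by (rule blinfun_eqI)
      (use \<open>a \<in> V1\<close> \<open>a \<in> V\<close> in \<open>simp add: bounded_linear_Blinfun_apply Ibl \<Psi>b Id\<close>)
  obtain U' V2 \<Phi> \<Phi>' where U': "open U'" "U' \<subseteq> V1" "a \<in> U'" and V2: "open V2" "\<Psi> a \<in> V2"
    and hom: "homeomorphism U' V2 \<Psi> \<Phi>"
    and d\<Phi>: "\<And>y. y \<in> V2 \<Longrightarrow> (\<Phi> has_derivative (\<Phi>' y)) (at y)"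
    and \<Phi>': "\<And>y. y \<in> V2 \<Longrightarrow> \<Phi>' y = inv (blinfun_apply (\<Psi>b (\<Phi> y)))"
    and bij: "\<And>y. y \<in> V2 \<Longrightarrow> bij (blinfun_apply (\<Psi>b (\<Phi> y)))"
    using inverse_function_theorem[OF \<open>open V1\<close> d\<Psi>b cb \<open>a \<in> V1\<close> invf] by blast
  have \<Phi>U: "\<Phi> y \<in> U'" if "y \<in> V2" for y using hom that by (auto simp: homeomorphism_def)
  have \<Phi>V: "\<Phi> y \<in> V" "\<Phi> y \<in> V1" if "y \<in> V2" for y using \<Phi>U[OF that] U' \<open>V1 \<subseteq> V\<close> by auto
  have \<Psi>\<Phi>: "\<Psi> (\<Phi> y) = y" if "y \<in> V2" for y using hom that by (auto simp: homeomorphism_def)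
  have "\<Phi>' y = I (\<Phi> y)" if "y \<in> V2" for y
    using inv_unique_comp[of "\<Psi>' (\<Phi> y)" "I (\<Phi> y)"] Id Id2 \<Phi>V[OF that] \<Phi>'[OF that]
    by (auto simp: fun_eq_iff \<Psi>b)
  with d\<Phi> have dI: "(\<Phi> has_derivative I (\<Phi> y)) (at y)" if "y \<in> V2" for y using that by metis
  \<comment> \<open>The derivative of \<Phi> at y is \<open>I (\<Phi> y)\<close>, rational in the
    derivatives of g at \<open>\<Phi> y\<close>. So if \<Phi> is C^n and g is C^(n+1), this
    derivative is C^n, and the regularity of \<Phi> climbs up to k.\<close>
  have Ck: "Cn_on n V2 \<Phi>" if "n \<le> k" for n
    using that
  proof (induction n)
    case 0
    have "continuous_on V2 \<Phi>" using dI
      by (auto intro!: continuous_at_imp_continuous_on intro: has_derivative_continuous)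
    then show ?case by simp
  next
    case (Suc n)
    then have IH: "Cn_on n V2 \<Phi>" by simp
    have "Cn_on (Suc n) V g" using Cn_on_le[OF g] Suc.prems by blast
    then have "Cn_on n V (\<lambda>x. D x v)" for v unfolding D_def by simp
    then have D\<Phi>: "Cn_on n V2 (\<lambda>y. D (\<Phi> y) v)" for v
      using Cn_on_compose[OF V2(1) \<open>open V\<close> IH] \<Phi>V by blast
    show ?case
    proof (rule Cn_on_SucI[OF V2(1) dI])
      show "Cn_on n V2 (\<lambda>x. I (\<Phi> x) v)" for v
        unfolding I_def using \<Phi>V
        by (intro Cn_on_add Cn_on_diff Cn_on_scaleR Cn_on_divide D\<Phi> Cn_on_const V2(1)) (auto simp: V1_def)
    qed
  qed
  obtain e where e: "e > 0" "cball (\<Psi> a) e \<subseteq> V2" using V2 open_contains_cball by blast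
  obtain L where L: "0 \<le> L"
    "\<And>y h. y \<in> cball (\<Psi> a) e \<Longrightarrow> norm (frechet_derivative \<Phi> (at y) h) \<le> L * norm h"
    using frechet_derivative_bound[OF Ck[OF \<open>1 \<le> k\<close>] compact_cball e(2)] by blast
  define W where "W = ball (\<Psi> a) e"
  have WV2: "W \<subseteq> V2" using e(2) unfolding W_def by (meson ball_subset_cball order_trans)
  define V' where "V' = U' \<inter> \<Psi> -` W"
  have "continuous_on U' \<Psi>" using hom by (auto simp: homeomorphism_def)
  then have oV': "open V'" unfolding V'_def W_def
    using U'(1) by (simp add: continuous_open_preimage)
  have \<Phi>V': "\<Phi> y \<in> V'" if "y \<in> W" for y
    using that WV2 \<Phi>U \<Psi>\<Phi> by (auto simp: V'_def)
  show thesis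
  proof (rule that[of V' W \<Phi> L])
    show "open V'" by fact
    show "a \<in> V'" using U' e by (auto simp: V'_def W_def)
    show "V' \<subseteq> V" using U' \<open>V1 \<subseteq> V\<close> by (auto simp: V'_def)
    show "open W" by (simp add: W_def)
    show "frechet_derivative g (at x) b \<noteq> 0" if "x \<in> V'" for x
      using that U' by (auto simp: V'_def V1_def D_def)
    show "x + (g x - x \<bullet> b) *\<^sub>R b \<in> W" if "x \<in> V'" for x
      using that by (auto simp: V'_def \<Psi>_def)
    show "\<Phi> (x + (g x - x \<bullet> b) *\<^sub>R b) = x" if "x \<in> V'" for x
      using that hom by (auto simp: V'_def \<Psi>_def homeomorphism_def)
    show "\<Phi> y \<in> V'" if "y \<in> W" for y by (rule \<Phi>V'[OF that])
    have eq: "\<Phi> y + (g (\<Phi> y) - \<Phi> y \<bullet> b) *\<^sub>R b = y" if "y \<in> W" for y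
      using \<Psi>\<Phi> that WV2 by (auto simp: \<Psi>_def)
    show "g (\<Phi> y) = y \<bullet> b" if "y \<in> W" for y
      using arg_cong[OF eq[OF that], of "\<lambda>z. z \<bullet> b"] bb by (simp add: inner_add_left)
    show "\<Phi> y \<bullet> i = y \<bullet> i" if "y \<in> W" "i \<in> Basis" "i \<noteq> b" for y i
      using arg_cong[OF eq[OF that(1)], of "\<lambda>z. z \<bullet> i"] that b
      by (simp add: inner_add_left inner_not_same_Basis)
    show "Cn_on k W \<Phi>" using Cn_on_subset[OF Ck[OF order_refl] WV2] .
    show "0 \<le> L" by fact
    show "norm (frechet_derivative \<Phi> (at y) h) \<le> L * norm h" if "y \<in> W" for y h
      using L(2) that by (auto simp: W_def)
  qed
qed

section \<open>Morse's vanishing lemma\<close>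

text \<open>The Lindelof property, with the subcover indexed by points so that data chosen at each
  point remain available.\<close>

lemma countable_subcover:
  fixes A :: "'a::euclidean_space set"
  assumes "\<And>a. a \<in> A \<Longrightarrow> open (N a) \<and> a \<in> N a"
  obtains A0 where "countable A0" "A0 \<subseteq> A" "A \<subseteq> (\<Union>a\<in>A0. N a)"
proof -
  have "\<And>S. S \<in> N ` A \<Longrightarrow> open S" using assms by auto
  from Lindelof[OF this] obtain F' where F': "F' \<subseteq> N ` A" "countable F'" "\<Union>F' = \<Union>(N ` A)"
    by blast
  have "\<exists>A0. countable A0 \<and> A0 \<subseteq> A \<and> F' = N ` A0"
    by (rule countable_subset_image[THEN iffD1, OF conjI[OF F'(2,1)]])
  then obtain A0 where A0: "countable A0" "A0 \<subseteq> A" "F' = N ` A0" by blast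
  have "A \<subseteq> (\<Union>a\<in>A0. N a)" using F'(3) A0(3) assms by blast
  then show thesis using that A0(1,2) by blast
qed

lemma mem_span_Basis_iff:
  "D \<subseteq> Basis \<Longrightarrow> x \<in> span D \<longleftrightarrow> (\<forall>c\<in>Basis. c \<notin> D \<longrightarrow> x \<bullet> c = 0)"
  by (simp add: span_substd_basis)

text \<open>Mean value estimate along the segment from y to x, which convexity keeps in B. The image
  of the segment under \<psi> has its velocity in \<open>span D\<close>, so only the derivatives of
  h along D enter. Each is at most C |x - y|^k, the velocity supplies the additional factor L |x -
  y|, and \<open>card D\<close> counts the summands.\<close>

lemma flat_integrate:
  fixes h :: "'a::euclidean_space \<Rightarrow> 'b::euclidean_space"
  assumes B: "open B" "convex B" and D: "D \<subseteq> Basis"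
    and \<psi>: "\<And>x. x \<in> B \<Longrightarrow> (\<psi> has_derivative \<psi>' x) (at x)"
    and L: "\<And>x v. x \<in> B \<Longrightarrow> norm (\<psi>' x v) \<le> L * norm v" "0 \<le> L"
    and \<psi>O: "\<psi> ` B \<subseteq> S" and \<psi>D: "\<psi> ` (B \<inter> span D') \<subseteq> span D"
    and h: "Cn_on 1 S h"
    and x: "x \<in> B \<inter> span D'" and y: "y \<in> B \<inter> span D'"
    and bd: "\<And>b z. b \<in> D \<Longrightarrow> z \<in> B \<inter> span D' \<Longrightarrow>
        norm (frechet_derivative h (at (\<psi> z)) b) \<le> C * norm (z - y) ^ k" and "0 \<le> C"
  shows "norm (h (\<psi> x) - h (\<psi> y)) \<le> real (card D) * C * L * norm (x - y) ^ Suc k"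
proof -
  define u where "u = x - y"
  define p where "p = (\<lambda>t::real. y + t *\<^sub>R u)"
  have fD: "finite D" using D finite_subset finite_Basis by blast
  have us: "u \<in> span D'" using x y by (auto simp: u_def span_diff)
  have ps: "p t \<in> span D'" for t using us y by (auto simp: p_def span_add span_scale)
  have pB: "p t \<in> B" if "t \<in> {0..1}" for t
  proof -
    have "p t = (1 - t) *\<^sub>R y + t *\<^sub>R x" by (simp add: p_def u_def algebra_simps)
    then show ?thesis using convexD_alt[OF B(2), of y x t] x y that by (metis IntD1 atLeastAtMost_iff)
  qed
  have dp: "(p has_derivative (\<lambda>s. s *\<^sub>R u)) (at t)" for t
    unfolding p_def by (auto intro!: derivative_eq_intros)
  \<comment> \<open>Along the segment the coordinates of \<psi> outside D vanish identically, hence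
    so do those of its velocity.\<close>
  have wD: "\<psi>' (p t) u \<in> span D" if t: "t \<in> {0..1}" for t
    unfolding mem_span_Basis_iff[OF D]
  proof (intro ballI impI)
    fix c :: 'a assume c: "c \<in> Basis" "c \<notin> D"
    have d: "((\<lambda>s. \<psi> (p s) \<bullet> c) has_derivative (\<lambda>s. \<psi>' (p t) (s *\<^sub>R u) \<bullet> c)) (at t)"
      using has_derivative_inner_left[OF diff_chain_at[OF dp \<psi>[OF pB[OF t]]], of c] by (simp add: o_def)
    have contp: "continuous (at s) p" for s using dp has_derivative_continuous by blast
    have "open (p -` B)"
      using B(1) contp by (metis continuous_at_imp_continuous_on open_vimage)
    moreover have "t \<in> p -` B" using pB[OF t] by simp
    moreover have "\<psi> (p s) \<bullet> c = 0" if "s \<in> p -` B" for s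
      using \<psi>D ps that c by (force simp: mem_span_Basis_iff[OF D])
    ultimately have "((\<lambda>s. 0) has_derivative (\<lambda>s. \<psi>' (p t) (s *\<^sub>R u) \<bullet> c)) (at t)"
      by (rule has_derivative_transform_within_open[OF d])
    then have "(\<lambda>s. \<psi>' (p t) (s *\<^sub>R u) \<bullet> c) = (\<lambda>s. 0)"
      by (rule has_derivative_unique[OF _ has_derivative_const])
    then show "\<psi>' (p t) u \<bullet> c = 0" by (metis scaleR_one)
  qed
  have dh: "(h has_derivative frechet_derivative h (at (\<psi> (p t)))) (at (\<psi> (p t)))" if "t \<in> {0..1}" for t
    using Cn_on_has_derivative[OF h] \<psi>O pB[OF that] by auto
  define M where "M = real (card D) * C * L * norm u ^ Suc k"
  have "0 \<le> M" using \<open>0 \<le> C\<close> \<open>0 \<le> L\<close> by (simp add: M_def)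
  define \<phi>' where "\<phi>' = (\<lambda>t s. frechet_derivative h (at (\<psi> (p t))) (\<psi>' (p t) (s *\<^sub>R u)))"
  have d\<phi>: "((\<lambda>t. h (\<psi> (p t))) has_derivative \<phi>' t) (at t within {0..1})" if "t \<in> {0..1}" for t
  proof -
    have "((\<lambda>t. \<psi> (p t)) has_derivative (\<lambda>s. \<psi>' (p t) (s *\<^sub>R u))) (at t)"
      using diff_chain_at[OF dp \<psi>[OF pB[OF that]]] by (simp add: o_def)
    from diff_chain_at[OF this dh[OF that]]
    have "((\<lambda>t. h (\<psi> (p t))) has_derivative \<phi>' t) (at t)" by (simp add: o_def \<phi>'_def)
    then show ?thesis by (rule has_derivative_at_withinI)
  qed
  have on: "onorm (\<phi>' t) \<le> M" if t: "t \<in> {0..1}" for t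
  proof (rule onorm_bound[OF \<open>0 \<le> M\<close>])
    fix s :: real
    have lin: "linear (frechet_derivative h (at (\<psi> (p t))))" using dh[OF t] has_derivative_linear by blast
    have lin\<psi>: "linear (\<psi>' (p t))" using \<psi>[OF pB[OF t]] has_derivative_linear by blast
    define w where "w = \<psi>' (p t) u"
    have w: "norm w \<le> L * norm u" using L(1)[OF pB[OF t]] by (simp add: w_def)
    have "\<phi>' t s = s *\<^sub>R frechet_derivative h (at (\<psi> (p t))) w"
      by (simp add: \<phi>'_def w_def linear_cmul[OF lin] linear_cmul[OF lin\<psi>])
    also have "frechet_derivative h (at (\<psi> (p t))) w
        = (\<Sum>b\<in>D. (w \<bullet> b) *\<^sub>R frechet_derivative h (at (\<psi> (p t))) b)"
      unfolding linear_eq_sum_Basis[OF lin, of w]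
      using wD[OF t] D by (intro sum.mono_neutral_right) (auto simp: mem_span_Basis_iff w_def)
    finally have eq: "\<phi>' t s = s *\<^sub>R (\<Sum>b\<in>D. (w \<bullet> b) *\<^sub>R frechet_derivative h (at (\<psi> (p t))) b)" .
    have "norm (\<phi>' t s) \<le> \<bar>s\<bar> * (\<Sum>b\<in>D. norm ((w \<bullet> b) *\<^sub>R frechet_derivative h (at (\<psi> (p t))) b))"
      unfolding eq norm_scaleR[of s] by (intro mult_left_mono norm_sum abs_ge_zero)
    moreover have "(\<Sum>b\<in>D. norm ((w \<bullet> b) *\<^sub>R frechet_derivative h (at (\<psi> (p t))) b))
        \<le> (\<Sum>b\<in>D. (L * norm u) * (C * norm u ^ k))"
    proof (rule sum_mono)
      fix b assume "b \<in> D"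
      then have "\<bar>w \<bullet> b\<bar> \<le> L * norm u" using Basis_le_norm[of b w] D w by auto
      moreover have "norm (frechet_derivative h (at (\<psi> (p t))) b) \<le> C * norm u ^ k"
      proof -
        have "norm (p t - y) ^ k \<le> norm u ^ k"
          using t by (intro power_mono) (auto simp: p_def mult_left_le_one_le)
        then show ?thesis using bd[OF \<open>b \<in> D\<close>, of "p t"] pB[OF t] ps \<open>0 \<le> C\<close>
          by (meson IntI mult_left_mono order_trans)
      qed
      ultimately show "norm ((w \<bullet> b) *\<^sub>R frechet_derivative h (at (\<psi> (p t))) b) \<le> L * norm u * (C * norm u ^ k)"
        using \<open>0 \<le> L\<close> by (simp add: mult_mono)
    qed
    moreover have "(\<Sum>b\<in>D. (L * norm u) * (C * norm u ^ k)) = M" by (simp add: M_def)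
    ultimately have "norm (\<phi>' t s) \<le> \<bar>s\<bar> * M" by (metis abs_ge_zero mult_left_mono order_trans)
    then show "norm (\<phi>' t s) \<le> M * norm s" by (simp add: mult.commute)
  qed
  have "norm (h (\<psi> (p 1)) - h (\<psi> (p 0))) \<le> M * norm (1 - 0 :: real)"
    by (rule differentiable_bound[of "{0..1}" _ \<phi>']) (auto intro: d\<phi> on)
  then show ?thesis by (simp add: p_def M_def u_def)
qed

text \<open>The sets E cover the common zeros A of a class of functions; on each of them, after the
  parametrization psi by a coordinate subspace, every C^k function that vanishes on A is k-flat.\<close>

definition flat_piece ::
    "'a::euclidean_space set \<Rightarrow> 'a set \<Rightarrow> nat \<Rightarrow> 'a set \<Rightarrow> 'a set \<times> 'a set \<times> ('a \<Rightarrow> 'a) \<times> 'a set \<Rightarrow> bool" where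
  "flat_piece S D k A = (\<lambda>(D', B, \<psi>, E).
     D' \<subseteq> D \<and> open B \<and> convex B \<and> bounded B \<and> E \<subseteq> A \<and> E \<subseteq> \<psi> ` (B \<inter> span D') \<and>
     \<psi> ` B \<subseteq> S \<and> \<psi> ` (B \<inter> span D') \<subseteq> span D \<and>
     (\<exists>\<psi>' L. 0 \<le> L \<and> (\<forall>x\<in>B. (\<psi> has_derivative \<psi>' x) (at x) \<and> (\<forall>v. norm (\<psi>' x v) \<le> L * norm v))) \<and>
     (\<forall>f :: 'a \<Rightarrow> real. Cn_on k S f \<longrightarrow> (\<forall>x\<in>A. f x = 0) \<longrightarrow>
        (\<exists>C\<ge>0. \<forall>x\<in>B \<inter> span D'. \<forall>y\<in>B \<inter> span D'. \<psi> y \<in> E \<longrightarrow> \<bar>f (\<psi> x)\<bar> \<le> C * norm (x - y) ^ k)))"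

definition flat_cover :: "'a::euclidean_space set \<Rightarrow> 'a set \<Rightarrow> nat \<Rightarrow> 'a set \<Rightarrow> bool" where
  "flat_cover S D k A \<longleftrightarrow>
     (\<exists>P. countable P \<and> (\<forall>p\<in>P. flat_piece S D k A p) \<and> A \<subseteq> (\<Union>(D', B, \<psi>, E)\<in>P. E))"

lemma flat_piece_derivative:
  "flat_piece S D k A (D', B, \<psi>, E) \<Longrightarrow>
    \<exists>\<psi>' L. 0 \<le> L \<and> (\<forall>x\<in>B. (\<psi> has_derivative \<psi>' x) (at x) \<and> (\<forall>v. norm (\<psi>' x v) \<le> L * norm v))"
  unfolding flat_piece_def split by (elim conjE)

lemma flat_piece_vanish:
  fixes f :: "'a::euclidean_space \<Rightarrow> real"
  assumes "flat_piece S D k A (D', B, \<psi>, E)" "Cn_on k S f" "\<forall>x\<in>A. f x = 0"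
  shows "\<exists>C\<ge>0. \<forall>x\<in>B \<inter> span D'. \<forall>y\<in>B \<inter> span D'. \<psi> y \<in> E \<longrightarrow> \<bar>f (\<psi> x)\<bar> \<le> C * norm (x - y) ^ k"
  using assms(1) unfolding flat_piece_def split
  by (elim conjE allE[where x = f] impE) (use assms in auto)

text \<open>Test functions must be C^k on S and vanish on A, so enlarging S or A leaves fewer of
  them. The other conditions that mention S or A are inclusions into them.\<close>

lemma flat_piece_mono:
  assumes p: "flat_piece S D k A p" and "S \<subseteq> S'" "A \<subseteq> A'"
  shows "flat_piece S' D k A' p"
proof -
  obtain D' B \<psi> E where eq: "p = (D', B, \<psi>, E)" by (cases p) auto
  have "Cn_on k S' f \<Longrightarrow> \<forall>x\<in>A'. f x = 0 \<Longrightarrow> Cn_on k S f \<and> (\<forall>x\<in>A. f x = 0)" for f :: "'a \<Rightarrow> real"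
    using assms Cn_on_subset by blast
  then show ?thesis
    using p assms(2,3) unfolding eq flat_piece_def by (auto 0 3)
qed

lemma flat_coverE:
  assumes "flat_cover S D k A"
  obtains P where "countable P" "\<forall>p\<in>P. flat_piece S D k A p" "A \<subseteq> (\<Union>(D', B, \<psi>, E)\<in>P. E)"
  using assms unfolding flat_cover_def by (elim exE conjE)

lemma flat_cover_UN:
  assumes "countable I" "\<And>i. i \<in> I \<Longrightarrow> flat_cover (S' i) D k (A' i)"
    "\<And>i. i \<in> I \<Longrightarrow> S' i \<subseteq> S" "\<And>i. i \<in> I \<Longrightarrow> A' i \<subseteq> A" "A \<subseteq> (\<Union>i\<in>I. A' i)"
  shows "flat_cover S D k A"
proof -
  obtain P where P: "\<And>i. i \<in> I \<Longrightarrow> countable (P i) \<and> (\<forall>p\<in>P i. flat_piece (S' i) D k (A' i) p) \<and>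
      A' i \<subseteq> (\<Union>(D', B, \<psi>, E)\<in>P i. E)"
    using assms(2) unfolding flat_cover_def by metis
  show ?thesis unfolding flat_cover_def
  proof (intro exI conjI)
    show "countable (\<Union>i\<in>I. P i)" using assms(1) P by blast
    show "\<forall>p\<in>\<Union>i\<in>I. P i. flat_piece S D k A p"
    proof
      fix p assume "p \<in> (\<Union>i\<in>I. P i)"
      then obtain i where i: "i \<in> I" "p \<in> P i" by blast
      then have "flat_piece (S' i) D k (A' i) p" using P by blast
      then show "flat_piece S D k A p" using assms(3,4)[OF i(1)] by (rule flat_piece_mono)
    qed
    show "A \<subseteq> (\<Union>(D', B, \<psi>, E)\<in>\<Union>i\<in>I. P i. E)"
    proof
      fix x assume "x \<in> A"
      then obtain i where i: "i \<in> I" "x \<in> A' i" using assms(5) by blast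
      then have "x \<in> (\<Union>(D', B, \<psi>, E)\<in>P i. E)" using P by blast
      then show "x \<in> (\<Union>(D', B, \<psi>, E)\<in>\<Union>i\<in>I. P i. E)" using i(1) by blast
    qed
  qed
qed

text \<open>Flatness of order 0 is boundedness, which a continuous function has on balls whose
  closures are compact subsets of S. The identity serves as parametrization.\<close>

lemma flat_cover_0:
  assumes "open S" "D \<subseteq> Basis" "A \<subseteq> S \<inter> span D"
  shows "flat_cover S D 0 A"
proof -
  have "\<exists>e>0. cball a e \<subseteq> S" if "a \<in> A" for a using that assms open_contains_cball by blast
  then obtain e where e: "\<And>a. a \<in> A \<Longrightarrow> e a > 0 \<and> cball a (e a) \<subseteq> S" by metis
  obtain A0 where A0: "countable A0" "A0 \<subseteq> A" "A \<subseteq> (\<Union>a\<in>A0. ball a (e a))"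
    using countable_subcover[of A "\<lambda>a. ball a (e a)"] e by auto
  show ?thesis unfolding flat_cover_def
  proof (intro exI[of _ "(\<lambda>a. (D, ball a (e a), \<lambda>x. x, A \<inter> ball a (e a))) ` A0"] conjI ballI)
    show "countable ((\<lambda>a. (D, ball a (e a), \<lambda>x. x, A \<inter> ball a (e a))) ` A0)" using A0 by simp
    show "A \<subseteq> (\<Union>(D', B, \<psi>, E)\<in>(\<lambda>a. (D, ball a (e a), \<lambda>x. x, A \<inter> ball a (e a))) ` A0. E)"
      using A0 by force
    fix p :: "'a set \<times> 'a set \<times> ('a \<Rightarrow> 'a) \<times> 'a set"
    assume "p \<in> (\<lambda>a. (D, ball a (e a), \<lambda>x. x, A \<inter> ball a (e a))) ` A0"
    then obtain a where a: "a \<in> A" and p: "p = (D, ball a (e a), \<lambda>x. x, A \<inter> ball a (e a))" using A0 by blast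
    have "\<exists>C\<ge>0. \<forall>x\<in>ball a (e a). \<bar>f x\<bar> \<le> C" if "continuous_on S f" for f :: "'a \<Rightarrow> real"
    proof -
      have "bounded (f ` cball a (e a))"
        using that e[OF a] by (meson compact_cball compact_continuous_image compact_imp_bounded continuous_on_subset)
      then obtain C where "\<forall>x\<in>cball a (e a). \<bar>f x\<bar> \<le> C" unfolding bounded_iff by auto
      then have "\<forall>x\<in>ball a (e a). \<bar>f x\<bar> \<le> \<bar>C\<bar>" by (metis abs_ge_self abs_ge_zero ball_subset_cball order_trans subsetD)
      then show ?thesis by (metis abs_ge_zero)
    qed
    then have *: "Cn_on 0 S f \<Longrightarrow> \<exists>C\<ge>0. \<forall>x\<in>ball a (e a). \<bar>f x\<bar> \<le> C" for f :: "'a \<Rightarrow> real" by simp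
    have "ball a (e a) \<subseteq> S" using e[OF a] by (meson ball_subset_cball order_trans)
    moreover have "\<exists>\<psi>' L. 0 \<le> L \<and> (\<forall>x\<in>ball a (e a). ((\<lambda>x. x) has_derivative \<psi>' x) (at x) \<and> (\<forall>v. norm (\<psi>' x v) \<le> L * norm v))"
      by (rule exI[of _ "\<lambda>x v. v"], rule exI[of _ 1]) auto
    moreover have "\<exists>C\<ge>0. \<forall>x\<in>ball a (e a) \<inter> span D. \<forall>y\<in>ball a (e a) \<inter> span D.
        y \<in> A \<inter> ball a (e a) \<longrightarrow> \<bar>f x\<bar> \<le> C * norm (x - y) ^ 0" if "Cn_on 0 S f" for f :: "'a \<Rightarrow> real"
    proof -
      from *[OF that] obtain C where "C \<ge> 0" "\<forall>x\<in>ball a (e a). \<bar>f x\<bar> \<le> C" by blast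
      then show ?thesis by (intro exI[of _ C]) simp
    qed
    ultimately show "flat_piece S D 0 A p"
      unfolding p flat_piece_def split
      by (intro conjI allI impI) (use assms in auto)
  qed
qed

text \<open>A piece found in straightened coordinates is carried back by \<Phi>: a test function f
  on V becomes f composed with \<Phi> on W, and the parametrization gains the Lipschitz factor L1.
  In the application D1 is D without the straightened direction.\<close>

lemma flat_piece_push:
  assumes W: "open V" "open W" and \<Phi>: "Cn_on k W \<Phi>" "1 \<le> k" "\<And>y. y \<in> W \<Longrightarrow> \<Phi> y \<in> V"
    and inv: "\<And>x. x \<in> V \<Longrightarrow> \<Phi> (\<Psi> x) = x" "\<And>y. y \<in> W \<Longrightarrow> \<Psi> (\<Phi> y) = y"
    and L1: "0 \<le> L1" "\<And>y v. y \<in> W \<Longrightarrow> norm (frechet_derivative \<Phi> (at y) v) \<le> L1 * norm v"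
    and D1: "D1 \<subseteq> D" "\<And>y. y \<in> W \<Longrightarrow> y \<in> span D1 \<Longrightarrow> \<Phi> y \<in> span D"
    and A: "A \<subseteq> V" and p: "flat_piece W D1 k (\<Psi> ` A) (D', B, \<psi>, E)"
  shows "flat_piece V D k A (D', B, \<lambda>x. \<Phi> (\<psi> x), \<Phi> ` E)"
proof -
  have p': "D' \<subseteq> D1" "open B" "convex B" "bounded B" "E \<subseteq> \<Psi> ` A" "E \<subseteq> \<psi> ` (B \<inter> span D')"
     "\<psi> ` B \<subseteq> W" "\<psi> ` (B \<inter> span D') \<subseteq> span D1"
    using p unfolding flat_piece_def by auto
  obtain \<psi>' L where L: "0 \<le> L" "\<And>x. x \<in> B \<Longrightarrow> (\<psi> has_derivative \<psi>' x) (at x)"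
    "\<And>x v. x \<in> B \<Longrightarrow> norm (\<psi>' x v) \<le> L * norm v"
    using flat_piece_derivative[OF p] by blast
  have der: "((\<lambda>x. \<Phi> (\<psi> x)) has_derivative (\<lambda>v. frechet_derivative \<Phi> (at (\<psi> x)) (\<psi>' x v))) (at x)"
    and bd: "norm (frechet_derivative \<Phi> (at (\<psi> x)) (\<psi>' x v)) \<le> (L1 * L) * norm v" if "x \<in> B" for x v
  proof -
    have w: "\<psi> x \<in> W" using that p' by auto
    show "((\<lambda>x. \<Phi> (\<psi> x)) has_derivative (\<lambda>v. frechet_derivative \<Phi> (at (\<psi> x)) (\<psi>' x v))) (at x)"
      using diff_chain_at[OF L(2)[OF that] Cn_on_has_derivative[OF \<Phi>(1,2) w]] by (simp add: o_def)
    have "norm (frechet_derivative \<Phi> (at (\<psi> x)) (\<psi>' x v)) \<le> L1 * norm (\<psi>' x v)" by (rule L1(2)[OF w])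
    also have "\<dots> \<le> L1 * (L * norm v)" using L(3)[OF that] L1(1) by (rule mult_left_mono)
    finally show "norm (frechet_derivative \<Phi> (at (\<psi> x)) (\<psi>' x v)) \<le> (L1 * L) * norm v" by (simp add: mult.assoc)
  qed
  have 1: "\<exists>\<psi>' L. 0 \<le> L \<and> (\<forall>x\<in>B. ((\<lambda>x. \<Phi> (\<psi> x)) has_derivative \<psi>' x) (at x) \<and> (\<forall>v. norm (\<psi>' x v) \<le> L * norm v))"
    by (rule exI[of _ "\<lambda>x v. frechet_derivative \<Phi> (at (\<psi> x)) (\<psi>' x v)"], rule exI[of _ "L1 * L"])
      (use der bd L1(1) L(1) in auto)
  have 2: "\<exists>C\<ge>0. \<forall>x\<in>B \<inter> span D'. \<forall>y\<in>B \<inter> span D'. \<Phi> (\<psi> y) \<in> \<Phi> ` E \<longrightarrow> \<bar>f (\<Phi> (\<psi> x))\<bar> \<le> C * norm (x - y) ^ k"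
    if f: "Cn_on k V f" "\<forall>x\<in>A. f x = 0" for f :: "'a \<Rightarrow> real"
  proof -
    have "Cn_on k W (\<lambda>y. f (\<Phi> y))" by (rule Cn_on_compose[OF W(2,1) \<Phi>(1) f(1) \<Phi>(3)])
    moreover have "\<forall>y\<in>\<Psi> ` A. f (\<Phi> y) = 0" using f(2) inv(1) A by auto
    ultimately obtain C where C: "C \<ge> 0" "\<forall>x\<in>B \<inter> span D'. \<forall>y\<in>B \<inter> span D'. \<psi> y \<in> E \<longrightarrow> \<bar>f (\<Phi> (\<psi> x))\<bar> \<le> C * norm (x - y) ^ k"
      using flat_piece_vanish[OF p, of "\<lambda>y. f (\<Phi> y)"] by blast
    \<comment> \<open>Injectivity of \<Phi> on W lifts membership in the image of E back to
      E.\<close>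
    have "\<psi> y \<in> E" if y: "y \<in> B" "\<Phi> (\<psi> y) \<in> \<Phi> ` E" for y
    proof -
      obtain z where z: "z \<in> E" "\<Phi> (\<psi> y) = \<Phi> z" using y by auto
      have "z \<in> W" "\<psi> y \<in> W" using z(1) y(1) p'(6,7) by blast+
      then show ?thesis using z inv(2) by metis
    qed
    then show ?thesis using C by blast
  qed
  show ?thesis unfolding flat_piece_def split
  proof (intro conjI 1 allI impI)
    show "D' \<subseteq> D" using p' D1 by auto
    show "\<Phi> ` E \<subseteq> A"
    proof (rule image_subsetI)
      fix z assume "z \<in> E"
      then obtain x where "x \<in> A" "z = \<Psi> x" using p'(5) by blast
      then show "\<Phi> z \<in> A" using inv(1) A by (simp add: subsetD)
    qed
    show "\<Phi> ` E \<subseteq> (\<lambda>x. \<Phi> (\<psi> x)) ` (B \<inter> span D')" using p'(6) by auto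
    show "(\<lambda>x. \<Phi> (\<psi> x)) ` B \<subseteq> V" using p'(7) \<Phi>(3) by auto
    show "(\<lambda>x. \<Phi> (\<psi> x)) ` (B \<inter> span D') \<subseteq> span D" using p'(7,8) D1(2) by auto
  qed (use p' 2 in auto)
qed

text \<open>On T the D-derivatives of every test function for A vanish, so they are test functions
  of order k for T. Their flatness is integrated along segments starting at points of E, where f
  itself vanishes because E lies in T and hence in A. One order is gained.\<close>

lemma flat_piece_Suc:
  assumes p: "flat_piece S D k T p" and "T \<subseteq> A" "D \<subseteq> Basis"
    and der: "\<And>f :: 'a \<Rightarrow> real. \<And>b x. Cn_on (Suc k) S f \<Longrightarrow> \<forall>x\<in>A. f x = 0 \<Longrightarrow> b \<in> D \<Longrightarrow> x \<in> T \<Longrightarrow>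
        frechet_derivative f (at x) b = 0"
  shows "flat_piece S D (Suc k) (A :: 'a::euclidean_space set) p"
proof -
  obtain D' B \<psi> E where eq: "p = (D', B, \<psi>, E)" by (cases p) auto
  have p': "D' \<subseteq> D" "open B" "convex B" "bounded B" "E \<subseteq> T" "E \<subseteq> \<psi> ` (B \<inter> span D')"
     "\<psi> ` B \<subseteq> S" "\<psi> ` (B \<inter> span D') \<subseteq> span D"
    using p unfolding eq flat_piece_def by auto
  have ex: "\<exists>\<psi>' L. 0 \<le> L \<and> (\<forall>x\<in>B. (\<psi> has_derivative \<psi>' x) (at x) \<and> (\<forall>v. norm (\<psi>' x v) \<le> L * norm v))"
    using flat_piece_derivative p unfolding eq .
  then obtain \<psi>' L where L: "0 \<le> L" "\<And>x. x \<in> B \<Longrightarrow> (\<psi> has_derivative \<psi>' x) (at x)"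
    "\<And>x v. x \<in> B \<Longrightarrow> norm (\<psi>' x v) \<le> L * norm v"
    by blast
  have "\<exists>C\<ge>0. \<forall>x\<in>B \<inter> span D'. \<forall>y\<in>B \<inter> span D'. \<psi> y \<in> E \<longrightarrow> \<bar>f (\<psi> x)\<bar> \<le> C * norm (x - y) ^ Suc k"
    if f: "Cn_on (Suc k) S f" "\<forall>x\<in>A. f x = 0" for f :: "'a \<Rightarrow> real"
  proof -
    have "\<exists>C\<ge>0. \<forall>x\<in>B \<inter> span D'. \<forall>y\<in>B \<inter> span D'. \<psi> y \<in> E \<longrightarrow>
        \<bar>frechet_derivative f (at (\<psi> x)) b\<bar> \<le> C * norm (x - y) ^ k" if "b \<in> D" for b
    proof -
      have "Cn_on k S (\<lambda>x. frechet_derivative f (at x) b)" by (rule Cn_on_derivative[OF f(1)])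
      moreover have "\<forall>x\<in>T. frechet_derivative f (at x) b = 0" using der[OF f that] by blast
      ultimately show ?thesis by (rule flat_piece_vanish[OF p[unfolded eq]])
    qed
    then obtain C where C: "\<And>b. b \<in> D \<Longrightarrow> C b \<ge> 0"
      "\<And>b x y. b \<in> D \<Longrightarrow> x\<in>B \<inter> span D' \<Longrightarrow> y\<in>B \<inter> span D' \<Longrightarrow> \<psi> y \<in> E \<Longrightarrow>
        \<bar>frechet_derivative f (at (\<psi> x)) b\<bar> \<le> C b * norm (x - y) ^ k" by metis
    have fD: "finite D" using assms(3) finite_subset finite_Basis by blast
    define M where "M = (\<Sum>b\<in>D. C b)"
    have "0 \<le> M" unfolding M_def by (intro sum_nonneg C(1))
    have bd: "norm (frechet_derivative f (at (\<psi> x)) b) \<le> M * norm (x - y) ^ k"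
      if "b \<in> D" "x\<in>B \<inter> span D'" "y\<in>B \<inter> span D'" "\<psi> y \<in> E" for b x y
    proof -
      have "C b \<le> M" unfolding M_def using fD C(1) that(1) by (intro member_le_sum) auto
      then have "C b * norm (x - y) ^ k \<le> M * norm (x - y) ^ k" by (intro mult_right_mono) auto
      then show ?thesis using C(2)[OF that] by simp
    qed
    have f1: "Cn_on 1 S f" by (rule Cn_on_le[OF f(1)]) simp
    have "norm (f (\<psi> x) - f (\<psi> y)) \<le> (real (card D) * M * L) * norm (x - y) ^ Suc k"
      if "x\<in>B \<inter> span D'" "y\<in>B \<inter> span D'" "\<psi> y \<in> E" for x y
      by (rule flat_integrate[OF p'(2,3) assms(3) L(2,3,1) p'(7,8) f1 that(1,2) bd \<open>0 \<le> M\<close>]) (use that in auto)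
    moreover have "f (\<psi> y) = 0" if "\<psi> y \<in> E" for y using that f(2) p'(5) assms(2) by blast
    moreover have "0 \<le> real (card D) * M * L" using \<open>0 \<le> M\<close> L(1) by simp
    ultimately show ?thesis by (metis diff_zero real_norm_def)
  qed
  then show ?thesis unfolding eq flat_piece_def split using p' ex assms(2) by blast
qed

text \<open>The induction is nested: at points of T1 the order stays and D loses the straightened
  direction; at points of T2 the order falls and D stays. The derivatives of the test functions of A
  are known to vanish on T2 only, which is why a piece of order k for T2, and not one for A, is
  promoted to order k + 1.\<close>

theorem flat_cover:
  assumes "open S" "D \<subseteq> Basis" "A \<subseteq> S \<inter> span D"
  shows "flat_cover S D k (A :: 'a::euclidean_space set)"
  using assms
proof (induction k arbitrary: S D A)
  case 0
  then show ?case by (rule flat_cover_0)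
next
  case (Suc k)
  note IHk = Suc.IH
  have "finite D" using Suc.prems(2) finite_subset finite_Basis by blast
  then show ?case using Suc.prems
  proof (induction D arbitrary: S A rule: finite_psubset_induct)
    case (psubset D)
    define T1 where "T1 = {a\<in>A. \<exists>f::'a \<Rightarrow> real. \<exists>b\<in>D. Cn_on (Suc k) S f \<and> (\<forall>x\<in>A. f x = 0) \<and> frechet_derivative f (at a) b \<noteq> 0}"
    define T2 where "T2 = A - T1"
    have "\<exists>V. open V \<and> a \<in> V \<and> V \<subseteq> S \<and> flat_cover V D (Suc k) (A \<inter> V)" if a: "a \<in> T1" for a
    proof -
      obtain f :: "'a \<Rightarrow> real" and b where f: "b \<in> D" "Cn_on (Suc k) S f" "\<forall>x\<in>A. f x = 0" "frechet_derivative f (at a) b \<noteq> 0"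
        and "a \<in> A" using a by (auto simp: T1_def)
      have "a \<in> S" "b \<in> Basis" using \<open>a \<in> A\<close> f(1) psubset.prems by auto
      have k1: "1 \<le> Suc k" by simp
      obtain V W \<Phi> L where VW: "open V" "a \<in> V" "V \<subseteq> S" "open W"
        "\<And>x. x \<in> V \<Longrightarrow> frechet_derivative f (at x) b \<noteq> 0"
        "\<And>x. x \<in> V \<Longrightarrow> x + (f x - x \<bullet> b) *\<^sub>R b \<in> W"
        "\<And>x. x \<in> V \<Longrightarrow> \<Phi> (x + (f x - x \<bullet> b) *\<^sub>R b) = x"
        and \<Phi>V: "\<And>y. y \<in> W \<Longrightarrow> \<Phi> y \<in> V" "\<And>y. y \<in> W \<Longrightarrow> f (\<Phi> y) = y \<bullet> b"
        "\<And>y i. y \<in> W \<Longrightarrow> i \<in> Basis \<Longrightarrow> i \<noteq> b \<Longrightarrow> \<Phi> y \<bullet> i = y \<bullet> i"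
        and \<Phi>: "Cn_on (Suc k) W \<Phi>" and L: "0 \<le> L" "\<And>y h. y \<in> W \<Longrightarrow> norm (frechet_derivative \<Phi> (at y) h) \<le> L * norm h"
        using straighten[OF psubset.prems(1) \<open>a \<in> S\<close> f(2) k1 \<open>b \<in> Basis\<close> f(4)] by blast
      define \<Psi> where "\<Psi> = (\<lambda>x. x + (f x - x \<bullet> b) *\<^sub>R b)"
      have \<Psi>\<Phi>: "\<Psi> (\<Phi> y) = y" if "y \<in> W" for y
      proof (rule euclidean_eqI)
        fix i :: 'a assume "i \<in> Basis"
        then show "\<Psi> (\<Phi> y) \<bullet> i = y \<bullet> i"
          using \<Phi>V(2,3)[OF that] \<open>b \<in> Basis\<close> by (cases "i = b") (auto simp: \<Psi>_def inner_add_left inner_not_same_Basis)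
      qed
      have Db: "D - {b} \<subset> D" "D - {b} \<subseteq> Basis" using f(1) psubset.prems by auto
      \<comment> \<open>The b-coordinate of \<open>\<Psi> x\<close> is f x, which vanishes on A; the
        other coordinates are unchanged.\<close>
      have sub: "\<Psi> ` (A \<inter> V) \<subseteq> W \<inter> span (D - {b})"
      proof safe
        fix x assume x: "x \<in> A" "x \<in> V"
        then show "\<Psi> x \<in> W" using VW by (simp add: \<Psi>_def)
        have "x \<in> span D" using x psubset.prems by auto
        then have x0: "x \<bullet> c = 0" if "c \<in> Basis" "c \<notin> D" for c
          using that by (simp add: mem_span_Basis_iff[OF psubset.prems(2)])
        have "\<Psi> x \<bullet> c = 0" if "c \<in> Basis" "c \<notin> D - {b}" for c
        proof (cases "c = b")
          case True
          then show ?thesis using f(3) x(1) \<open>b \<in> Basis\<close> by (simp add: \<Psi>_def inner_add_left inner_diff_left)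
        next
          case False
          then show ?thesis using x0[of c] that \<open>b \<in> Basis\<close>
            by (simp add: \<Psi>_def inner_add_left inner_not_same_Basis)
        qed
        then show "\<Psi> x \<in> span (D - {b})" by (simp add: mem_span_Basis_iff[OF Db(2)])
      qed
      have "flat_cover W (D - {b}) (Suc k) (\<Psi> ` (A \<inter> V))"
        using psubset.IH[OF Db(1) VW(4) Db(2) sub] .
      then obtain P where P: "countable P" "\<forall>p\<in>P. flat_piece W (D - {b}) (Suc k) (\<Psi> ` (A \<inter> V)) p"
        "\<Psi> ` (A \<inter> V) \<subseteq> (\<Union>(D', B, \<psi>, E)\<in>P. E)"
        by (rule flat_coverE)
      define q where "q = (\<lambda>(D' :: 'a set, B :: 'a set, \<psi> :: 'a \<Rightarrow> 'a, E :: 'a set). (D', B, \<lambda>x. \<Phi> (\<psi> x), \<Phi> ` E))"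
      have "flat_cover V D (Suc k) (A \<inter> V)" unfolding flat_cover_def
      proof (intro exI conjI ballI)
        show "countable (q ` P)" using P(1) by simp
        show "A \<inter> V \<subseteq> (\<Union>(D', B, \<psi>, E)\<in>q ` P. E)"
        proof
          fix x assume x: "x \<in> A \<inter> V"
          then have "\<Psi> x \<in> (\<Union>(D', B, \<psi>, E)\<in>P. E)" using P(3) by blast
          then obtain D' B \<psi> E where E: "(D', B, \<psi>, E) \<in> P" "\<Psi> x \<in> E" by auto
          have "x \<in> \<Phi> ` E" using E(2) x VW(7) by (force simp: \<Psi>_def)
          moreover have "(D', B, \<lambda>x. \<Phi> (\<psi> x), \<Phi> ` E) \<in> q ` P" using E(1) by (force simp: q_def)
          ultimately show "x \<in> (\<Union>(D', B, \<psi>, E)\<in>q ` P. E)" by blast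
        qed
        fix p assume "p \<in> q ` P"
        then obtain D' B \<psi> E where E: "(D', B, \<psi>, E) \<in> P" and p: "p = (D', B, \<lambda>x. \<Phi> (\<psi> x), \<Phi> ` E)"
          by (auto simp: q_def)
        show "flat_piece V D (Suc k) (A \<inter> V) p" unfolding p
        proof (rule flat_piece_push[OF VW(1,4) \<Phi> _ \<Phi>V(1), where \<Psi> = \<Psi> and ?L1.0 = L and ?D1.0 = "D - {b}"])
          show "\<Phi> (\<Psi> x) = x" if "x \<in> V" for x using VW(7)[OF that] by (simp add: \<Psi>_def)
          show "\<Phi> y \<in> span D" if "y \<in> W" "y \<in> span (D - {b})" for y
            using that(2) \<Phi>V(3)[OF that(1)] f(1)
            unfolding mem_span_Basis_iff[OF Db(2)] mem_span_Basis_iff[OF psubset.prems(2)] by (metis Diff_iff)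
          show "flat_piece W (D - {b}) (Suc k) (\<Psi> ` (A \<inter> V)) (D', B, \<psi>, E)" using P(2) E by blast
        qed (use \<Psi>\<Phi> L in auto)
      qed
      then show ?thesis using VW by blast
    qed
    then obtain V where V: "\<And>a. a \<in> T1 \<Longrightarrow> open (V a) \<and> a \<in> V a \<and> V a \<subseteq> S \<and> flat_cover (V a) D (Suc k) (A \<inter> V a)"
      by metis
    obtain T0 where T0: "countable T0" "T0 \<subseteq> T1" "T1 \<subseteq> (\<Union>a\<in>T0. V a)"
      using countable_subcover[of T1 V] V by blast
    obtain P1 where P1: "countable P1" "\<forall>p\<in>P1. flat_piece S D (Suc k) (\<Union>a\<in>T0. A \<inter> V a) p"
      "(\<Union>a\<in>T0. A \<inter> V a) \<subseteq> (\<Union>(D', B, \<psi>, E)\<in>P1. E)"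
    proof (rule flat_coverE[OF flat_cover_UN[OF T0(1), of V D "Suc k" "\<lambda>a. A \<inter> V a" S "\<Union>a\<in>T0. A \<inter> V a"]])
      show "flat_cover (V a) D (Suc k) (A \<inter> V a)" "V a \<subseteq> S" if "a \<in> T0" for a
        using V T0(2) that by blast+
      show "A \<inter> V a \<subseteq> (\<Union>a\<in>T0. A \<inter> V a)" if "a \<in> T0" for a using that by blast
    qed auto
    have "T2 \<subseteq> S \<inter> span D" using psubset.prems(3) by (auto simp: T2_def)
    from IHk[OF psubset.prems(1,2) this]
    obtain P2 where P2: "countable P2" "\<forall>p\<in>P2. flat_piece S D k T2 p" "T2 \<subseteq> (\<Union>(D', B, \<psi>, E)\<in>P2. E)"
      by (rule flat_coverE)
    show ?case unfolding flat_cover_def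
    proof (intro exI conjI ballI)
      show "countable (P1 \<union> P2)" using P1 P2 by simp
      have "x \<in> (\<Union>(D', B, \<psi>, E)\<in>P1. E) \<union> (\<Union>(D', B, \<psi>, E)\<in>P2. E)" if "x \<in> A" for x
      proof (cases "x \<in> T1")
        case True
        then have "x \<in> (\<Union>a\<in>T0. A \<inter> V a)" using T0(3) that by blast
        then show ?thesis by (rule UnI1[OF subsetD[OF P1(3)]])
      next
        case False
        then have "x \<in> T2" using that by (simp add: T2_def)
        then show ?thesis by (rule UnI2[OF subsetD[OF P2(3)]])
      qed
      then show "A \<subseteq> (\<Union>(D', B, \<psi>, E)\<in>P1 \<union> P2. E)" unfolding UN_Un by (rule subsetI)
      fix p assume "p \<in> P1 \<union> P2"
      then consider "p \<in> P1" | "p \<in> P2" by blast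
      then show "flat_piece S D (Suc k) A p"
      proof cases
        case 1
        then show ?thesis using P1(2) flat_piece_mono[of S D "Suc k" _ p S A] by blast
      next
        case 2
        show ?thesis
        proof (rule flat_piece_Suc)
          show "flat_piece S D k T2 p" using P2(2) 2 by blast
        qed (use psubset.prems in \<open>auto simp: T2_def T1_def\<close>)
      qed
    qed
  qed
qed

text \<open>A flat cover serves all functions vanishing on A at once, hence all components of all
  D-derivatives of h. One integration turns their flatness of order k into order k + 1 for h
  composed with \<psi>.\<close>

lemma critical_cover:
  fixes h :: "'a::euclidean_space \<Rightarrow> 'b::euclidean_space"
  assumes "open S" "D \<subseteq> Basis" "A \<subseteq> S \<inter> span D" and h: "Cn_on (Suc k) S h"
    and crit: "\<And>a b. a \<in> A \<Longrightarrow> b \<in> D \<Longrightarrow> frechet_derivative h (at a) b = 0"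
  obtains Q :: "('a set \<times> 'a set \<times> ('a \<Rightarrow> 'b)) set" where "countable Q" "h ` A \<subseteq> (\<Union>(D', E, g)\<in>Q. g ` E)"
    "\<And>D' E g. (D', E, g) \<in> Q \<Longrightarrow> D' \<subseteq> D \<and> E \<subseteq> span D' \<and> bounded E \<and>
        (\<exists>C\<ge>0. \<forall>x\<in>E. \<forall>y\<in>E. norm (g x - g y) \<le> C * norm (x - y) ^ Suc k)"
proof -
  obtain P where P: "countable P" "\<forall>p\<in>P. flat_piece S D k A p" "A \<subseteq> (\<Union>(D', B, \<psi>, E)\<in>P. E)"
    by (rule flat_coverE[OF flat_cover[OF assms(1-3), where k = k]])
  define q where "q = (\<lambda>(D' :: 'a set, B :: 'a set, \<psi> :: 'a \<Rightarrow> 'a, E :: 'a set).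
      (D', {x \<in> B \<inter> span D'. \<psi> x \<in> E}, \<lambda>x. h (\<psi> x)))"
  show thesis
  proof (rule that[of "q ` P"])
    show "countable (q ` P)" using P(1) by simp
    show "h ` A \<subseteq> (\<Union>(D', E, g)\<in>q ` P. g ` E)"
    proof
      fix z assume "z \<in> h ` A"
      then obtain x where x: "x \<in> A" "z = h x" by blast
      then have "x \<in> (\<Union>(D', B, \<psi>, E)\<in>P. E)" using P(3) by blast
      then obtain D' B \<psi> E where E: "(D', B, \<psi>, E) \<in> P" "x \<in> E" by auto
      have "E \<subseteq> \<psi> ` (B \<inter> span D')" using P(2) E unfolding flat_piece_def by fastforce
      then obtain y where "y \<in> B \<inter> span D'" "x = \<psi> y" using E(2) by blast
      then have "z \<in> (\<lambda>x. h (\<psi> x)) ` {x \<in> B \<inter> span D'. \<psi> x \<in> E}" using x E(2) by blast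
      moreover have "(D', {x \<in> B \<inter> span D'. \<psi> x \<in> E}, \<lambda>x. h (\<psi> x)) \<in> q ` P" using E(1) by (force simp: q_def)
      ultimately show "z \<in> (\<Union>(D', E, g)\<in>q ` P. g ` E)" by blast
    qed
    fix D' E' g assume "(D', E', g) \<in> q ` P"
    then obtain B \<psi> E where p: "(D', B, \<psi>, E) \<in> P" and E': "E' = {x \<in> B \<inter> span D'. \<psi> x \<in> E}"
      and g: "g = (\<lambda>x. h (\<psi> x))"
      by (auto simp: q_def)
    have fp: "flat_piece S D k A (D', B, \<psi>, E)" using P(2) p by blast
    then have p': "D' \<subseteq> D" "open B" "convex B" "bounded B" "\<psi> ` B \<subseteq> S" "\<psi> ` (B \<inter> span D') \<subseteq> span D"
      unfolding flat_piece_def by auto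
    obtain \<psi>' L where L: "0 \<le> L" "\<And>x. x \<in> B \<Longrightarrow> (\<psi> has_derivative \<psi>' x) (at x)"
      "\<And>x v. x \<in> B \<Longrightarrow> norm (\<psi>' x v) \<le> L * norm v"
      using flat_piece_derivative[OF fp] by blast
    have "\<exists>C\<ge>0. \<forall>x\<in>B \<inter> span D'. \<forall>y\<in>B \<inter> span D'. \<psi> y \<in> E \<longrightarrow>
        \<bar>frechet_derivative h (at (\<psi> x)) b \<bullet> e\<bar> \<le> C * norm (x - y) ^ k" if "b \<in> D" "e \<in> Basis" for b e
    proof -
      have "Cn_on k S (\<lambda>x. frechet_derivative h (at x) b \<bullet> e)"
        by (intro Cn_on_inner Cn_on_const assms(1) Cn_on_derivative[OF h])
      moreover have "\<forall>x\<in>A. frechet_derivative h (at x) b \<bullet> e = 0" using crit that by simp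
      ultimately show ?thesis by (rule flat_piece_vanish[OF fp])
    qed
    then obtain C where C: "\<And>b e. b \<in> D \<Longrightarrow> e \<in> Basis \<Longrightarrow> C b e \<ge> 0"
      "\<And>b e x y. b \<in> D \<Longrightarrow> e \<in> Basis \<Longrightarrow> x\<in>B \<inter> span D' \<Longrightarrow> y\<in>B \<inter> span D' \<Longrightarrow> \<psi> y \<in> E \<Longrightarrow>
        \<bar>frechet_derivative h (at (\<psi> x)) b \<bullet> e\<bar> \<le> C b e * norm (x - y) ^ k" by metis
    have fD: "finite D" using assms(2) finite_subset finite_Basis by blast
    define M where "M = (\<Sum>b\<in>D. \<Sum>e\<in>Basis. C b e)"
    have "0 \<le> M" unfolding M_def by (intro sum_nonneg C(1))
    have bd: "norm (frechet_derivative h (at (\<psi> x)) b) \<le> M * norm (x - y) ^ k"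
      if "b \<in> D" "x\<in>B \<inter> span D'" "y\<in>B \<inter> span D'" "\<psi> y \<in> E" for b x y
    proof -
      have "norm (frechet_derivative h (at (\<psi> x)) b) \<le> (\<Sum>e\<in>Basis. \<bar>frechet_derivative h (at (\<psi> x)) b \<bullet> e\<bar>)"
        by (rule norm_le_l1)
      also have "\<dots> \<le> (\<Sum>e\<in>Basis. C b e * norm (x - y) ^ k)"
        using C(2) that by (intro sum_mono) auto
      also have "\<dots> = (\<Sum>e\<in>Basis. C b e) * norm (x - y) ^ k" by (simp add: sum_distrib_right)
      also have "\<dots> \<le> M * norm (x - y) ^ k" unfolding M_def
        using fD C(1) that(1) by (intro mult_right_mono member_le_sum[of b D "\<lambda>b. \<Sum>e\<in>Basis. C b e"]) (auto intro: sum_nonneg)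
      finally show ?thesis .
    qed
    have h1: "Cn_on 1 S h" by (rule Cn_on_le[OF h]) simp
    have "norm (g x - g y) \<le> (real (card D) * M * L) * norm (x - y) ^ Suc k" if "x \<in> E'" "y \<in> E'" for x y
      unfolding g
      by (rule flat_integrate[OF p'(2,3) assms(2) L(2,3,1) p'(5,6) h1 _ _ bd \<open>0 \<le> M\<close>]) (use that E' in auto)
    moreover have "0 \<le> real (card D) * M * L" using \<open>0 \<le> M\<close> L(1) by simp
    moreover have "bounded E'" by (rule bounded_subset[OF p'(4)]) (use E' in auto)
    ultimately show "D' \<subseteq> D \<and> E' \<subseteq> span D' \<and> bounded E' \<and>
        (\<exists>C\<ge>0. \<forall>x\<in>E'. \<forall>y\<in>E'. norm (g x - g y) \<le> C * norm (x - y) ^ Suc k)"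
      using p'(1) E' by auto
  qed
qed

text \<open>With a single derivative, flatness of order 0 would give only a Lipschitz bound. But the
  D-derivatives vanish on A and are uniformly continuous on compact balls, so on each piece the
  increments are uniformly of smaller order than |x - y|.\<close>

lemma critical_cover_C1:
  fixes h :: "'a::euclidean_space \<Rightarrow> 'b::euclidean_space"
  assumes "open S" "D \<subseteq> Basis" "A \<subseteq> S \<inter> span D" and h: "Cn_on 1 S h"
    and crit: "\<And>a b. a \<in> A \<Longrightarrow> b \<in> D \<Longrightarrow> frechet_derivative h (at a) b = 0"
  obtains Q where "countable Q" "A \<subseteq> \<Union>Q" 
    "\<And>E. E \<in> Q \<Longrightarrow> E \<subseteq> span D \<and> bounded E \<and>
        (\<forall>\<eta>>0. \<exists>\<delta>>0. \<forall>x\<in>E. \<forall>y\<in>E. norm (x - y) < \<delta> \<longrightarrow> norm (h x - h y) \<le> \<eta> * norm (x - y))"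
proof -
  have "\<exists>e>0. cball a e \<subseteq> S" if "a \<in> A" for a using that assms open_contains_cball by blast
  then obtain e where e: "\<And>a. a \<in> A \<Longrightarrow> e a > 0 \<and> cball a (e a) \<subseteq> S" by metis
  obtain A0 where A0: "countable A0" "A0 \<subseteq> A" "A \<subseteq> (\<Union>a\<in>A0. ball a (e a))"
    using countable_subcover[of A "\<lambda>a. ball a (e a)"] e by auto
  have fD: "finite D" using assms(2) finite_subset finite_Basis by blast
  show thesis
  proof (rule that[of "(\<lambda>a. A \<inter> ball a (e a)) ` A0"])
    show "countable ((\<lambda>a. A \<inter> ball a (e a)) ` A0)" using A0 by simp
    show "A \<subseteq> \<Union>((\<lambda>a. A \<inter> ball a (e a)) ` A0)" using A0(3) by blast
    fix E assume "E \<in> (\<lambda>a. A \<inter> ball a (e a)) ` A0"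
    then obtain a where a: "a \<in> A" "E = A \<inter> ball a (e a)" using A0 by blast
    have "\<exists>\<delta>>0. \<forall>x\<in>E. \<forall>y\<in>E. norm (x - y) < \<delta> \<longrightarrow> norm (h x - h y) \<le> \<eta> * norm (x - y)" if "\<eta> > 0" for \<eta>
    proof -
      \<comment> \<open>The estimate below sums over D; the summand 1 covers the case of empty
        D.\<close>
      define \<eta>' where "\<eta>' = \<eta> / (real (card D) + 1)"
      have "\<eta>' > 0" using that by (simp add: \<eta>'_def)
      have "\<exists>d>0. \<forall>x\<in>cball a (e a). \<forall>x'\<in>cball a (e a). dist x' x < d \<longrightarrow>
          dist (frechet_derivative h (at x') b) (frechet_derivative h (at x) b) < \<eta>'" for b
      proof -
        have "uniformly_continuous_on (cball a (e a)) (\<lambda>x. frechet_derivative h (at x) b)"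
          using Cn_on_1_continuous_derivative[OF h] e[OF a(1)]
          by (intro compact_uniformly_continuous) (auto intro: continuous_on_subset)
        then show ?thesis using \<open>\<eta>' > 0\<close> unfolding uniformly_continuous_on_def by blast
      qed
      then obtain d where d: "\<And>b. d b > 0" "\<And>b x x'. x\<in>cball a (e a) \<Longrightarrow> x'\<in>cball a (e a) \<Longrightarrow> dist x' x < d b \<Longrightarrow>
          dist (frechet_derivative h (at x') b) (frechet_derivative h (at x) b) < \<eta>'" by metis
      define \<delta> where "\<delta> = Min (insert 1 (d ` D))"
      have "\<delta> > 0" using d(1) fD by (simp add: \<delta>_def)
      have \<delta>d: "\<delta> \<le> d b" if "b \<in> D" for b using fD that by (simp add: \<delta>_def)
      have "norm (h x - h y) \<le> \<eta> * norm (x - y)" if xy: "x \<in> E" "y \<in> E" "norm (x - y) < \<delta>" for x y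
      proof -
        \<comment> \<open>The ball around y keeps the whole segment from y to x within \<delta> of
          y, where the derivatives differ from those at y, which are 0, by less than
          \<open>\<eta>'\<close>.\<close>
        define B where "B = ball a (e a) \<inter> ball y \<delta>"
        have *: "norm (frechet_derivative h (at z) b) \<le> \<eta>' * norm (z - y) ^ 0" if "b \<in> D" "z \<in> B \<inter> span D" for b z
        proof -
          have "dist (frechet_derivative h (at z) b) (frechet_derivative h (at y) b) < \<eta>'"
            using that xy a(2) \<delta>d[OF that(1)] by (intro d(2)) (auto simp: B_def dist_commute)
          then show ?thesis using crit[of y b] xy a that(1) by (simp add: dist_norm)
        qed
        have "norm (h x - h y) \<le> real (card D) * \<eta>' * 1 * norm (x - y) ^ Suc 0"
        proof (rule flat_integrate[of B D "\<lambda>x. x" "\<lambda>x v. v" 1 S D h x y, OF _ _ assms(2)])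
          show "(\<lambda>x. x) ` B \<subseteq> S" using e[OF a(1)] by (auto simp: B_def)
          show "x \<in> B \<inter> span D" "y \<in> B \<inter> span D" using xy a assms(3) \<open>\<delta> > 0\<close>
            by (auto simp: B_def dist_norm norm_minus_commute)
        qed (use * h \<open>\<eta>' > 0\<close> in \<open>auto simp: B_def intro: convex_Int\<close>)
        also have "\<dots> \<le> \<eta> * norm (x - y)"
        proof -
          have "real (card D) * \<eta>' \<le> \<eta>" using \<open>\<eta> > 0\<close> by (simp add: \<eta>'_def field_simps)
          then show ?thesis by (simp add: mult_right_mono)
        qed
        finally show ?thesis .
      qed
      then show ?thesis using \<open>\<delta> > 0\<close> by blast
    qed
    moreover have "bounded E" using a(2) bounded_ball bounded_subset by blast
    ultimately show "E \<subseteq> span D \<and> bounded E \<and>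
        (\<forall>\<eta>>0. \<exists>\<delta>>0. \<forall>x\<in>E. \<forall>y\<in>E. norm (x - y) < \<delta> \<longrightarrow> norm (h x - h y) \<le> \<eta> * norm (x - y))"
      using a assms(3) by blast
  qed
qed

section \<open>Null sets by counting grid cells\<close>

text \<open>For N at least 1, the index of the cube of side 1/N that contains x, in the coordinates
  D only. Indices are extensional functions, so that products \<open>\<Pi>\<^sub>E\<close> count
  them.\<close>

definition cell :: "'a::euclidean_space set \<Rightarrow> nat \<Rightarrow> 'a \<Rightarrow> 'a \<Rightarrow> int" where
  "cell D N x = (\<lambda>b\<in>D. \<lfloor>real N * (x \<bullet> b)\<rfloor>)"

definition subcells :: "'a set \<Rightarrow> nat \<Rightarrow> ('a \<Rightarrow> int) \<Rightarrow> ('a \<Rightarrow> int) set" where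
  "subcells D M Q = (\<Pi>\<^sub>E b\<in>D. {int M * Q b..<int M * Q b + int M})"

text \<open>Points in one class of c have images within \<delta> of one chosen image, so the
  D-coordinates of v lie in a cube of side 2 \<delta>, and the remaining coordinates are bounded by
  R. One such box per class covers the set.\<close>

lemma cylinder_outer_measure:
  fixes g :: "'a \<Rightarrow> 'b::euclidean_space"
  assumes D: "D \<subseteq> Basis" and fin: "finite (c ` E)" and "0 \<le> R" and \<delta>: "\<And>i. i \<in> c ` E \<Longrightarrow> 0 \<le> \<delta> i"
    and g: "\<And>x y. x \<in> E \<Longrightarrow> y \<in> E \<Longrightarrow> c x = c y \<Longrightarrow> norm (g x - g y) \<le> \<delta> (c x)"
  shows "\<exists>T. {v. norm v \<le> R \<and> (\<exists>x\<in>E. \<forall>e\<in>D. v \<bullet> e = g x \<bullet> e)} \<subseteq> T \<and> T \<in> lmeasurable \<and>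
     measure lebesgue T \<le> (\<Sum>i\<in>c ` E. (2 * \<delta> i) ^ card D) * (2 * R) ^ (DIM('b) - card D)"
proof -
  define z where "z = (\<lambda>i. SOME x. x \<in> E \<and> c x = i)"
  have z: "z i \<in> E" "c (z i) = i" if "i \<in> c ` E" for i
  proof -
    have "\<exists>x. x \<in> E \<and> c x = i" using that by auto
    from someI_ex[OF this] show "z i \<in> E" "c (z i) = i" by (auto simp: z_def)
  qed
  define lo where "lo = (\<lambda>i. \<Sum>e\<in>Basis. (if e \<in> D then g (z i) \<bullet> e - \<delta> i else - R) *\<^sub>R e)"
  define hi where "hi = (\<lambda>i. \<Sum>e\<in>Basis. (if e \<in> D then g (z i) \<bullet> e + \<delta> i else R) *\<^sub>R e)"
  define T where "T = (\<Union>i\<in>c ` E. cbox (lo i) (hi i))"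
  have lo: "lo i \<bullet> e = (if e \<in> D then g (z i) \<bullet> e - \<delta> i else - R)" if "e \<in> Basis" for i e
    using that by (simp add: lo_def)
  have hi: "hi i \<bullet> e = (if e \<in> D then g (z i) \<bullet> e + \<delta> i else R)" if "e \<in> Basis" for i e
    using that by (simp add: hi_def)
  have "v \<in> T" if v: "norm v \<le> R" "x \<in> E" "\<forall>e\<in>D. v \<bullet> e = g x \<bullet> e" for v x
  proof -
    have i: "c x \<in> c ` E" using v by simp
    have "v \<in> cbox (lo (c x)) (hi (c x))" unfolding mem_box
    proof (intro ballI)
      fix e :: 'b assume e: "e \<in> Basis"
      have "\<bar>v \<bullet> e\<bar> \<le> R" using Basis_le_norm[OF e, of v] v(1) by linarith
      moreover have "\<bar>(g x - g (z (c x))) \<bullet> e\<bar> \<le> \<delta> (c x)"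
        using Basis_le_norm[OF e, of "g x - g (z (c x))"] g[OF v(2) z(1)[OF i] z(2)[OF i, symmetric]] by linarith
      ultimately show "lo (c x) \<bullet> e \<le> v \<bullet> e \<and> v \<bullet> e \<le> hi (c x) \<bullet> e"
        unfolding lo[OF e] hi[OF e] using v(3) by (auto simp: inner_diff_left abs_le_iff)
    qed
    then show ?thesis using i by (auto simp: T_def)
  qed
  moreover have "T \<in> lmeasurable" unfolding T_def using fin by (intro fmeasurable.finite_UN) auto
  moreover have "measure lebesgue T \<le> (\<Sum>i\<in>c ` E. (2 * \<delta> i) ^ card D) * (2 * R) ^ (DIM('b) - card D)"
  proof -
    have "measure lebesgue T \<le> (\<Sum>i\<in>c ` E. measure lebesgue (cbox (lo i) (hi i)))"
      unfolding T_def using fin by (intro measure_UNION_le) auto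
    also have "\<dots> = (\<Sum>i\<in>c ` E. (2 * \<delta> i) ^ card D * (2 * R) ^ (DIM('b) - card D))"
    proof (rule sum.cong[OF refl])
      fix i assume i: "i \<in> c ` E"
      have fD: "finite D" using D finite_subset finite_Basis by blast
      have le: "\<forall>e\<in>Basis. lo i \<bullet> e \<le> hi i \<bullet> e" using lo hi \<delta>[OF i] \<open>0 \<le> R\<close> by simp
      have "measure lebesgue (cbox (lo i) (hi i)) = (\<Prod>e\<in>Basis. hi i \<bullet> e - lo i \<bullet> e)"
        using le by (simp add: content_cbox inner_diff_left)
      also have "\<dots> = (\<Prod>e\<in>Basis. if e \<in> D then 2 * \<delta> i else 2 * R)"
        by (intro prod.cong) (auto simp: lo hi)
      also have "\<dots> = (\<Prod>e\<in>D. 2 * \<delta> i) * (\<Prod>e\<in>Basis - D. 2 * R)"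
        using D by (subst prod.If_cases) (auto simp: Int_absorb1 Diff_eq)
      also have "\<dots> = (2 * \<delta> i) ^ card D * (2 * R) ^ (DIM('b) - card D)"
        using D fD by (simp add: card_Diff_subset)
      finally show "measure lebesgue (cbox (lo i) (hi i)) = (2 * \<delta> i) ^ card D * (2 * R) ^ (DIM('b) - card D)" .
    qed
    finally show ?thesis by (simp add: sum_distrib_right)
  qed
  ultimately show ?thesis by blast
qed

lemma finite_cells:
  assumes "finite D" "bounded E" "D \<subseteq> Basis"
  shows "finite (cell D N ` E)"
proof -
  obtain R where R: "\<And>x. x \<in> E \<Longrightarrow> norm x \<le> R" using assms(2) bounded_iff by blast
  have "cell D N ` E \<subseteq> (\<Pi>\<^sub>E b\<in>D. {\<lfloor>- (real N * R)\<rfloor>..\<lfloor>real N * R\<rfloor>})"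
  proof
    fix q assume "q \<in> cell D N ` E"
    then obtain x where x: "x \<in> E" "q = cell D N x" by blast
    have "\<lfloor>- (real N * R)\<rfloor> \<le> \<lfloor>real N * (x \<bullet> b)\<rfloor> \<and> \<lfloor>real N * (x \<bullet> b)\<rfloor> \<le> \<lfloor>real N * R\<rfloor>" if "b \<in> D" for b
    proof -
      have "\<bar>x \<bullet> b\<bar> \<le> R" using Basis_le_norm[of b x] R[OF x(1)] assms(3) that by force
      then have "\<bar>real N * (x \<bullet> b)\<bar> \<le> real N * R" by (simp add: abs_mult mult_left_mono)
      then show ?thesis by (intro conjI floor_mono) linarith+
    qed
    then show "q \<in> (\<Pi>\<^sub>E b\<in>D. {\<lfloor>- (real N * R)\<rfloor>..\<lfloor>real N * R\<rfloor>})" by (auto simp: x(2) cell_def)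
  qed
  then show ?thesis by (rule finite_subset) (auto intro!: finite_PiE assms(1))
qed

lemma card_subcells: "finite D \<Longrightarrow> card (subcells D M Q) = M ^ card D"
  by (simp add: subcells_def card_PiE)

lemma finite_subcells: "finite D \<Longrightarrow> finite (subcells D M Q)"
  by (simp add: subcells_def finite_PiE)

lemma cell_in_subcells:
  assumes "1 \<le> M" shows "cell D (M * N) x \<in> subcells D M (cell D N x)"
proof -
  have "int M * \<lfloor>real N * (x \<bullet> b)\<rfloor> \<le> \<lfloor>real (M * N) * (x \<bullet> b)\<rfloor> \<and>
      \<lfloor>real (M * N) * (x \<bullet> b)\<rfloor> < int M * \<lfloor>real N * (x \<bullet> b)\<rfloor> + int M" for b
  proof
    let ?t = "real N * (x \<bullet> b)"
    have t: "of_int \<lfloor>?t\<rfloor> \<le> ?t" "?t < of_int \<lfloor>?t\<rfloor> + 1" by linarith+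
    have "real M * of_int \<lfloor>?t\<rfloor> \<le> real M * ?t" using t(1) by (simp add: mult_left_mono)
    then show "int M * \<lfloor>?t\<rfloor> \<le> \<lfloor>real (M * N) * (x \<bullet> b)\<rfloor>" by (simp add: le_floor_iff mult.assoc)
    have "real M * ?t < real M * (of_int \<lfloor>?t\<rfloor> + 1)" using t(2) assms by simp
    then show "\<lfloor>real (M * N) * (x \<bullet> b)\<rfloor> < int M * \<lfloor>?t\<rfloor> + int M"
      by (simp add: floor_less_iff mult.assoc algebra_simps)
  qed
  then show ?thesis by (auto simp: subcells_def cell_def)
qed

text \<open>Defective cells lower the volume of the grid neighbourhood of E when the grid is refined, hence
  there are few of them.\<close>

definition defective :: "'a::euclidean_space set \<Rightarrow> 'a set \<Rightarrow> nat \<Rightarrow> nat \<Rightarrow> ('a \<Rightarrow> int) set" where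
  "defective D E M N = {Q \<in> cell D N ` E. \<not> subcells D M Q \<subseteq> cell D (M * N) ` E}"

text \<open>The cells met by E split into M^(card D) fine cells each, and these include all fine
  cells met by E. A defective cell has at least one fine cell that E misses.\<close>

lemma card_defective:
  assumes fin: "finite D" "bounded E" "D \<subseteq> Basis" and "1 \<le> M"
  shows "card (cell D (M * N) ` E) + card (defective D E M N) \<le> M ^ card D * card (cell D N ` E)"
proof -
  let ?C = "cell D N ` E" and ?C' = "cell D (M * N) ` E"
  have f: "finite ?C" "finite ?C'" using finite_cells fin by blast+
  have sub: "?C' \<subseteq> (\<Union>Q\<in>?C. subcells D M Q \<inter> ?C')"
    using cell_in_subcells[OF \<open>1 \<le> M\<close>] by blast
  have "card ?C' \<le> (\<Sum>Q\<in>?C. card (subcells D M Q \<inter> ?C'))"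
    using f by (intro order_trans[OF card_mono[OF _ sub] card_UN_le]) auto
  moreover have "card (subcells D M Q \<inter> ?C') + (if Q \<in> defective D E M N then 1 else 0) \<le> M ^ card D" if "Q \<in> ?C" for Q
  proof (cases "Q \<in> defective D E M N")
    case True
    then have "subcells D M Q \<inter> ?C' \<subset> subcells D M Q" by (auto simp: defective_def)
    then have "card (subcells D M Q \<inter> ?C') < card (subcells D M Q)"
      by (rule psubset_card_mono[OF finite_subcells[OF fin(1)]])
    then show ?thesis using True card_subcells[OF fin(1), of M Q] by simp
  next
    case False
    then show ?thesis using card_mono[OF finite_subcells[OF fin(1)], of "subcells D M Q \<inter> ?C'" M Q]
      card_subcells[OF fin(1), of M Q] by simp
  qed
  then have "(\<Sum>Q\<in>?C. card (subcells D M Q \<inter> ?C') + (if Q \<in> defective D E M N then 1 else 0)) \<le> (\<Sum>Q\<in>?C. M ^ card D)"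
    by (rule sum_mono)
  moreover have "(\<Sum>Q\<in>?C. if Q \<in> defective D E M N then 1 else 0) = card (defective D E M N)"
  proof -
    have "?C \<inter> {Q. Q \<in> defective D E M N} = defective D E M N" by (auto simp: defective_def)
    then show ?thesis using f by (simp add: sum.If_cases)
  qed
  ultimately show ?thesis by (simp add: sum.distrib mult.commute)
qed

text \<open>Bounding the norm by the sum of the coordinates costs the factor \<open>card D\<close>;
  any constant independent of N would serve.\<close>

lemma cell_eq_norm_le:
  assumes "D \<subseteq> Basis" "x \<in> span D" "y \<in> span D" "cell D N x = cell D N y" "1 \<le> N"
  shows "norm (x - y) \<le> real (card D) / real N"
proof -
  have c: "\<bar>(x - y) \<bullet> b\<bar> \<le> 1 / real N" if "b \<in> D" for b
  proof -
    have "\<lfloor>real N * (x \<bullet> b)\<rfloor> = \<lfloor>real N * (y \<bullet> b)\<rfloor>"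
      using fun_cong[OF assms(4), of b] that by (simp add: cell_def)
    then have "\<bar>real N * (x \<bullet> b) - real N * (y \<bullet> b)\<bar> \<le> 1" by linarith
    then have "real N * \<bar>(x - y) \<bullet> b\<bar> \<le> 1"
      by (simp add: inner_diff_left abs_mult flip: right_diff_distrib)
    then show ?thesis using assms(5) by (simp add: field_simps)
  qed
  have "norm (x - y) \<le> (\<Sum>b\<in>Basis. \<bar>(x - y) \<bullet> b\<bar>)" by (rule norm_le_l1)
  also have "\<dots> = (\<Sum>b\<in>D. \<bar>(x - y) \<bullet> b\<bar>)"
    using assms(1-3) by (intro sum.mono_neutral_right) (auto simp: mem_span_Basis_iff inner_diff_left)
  also have "\<dots> \<le> (\<Sum>b\<in>D. 1 / real N)" by (rule sum_mono[OF c])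
  finally show ?thesis by simp
qed

text \<open>Two points of E in a nondefective cell are joined by a chain of M short steps inside E that
  follows the segment between them.\<close>

lemma nondefective_variation:
  fixes g :: "'a::euclidean_space \<Rightarrow> 'b::real_normed_vector"
  assumes D: "D \<subseteq> Basis" and E: "E \<subseteq> span D" and N: "1 \<le> N" and M: "1 \<le> M" and "0 \<le> C"
    and g: "\<And>x y. x \<in> E \<Longrightarrow> y \<in> E \<Longrightarrow> norm (g x - g y) \<le> C * norm (x - y) ^ k"
    and x: "x \<in> E" and y: "y \<in> E" and eq: "cell D N x = cell D N y"
    and nd: "cell D N x \<notin> defective D E M N"
  shows "norm (g x - g y) \<le> real M * (C * (3 * real (card D) / (real M * real N)) ^ k)"
proof -
  define p where "p = (\<lambda>t::nat. x + (real t / real M) *\<^sub>R (y - x))"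
  have pD: "p t \<in> span D" for t using E x y by (auto simp: p_def intro!: span_add span_scale span_diff)
  \<comment> \<open>A cell is convex, so the whole segment stays in it: between two numbers with
    equal floor the floor is constant.\<close>
  have cp: "cell D N (p t) = cell D N x" if "t \<le> M" for t
  proof -
    have "\<lfloor>real N * (p t \<bullet> b)\<rfloor> = \<lfloor>real N * (x \<bullet> b)\<rfloor>" if "b \<in> D" for b
    proof -
      define s where "s = real t / real M"
      have s: "0 \<le> s" "s \<le> 1" using \<open>t \<le> M\<close> M by (auto simp: s_def)
      have xy: "\<lfloor>real N * (x \<bullet> b)\<rfloor> = \<lfloor>real N * (y \<bullet> b)\<rfloor>"
        using fun_cong[OF eq, of b] that by (simp add: cell_def)
      define X where "X = real N * (x \<bullet> b)"
      define Y where "Y = real N * (y \<bullet> b)"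
      have "real N * (p t \<bullet> b) = (1 - s) * X + s * Y"
        by (simp add: p_def s_def[symmetric] X_def Y_def inner_add_left inner_diff_left algebra_simps)
      moreover have "\<lfloor>(1 - s) * X + s * Y\<rfloor> = \<lfloor>X\<rfloor>"
      proof (cases "X \<le> Y")
        case True
        then have "0 \<le> s * (Y - X)" "s * (Y - X) \<le> Y - X" using s by (auto simp: mult_left_le_one_le)
        moreover have "(1 - s) * X + s * Y = X + s * (Y - X)" by (simp add: algebra_simps)
        ultimately have "X \<le> (1 - s) * X + s * Y" "(1 - s) * X + s * Y \<le> Y" by linarith+
        then show ?thesis using xy unfolding X_def[symmetric] Y_def[symmetric] by linarith
      next
        case False
        then have "0 \<le> s * (X - Y)" "s * (X - Y) \<le> X - Y" using s by (auto simp: mult_left_le_one_le)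
        moreover have "(1 - s) * X + s * Y = X - s * (X - Y)" by (simp add: algebra_simps)
        ultimately have "Y \<le> (1 - s) * X + s * Y" "(1 - s) * X + s * Y \<le> X" by linarith+
        then show ?thesis using xy unfolding X_def[symmetric] Y_def[symmetric] by linarith
      qed
      ultimately show ?thesis by (simp add: X_def)
    qed
    then show ?thesis by (auto simp: cell_def fun_eq_iff restrict_def)
  qed
  have "\<exists>e\<in>E. cell D (M * N) e = cell D (M * N) (p t)" if "t \<le> M" for t
  proof -
    have "cell D (M * N) (p t) \<in> subcells D M (cell D N x)"
      using cell_in_subcells[OF M, of D N "p t"] cp[OF that] by simp
    then have "cell D (M * N) (p t) \<in> cell D (M * N) ` E" using nd x unfolding defective_def by blast
    then show ?thesis by (metis image_iff)
  qed
  then obtain e' where e': "\<And>t. t \<le> M \<Longrightarrow> e' t \<in> E \<and> cell D (M * N) (e' t) = cell D (M * N) (p t)" by metis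
  \<comment> \<open>The chain must start at x and end at y exactly; in between it takes points of E
    from the fine cells that the segment visits.\<close>
  define e where "e = (\<lambda>t. if t = 0 then x else if t = M then y else e' t)"
  have p0: "p 0 = x" "p M = y" using M by (auto simp: p_def)
  have e: "e t \<in> E" "cell D (M * N) (e t) = cell D (M * N) (p t)" if "t \<le> M" for t
    using e'[OF that] x y p0 by (auto simp: e_def)
  define d where "d = real (card D) / (real M * real N)"
  have ep: "norm (e t - p t) \<le> d" if "t \<le> M" for t
    using cell_eq_norm_le[OF D _ pD e(2)[OF that]] e(1)[OF that] E M N by (auto simp: d_def)
  have pp: "norm (p (Suc t) - p t) \<le> d" for t
  proof -
    have "p (Suc t) - p t = (1 / real M) *\<^sub>R (y - x)"
      by (simp add: p_def algebra_simps add_divide_distrib)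
    then have "norm (p (Suc t) - p t) = norm (y - x) / real M" by simp
    also have "\<dots> \<le> (real (card D) / real N) / real M"
      using cell_eq_norm_le[OF D _ _ eq N] E x y by (intro divide_right_mono) (auto simp: norm_minus_commute)
    finally show ?thesis by (simp add: d_def mult.commute)
  qed
  \<comment> \<open>A step of the chain is at most a step along the segment plus the distances of
    its two ends to the segment, each of the three at most d.\<close>
  have step: "norm (g (e (Suc t)) - g (e t)) \<le> C * (3 * d) ^ k" if "t < M" for t
  proof -
    have "e (Suc t) - e t = (e (Suc t) - p (Suc t)) + (p (Suc t) - p t) - (e t - p t)" by simp
    then have "norm (e (Suc t) - e t) \<le> d + d + d"
      using ep[of "Suc t"] ep[of t] pp[of t] that
      by (smt (verit) Suc_leI less_imp_le norm_triangle_ineq norm_triangle_ineq4)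
    then have "norm (e (Suc t) - e t) ^ k \<le> (3 * d) ^ k" by (intro power_mono) auto
    then have "C * norm (e (Suc t) - e t) ^ k \<le> C * (3 * d) ^ k" using \<open>0 \<le> C\<close> by (rule mult_left_mono)
    then show ?thesis using g[OF e(1) e(1), of "Suc t" t] that by simp
  qed
  have "norm (g y - g x) = norm (\<Sum>t<M. g (e (Suc t)) - g (e t))"
    using M by (subst sum_lessThan_telescope) (auto simp: e_def)
  also have "\<dots> \<le> (\<Sum>t<M. C * (3 * d) ^ k)"
    using step by (intro order_trans[OF norm_sum] sum_mono) auto
  finally show ?thesis by (simp add: d_def norm_minus_commute)
qed


text \<open>\<open>V i\<close> is the volume of the union of the cells of side M^(-i) that meet E.
  Dividing the count in \<open>card_defective\<close> by the scale shows that the volume of the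
  defective cells is controlled by the drop of \<open>V\<close> in one refinement.\<close>

lemma cell_volume_antimono:
  assumes "finite D" "bounded E" "D \<subseteq> Basis" "1 \<le> M"
  defines "V \<equiv> \<lambda>i. real (card (cell D (M ^ i) ` E)) / real (M ^ i) ^ card D"
  shows "real (card (defective D E M (M ^ i))) / real (M ^ i) ^ card D \<le> real (M ^ card D) * (V i - V (Suc i))"
proof -
  let ?a = "real (card (cell D (M ^ i) ` E))" and ?a' = "real (card (cell D (M ^ Suc i) ` E))"
    and ?n = "real (card (defective D E M (M ^ i)))" and ?N = "real (M ^ i) ^ card D"
  have "?a' + ?n \<le> real (M ^ card D) * ?a"
    using card_defective[OF assms(1-4), of "M ^ i"] by (simp flip: of_nat_add of_nat_mult of_nat_power)
  then have "?n / ?N \<le> (real (M ^ card D) * ?a - ?a') / ?N"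
    by (intro divide_right_mono) auto
  also have "\<dots> = real (M ^ card D) * (V i - V (Suc i))"
    using assms(4) by (simp add: V_def field_simps power_mult_distrib)
  finally show ?thesis .
qed

section \<open>Null images under flat maps\<close>

lemma negligible_if_bounded:
  fixes P :: "'a::euclidean_space \<Rightarrow> bool"
  assumes "\<And>R. 0 \<le> R \<Longrightarrow> negligible {v. norm v \<le> R \<and> P v}"
  shows "negligible {v. P v}"
proof -
  have "negligible (\<Union>R::nat. {v. norm v \<le> real R \<and> P v})"
    by (intro negligible_countable_Union) (auto intro: assms)
  moreover have "{v. P v} \<subseteq> (\<Union>R::nat. {v. norm v \<le> real R \<and> P v})"
  proof
    fix v assume "v \<in> {v. P v}"
    moreover obtain n :: nat where "norm v \<le> real n" using real_arch_simple by blast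
    ultimately show "v \<in> (\<Union>R::nat. {v. norm v \<le> real R \<and> P v})" by blast
  qed
  ultimately show ?thesis by (rule negligible_subset)
qed

text \<open>Write d = card D' and j = card D. At scale N = M^i there are at most V0 N^d cells, and
  the direct estimate bounds the D-volume over each by a multiple of N^(-k j); with d <= k j the
  total is merely bounded. In a nondefective cell a chain of M steps improves the diameter by the
  factor M^(1 - k), at most 1/M since k >= 2. The defective cells have volume tending to 0, because
  the decreasing volumes \<open>V i\<close> converge. So M is chosen for the first contribution, and
  afterwards i for the second.\<close>

lemma flat_image_negligible:
  fixes g :: "'a::euclidean_space \<Rightarrow> 'b::euclidean_space"
  assumes D': "D' \<subseteq> Basis" and E: "E \<subseteq> span D'" "bounded E" and D: "D \<subseteq> Basis" "D \<noteq> {}" and "0 \<le> C"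
    and k: "2 \<le> k" "card D' \<le> k * card D"
    and g: "\<And>x y. x \<in> E \<Longrightarrow> y \<in> E \<Longrightarrow> norm (g x - g y) \<le> C * norm (x - y) ^ k"
  shows "negligible {v. \<exists>x\<in>E. \<forall>e\<in>D. v \<bullet> e = g x \<bullet> e}"
proof -
  define j where "j = card D"
  define d where "d = card D'"
  have fD: "finite D" "finite D'" using D D' finite_subset finite_Basis by blast+
  have "1 \<le> j" using D fD by (simp add: j_def Suc_le_eq card_gt_0_iff)
  have "negligible {v. norm v \<le> R \<and> (\<exists>x\<in>E. \<forall>e\<in>D. v \<bullet> e = g x \<bullet> e)}" if "0 \<le> R" for R
    unfolding negligible_outer
  proof (intro allI impI)
    fix \<epsilon> :: real assume "\<epsilon> > 0"
    define H where "H = (2 * R) ^ (DIM('b) - card D)"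
    have "0 \<le> H" using \<open>0 \<le> R\<close> by (simp add: H_def)
    define V0 where "V0 = real (card (cell D' 1 ` E))"
    \<comment> \<open>\<open>K / M\<close> will bound the volume over the nondefective cells and
      \<open>n i * K2\<close> the volume over the defective ones, up to the factor H of the free
      coordinates.\<close>
    define K where "K = V0 * (2 * C * (3 * real d) ^ k) ^ j"
    define K2 where "K2 = (2 * C * real d ^ k) ^ j"
    have "0 \<le> K" "0 \<le> K2" "0 \<le> V0" using \<open>0 \<le> C\<close> by (auto simp: K_def K2_def V0_def)
    obtain M :: nat where "K * H / (\<epsilon> / 2) < real M" using reals_Archimedean2 by blast
    then have "K * H / (\<epsilon> / 2) < real (max M 1)" by linarith
    then obtain M :: nat where M: "1 \<le> M" "K * H / (\<epsilon> / 2) < real M" by (metis max.cobounded2)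
    have KH: "K * H / real M < \<epsilon> / 2" using M \<open>\<epsilon> > 0\<close> by (simp add: field_simps)
    define V where "V = (\<lambda>i. real (card (cell D' (M ^ i) ` E)) / real (M ^ i) ^ card D')"
    define n where "n = (\<lambda>i. real (card (defective D' E M (M ^ i))) / real (M ^ i) ^ card D')"
    have nV: "n i \<le> real (M ^ card D') * (V i - V (Suc i))" for i
      using cell_volume_antimono[OF fD(2) E(2) D' M(1), of i] by (simp add: n_def V_def)
    have n0: "0 \<le> n i" for i by (simp add: n_def)
    have dec: "V (Suc i) \<le> V i" for i
    proof -
      have "0 \<le> real (M ^ card D') * (V i - V (Suc i))" using nV[of i] n0[of i] by linarith
      moreover have "0 < real (M ^ card D')" using M(1) by simp
      ultimately show ?thesis by (metis diff_ge_0_iff_ge zero_le_mult_iff not_le)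
    qed
    then have decV: "decseq V" by (simp add: decseq_SucI)
    have V0: "0 \<le> V i" for i by (simp add: V_def)
    \<comment> \<open>A decreasing sequence bounded below converges, so its successive differences,
      multiples of which dominate n, tend to 0.\<close>
    obtain L where L: "V \<longlonglongrightarrow> L" using decseq_convergent[OF decV, of 0] V0 by blast
    have "(\<lambda>i. real (M ^ card D') * (V i - V (Suc i))) \<longlonglongrightarrow> real (M ^ card D') * (L - L)"
      using L LIMSEQ_Suc[OF L] by (intro tendsto_intros)
    then have "(\<lambda>i. real (M ^ card D') * (V i - V (Suc i))) \<longlonglongrightarrow> 0" by simp
    then have "n \<longlonglongrightarrow> 0"
      by (rule tendsto_sandwich[of "\<lambda>_. 0" n, rotated 3]) (use nV n0 in auto)
    then have "(\<lambda>i. n i * K2 * H) \<longlonglongrightarrow> 0 * K2 * H" by (intro tendsto_intros)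
    then have "eventually (\<lambda>i. n i * K2 * H < \<epsilon> / 2) sequentially"
      using \<open>\<epsilon> > 0\<close> by (intro order_tendstoD) auto
    then obtain i where i: "n i * K2 * H < \<epsilon> / 2" by (auto simp: eventually_sequentially)
    define N where "N = M ^ i"
    have N: "1 \<le> N" using M(1) by (simp add: N_def)
    \<comment> \<open>Here d <= k j enters: the growth of the number of cells is outweighed by the
      decay of the image volumes.\<close>
    have ND: "real N ^ d * (1 / real N ^ k) ^ j \<le> 1"
    proof -
      have "real N ^ d \<le> real N ^ (k * j)" using k(2) N by (intro power_increasing) (auto simp: d_def j_def)
      also have "real N ^ (k * j) = (real N ^ k) ^ j" by (rule power_mult)
      finally show ?thesis using N by (simp add: power_one_over field_simps)
    qed
    let ?C = "cell D' N ` E" and ?B = "defective D' E M N"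
    have fC: "finite ?C" by (rule finite_cells[OF fD(2) E(2) D'])
    have BC: "?B \<subseteq> ?C" by (auto simp: defective_def)
    define \<delta>1 where "\<delta>1 = real M * (C * (3 * real d / (real M * real N)) ^ k)"
    define \<delta>2 where "\<delta>2 = C * (real d / real N) ^ k"
    define \<delta> where "\<delta> = (\<lambda>Q. if Q \<in> ?B then \<delta>2 else \<delta>1)"
    have \<delta>0: "0 \<le> \<delta>1" "0 \<le> \<delta>2" using \<open>0 \<le> C\<close> by (auto simp: \<delta>1_def \<delta>2_def)
    have \<delta>nn: "0 \<le> \<delta> Q" for Q using \<delta>0 by (simp add: \<delta>_def)
    have gd: "norm (g x - g y) \<le> \<delta> (cell D' N x)" if "x \<in> E" "y \<in> E" "cell D' N x = cell D' N y" for x y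
    proof (cases "cell D' N x \<in> ?B")
      case True
      have "norm (x - y) \<le> real d / real N"
        using cell_eq_norm_le[OF D' _ _ that(3) N] that E(1) by (auto simp: d_def)
      then have "C * norm (x - y) ^ k \<le> \<delta>2"
        unfolding \<delta>2_def using \<open>0 \<le> C\<close> by (intro mult_left_mono power_mono) auto
      then show ?thesis using g[OF that(1,2)] True by (simp add: \<delta>_def)
    next
      case False
      then show ?thesis
        using nondefective_variation[OF D' E(1) N M(1) \<open>0 \<le> C\<close> g that False] by (simp add: \<delta>_def \<delta>1_def d_def)
    qed
    have "\<exists>T. {v. norm v \<le> R \<and> (\<exists>x\<in>E. \<forall>e\<in>D. v \<bullet> e = g x \<bullet> e)} \<subseteq> T \<and> T \<in> lmeasurable \<and>
      measure lebesgue T \<le> (\<Sum>Q\<in>?C. (2 * \<delta> Q) ^ card D) * (2 * R) ^ (DIM('b) - card D)"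
      by (rule cylinder_outer_measure[OF D(1) fC \<open>0 \<le> R\<close>, of \<delta> g]) (rule \<delta>nn, rule gd)
    then obtain T where T: "{v. norm v \<le> R \<and> (\<exists>x\<in>E. \<forall>e\<in>D. v \<bullet> e = g x \<bullet> e)} \<subseteq> T" "T \<in> lmeasurable"
      "measure lebesgue T \<le> (\<Sum>Q\<in>?C. (2 * \<delta> Q) ^ card D) * (2 * R) ^ (DIM('b) - card D)"
      by (elim exE conjE) (rule that)
    have "(\<Sum>Q\<in>?C. (2 * \<delta> Q) ^ j) \<le> (\<Sum>Q\<in>?C. (2 * \<delta>1) ^ j + (if Q \<in> ?B then (2 * \<delta>2) ^ j else 0))"
      using \<delta>0 by (intro sum_mono) (auto simp: \<delta>_def)
    also have "\<dots> = real (card ?C) * (2 * \<delta>1) ^ j + real (card ?B) * (2 * \<delta>2) ^ j"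
    proof -
      have "?C \<inter> {Q. Q \<in> ?B} = ?B" using BC by auto
      then show ?thesis using fC by (simp add: sum.distrib sum.If_cases)
    qed
    also have "\<dots> \<le> K / real M + n i * K2"
    proof (rule add_mono)
      have cC: "real (card ?C) = V i * real N ^ d" using M(1) by (simp add: V_def N_def d_def)
      have "V i \<le> V 0" using decV by (simp add: decseq_def)
      also have "V 0 = V0" by (simp add: V_def V0_def)
      finally have Vi: "V i \<le> V0" .
      \<comment> \<open>Two of the k factors 1/M suffice: one cancels M, one is left, and raising to
        the power j >= 1 does not exceed it.\<close>
      have M1: "(real M * (1 / real M) ^ k) ^ j \<le> 1 / real M"
      proof -
        obtain k' where k': "k = Suc (Suc k')" using k(1) by (metis add_2_eq_Suc le_Suc_ex)
        have "real M * (1 / real M) ^ k = (1 / real M) ^ Suc k'" using M(1) by (simp add: k')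
        moreover have "((1 / real M) ^ Suc k') ^ j \<le> (1 / real M) ^ 1"
          unfolding power_mult[symmetric] using M(1) \<open>1 \<le> j\<close> by (intro power_decreasing) auto
        ultimately show ?thesis by simp
      qed
      have "2 * \<delta>1 = (2 * C * (3 * real d) ^ k) * (real M * (1 / real M) ^ k) * (1 / real N ^ k)"
        by (simp add: \<delta>1_def power_divide power_mult_distrib)
      then have "(2 * \<delta>1) ^ j = (2 * C * (3 * real d) ^ k) ^ j * (real M * (1 / real M) ^ k) ^ j * (1 / real N ^ k) ^ j"
        by (simp only: power_mult_distrib)
      then have "real (card ?C) * (2 * \<delta>1) ^ j =
          (V i * (2 * C * (3 * real d) ^ k) ^ j) * (real M * (1 / real M) ^ k) ^ j * (real N ^ d * (1 / real N ^ k) ^ j)"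
        using cC by (simp add: mult_ac)
      also have "\<dots> \<le> K * (1 / real M) * 1"
        unfolding K_def using Vi M1 ND \<open>0 \<le> C\<close> V0 \<open>0 \<le> V0\<close> by (intro mult_mono) auto
      finally show "real (card ?C) * (2 * \<delta>1) ^ j \<le> K / real M" by simp
      have cB: "real (card ?B) = n i * real N ^ d" using M(1) by (simp add: n_def N_def d_def)
      have "2 * \<delta>2 = (2 * C * real d ^ k) * (1 / real N ^ k)"
        by (simp add: \<delta>2_def power_divide)
      then have "(2 * \<delta>2) ^ j = K2 * (1 / real N ^ k) ^ j"
        by (simp only: power_mult_distrib K2_def)
      then have "real (card ?B) * (2 * \<delta>2) ^ j = (n i * K2) * (real N ^ d * (1 / real N ^ k) ^ j)"
        using cB by (simp add: mult_ac)
      also have "\<dots> \<le> (n i * K2) * 1"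
        using ND n0[of i] \<open>0 \<le> K2\<close> by (intro mult_left_mono) auto
      finally show "real (card ?B) * (2 * \<delta>2) ^ j \<le> n i * K2" by simp
    qed
    finally have "(\<Sum>Q\<in>?C. (2 * \<delta> Q) ^ j) * H \<le> (K / real M + n i * K2) * H"
      using \<open>0 \<le> H\<close> by (rule mult_right_mono)
    also have "\<dots> = K * H / real M + n i * K2 * H" by (simp add: distrib_right)
    also have "\<dots> < \<epsilon>" using add_strict_mono[OF KH i] by simp
    finally have "measure lebesgue T < \<epsilon>" using T(3) by (simp add: H_def j_def)
    then show "\<exists>T. {v. norm v \<le> R \<and> (\<exists>x\<in>E. \<forall>e\<in>D. v \<bullet> e = g x \<bullet> e)} \<subseteq> T \<and> T \<in> lmeasurable \<and> measure lebesgue T < \<epsilon>"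
      using T(1,2) by blast
  qed
  then show ?thesis by (rule negligible_if_bounded)
qed

text \<open>For k = 1 chains gain nothing, as M^(1 - k) = 1. Instead the increments on fine cells
  are at most \<eta> times the cell size, and since card D' <= card D the volumes add up to at most
  a multiple of \<eta>.\<close>

lemma flat_image_negligible_C1:
  fixes g :: "'a::euclidean_space \<Rightarrow> 'b::euclidean_space"
  assumes D': "D' \<subseteq> Basis" and E: "E \<subseteq> span D'" "bounded E" and D: "D \<subseteq> Basis" "D \<noteq> {}"
    and k: "card D' \<le> card D"
    and g: "\<And>\<eta>. \<eta> > 0 \<Longrightarrow> \<exists>\<delta>>0. \<forall>x\<in>E. \<forall>y\<in>E. norm (x - y) < \<delta> \<longrightarrow> norm (g x - g y) \<le> \<eta> * norm (x - y)"
  shows "negligible {v. \<exists>x\<in>E. \<forall>e\<in>D. v \<bullet> e = g x \<bullet> e}"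
proof -
  define j where "j = card D"
  define d where "d = card D'"
  have fD: "finite D" "finite D'" using D D' finite_subset finite_Basis by blast+
  have "1 \<le> j" using D fD by (simp add: j_def Suc_le_eq card_gt_0_iff)
  have "negligible {v. norm v \<le> R \<and> (\<exists>x\<in>E. \<forall>e\<in>D. v \<bullet> e = g x \<bullet> e)}" if "0 \<le> R" for R
    unfolding negligible_outer
  proof (intro allI impI)
    fix \<epsilon> :: real assume "\<epsilon> > 0"
    define H where "H = (2 * R) ^ (DIM('b) - card D)"
    have "0 \<le> H" using \<open>0 \<le> R\<close> by (simp add: H_def)
    define V0 where "V0 = real (card (cell D' 1 ` E))"
    define K where "K = V0 * (2 * real d) ^ j * H"
    have "0 \<le> K" "0 \<le> V0" using \<open>0 \<le> H\<close> by (auto simp: K_def V0_def)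
    \<comment> \<open>The bound 1 gives \<open>\<eta> ^ j \<le> \<eta>\<close>; the summand 1 in K +
      1 avoids a division by zero.\<close>
    define \<eta> where "\<eta> = min 1 (\<epsilon> / (K + 1) / 2)"
    have \<eta>: "0 < \<eta>" "\<eta> \<le> 1" "\<eta> \<le> \<epsilon> / (K + 1) / 2"
      unfolding \<eta>_def using \<open>\<epsilon> > 0\<close> \<open>0 \<le> K\<close> by (simp_all add: add_nonneg_pos)
    have "\<eta> * K \<le> \<epsilon> / (K + 1) / 2 * (K + 1)" using \<eta> \<open>0 \<le> K\<close> \<open>\<epsilon> > 0\<close> by (intro mult_mono) auto
    also have "\<dots> = \<epsilon> / 2" using \<open>0 \<le> K\<close> by (simp add: field_simps)
    finally have \<eta>K: "\<eta> * K < \<epsilon>" using \<open>\<epsilon> > 0\<close> by simp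
    obtain \<delta> where \<delta>: "\<delta> > 0" "\<And>x y. x \<in> E \<Longrightarrow> y \<in> E \<Longrightarrow> norm (x - y) < \<delta> \<Longrightarrow> norm (g x - g y) \<le> \<eta> * norm (x - y)"
      using g[OF \<eta>(1)] by blast
    obtain N where N: "1 \<le> N" "real d / real N < \<delta>"
    proof -
      obtain N :: nat where "real d / \<delta> < real N" using reals_Archimedean2 by blast
      then have "real d / \<delta> < real (Suc N)" by simp
      then have "real d / real (Suc N) < \<delta>" using \<delta>(1) by (simp add: field_simps)
      moreover have "1 \<le> Suc N" by simp
      ultimately show thesis using that by blast
    qed
    let ?C = "cell D' N ` E"
    have fC: "finite ?C" by (rule finite_cells[OF fD(2) E(2) D'])
    have cC: "real (card ?C) \<le> V0 * real N ^ d"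
    proof -
      \<comment> \<open>The unit grid is the coarse grid of the count: a unit cell consists of N^d
        cells of side 1/N.\<close>
      have "card ?C \<le> N ^ d * card (cell D' 1 ` E)"
        using card_defective[OF fD(2) E(2) D' N(1), of 1] by (simp add: d_def)
      then have "real (card ?C) \<le> real (N ^ d * card (cell D' 1 ` E))" by (rule of_nat_mono)
      then show ?thesis by (simp add: V0_def mult.commute)
    qed
    have gd: "norm (g x - g y) \<le> \<eta> * (real d / real N)" if "x \<in> E" "y \<in> E" "cell D' N x = cell D' N y" for x y
    proof -
      have n: "norm (x - y) \<le> real d / real N"
        using cell_eq_norm_le[OF D' _ _ that(3) N(1)] that E(1) by (auto simp: d_def)
      then have "norm (g x - g y) \<le> \<eta> * norm (x - y)" using \<delta>(2)[OF that(1,2)] N(2) by simp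
      also have "\<dots> \<le> \<eta> * (real d / real N)" using n \<eta>(1) by (intro mult_left_mono) auto
      finally show ?thesis .
    qed
    obtain T where T: "{v. norm v \<le> R \<and> (\<exists>x\<in>E. \<forall>e\<in>D. v \<bullet> e = g x \<bullet> e)} \<subseteq> T" "T \<in> lmeasurable"
      "measure lebesgue T \<le> (\<Sum>Q\<in>?C. (2 * (\<eta> * (real d / real N))) ^ card D) * (2 * R) ^ (DIM('b) - card D)"
      using cylinder_outer_measure[OF D(1) fC \<open>0 \<le> R\<close>, of "\<lambda>_. \<eta> * (real d / real N)" g] \<eta>(1) gd by auto
    have "(\<Sum>Q\<in>?C. (2 * (\<eta> * (real d / real N))) ^ j) = real (card ?C) * ((2 * real d) ^ j * \<eta> ^ j / real N ^ j)"
      by (simp add: power_mult_distrib power_divide)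
    also have "\<dots> \<le> (V0 * real N ^ d) * ((2 * real d) ^ j * \<eta> ^ j / real N ^ j)"
      using cC \<eta>(1) by (intro mult_right_mono) auto
    also have "\<dots> = (V0 * (2 * real d) ^ j) * (\<eta> ^ j * (real N ^ d / real N ^ j))" by simp
    also have "\<dots> \<le> (V0 * (2 * real d) ^ j) * (\<eta> * 1)"
    proof (intro mult_left_mono mult_mono)
      show "\<eta> ^ j \<le> \<eta>" using \<eta> \<open>1 \<le> j\<close> power_decreasing[of 1 j \<eta>] by simp
      have "real N ^ d \<le> real N ^ j" using k N by (intro power_increasing) (auto simp: d_def j_def)
      then show "real N ^ d / real N ^ j \<le> 1" using N by simp
    qed (use \<eta>(1) \<open>0 \<le> V0\<close> in auto)
    finally have "(\<Sum>Q\<in>?C. (2 * (\<eta> * (real d / real N))) ^ j) * H \<le> (V0 * (2 * real d) ^ j) * (\<eta> * 1) * H"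
      using \<open>0 \<le> H\<close> by (rule mult_right_mono)
    also have "\<dots> < \<epsilon>" using \<eta>K by (simp add: K_def mult_ac)
    finally have "measure lebesgue T < \<epsilon>" using T(3) by (simp add: H_def j_def)
    then show "\<exists>T. {v. norm v \<le> R \<and> (\<exists>x\<in>E. \<forall>e\<in>D. v \<bullet> e = g x \<bullet> e)} \<subseteq> T \<and> T \<in> lmeasurable \<and> measure lebesgue T < \<epsilon>"
      using T(1,2) by blast
  qed
  then show ?thesis by (rule negligible_if_bounded)
qed

section \<open>Sard's theorem\<close>

lemma negligible_borel_iff:
  "X \<in> sets borel \<Longrightarrow> negligible X \<longleftrightarrow> emeasure lborel X = 0"
  by (simp add: negligible_iff_emeasure0)

text \<open>The shear (b, a) to (b + T a, a) turns the set of bad pairs into the product of X with the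
  whole space.\<close>

lemma negligible_if_slices:
  fixes T :: "'a::euclidean_space \<Rightarrow> 'b::euclidean_space"
  assumes T: "linear T" and X: "X \<in> sets borel" and sl: "\<And>b. negligible {a. b + T a \<in> X}"
  shows "negligible X"
proof -
  have Tb: "T \<in> borel_measurable borel"
    using T by (intro borel_measurable_continuous_onI linear_continuous_on) (simp add: linear_conv_bounded_linear)
  define Y where "Y = {p :: 'b \<times> 'a. fst p + T (snd p) \<in> X}"
  have cT: "continuous_on UNIV T"
    using T by (intro linear_continuous_on) (simp add: linear_conv_bounded_linear)
  have "(\<lambda>p. fst p + T (snd p)) \<in> borel_measurable (borel :: ('b \<times> 'a) measure)"
    by (intro borel_measurable_continuous_onI continuous_intros continuous_on_compose2[OF cT]) auto
  from measurable_sets[OF this X] have Yb: "Y \<in> sets (borel :: ('b \<times> 'a) measure)"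
    by (simp add: Y_def vimage_def)
  then have Y: "Y \<in> sets (lborel \<Otimes>\<^sub>M (lborel :: 'a measure))" unfolding lborel_prod sets_lborel .
  have "emeasure lborel (Pair b -` Y) = 0" for b
  proof -
    have "Pair b -` Y = {a. b + T a \<in> X}" by (auto simp: Y_def)
    moreover have "{a. b + T a \<in> X} \<in> sets borel"
    proof -
      have "(\<lambda>a. b + T a) \<in> borel_measurable borel" using Tb by measurable
      from measurable_sets[OF this X] show ?thesis by (simp add: vimage_def)
    qed
    ultimately show ?thesis using sl[of b] by (simp add: negligible_borel_iff)
  qed
  then have "emeasure (lborel \<Otimes>\<^sub>M (lborel :: 'a measure)) Y = 0"
    by (subst lborel.emeasure_pair_measure_alt[OF Y]) simp
  then have nY: "negligible Y" using Yb by (simp add: negligible_borel_iff lborel_prod)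
  define f where "f = (\<lambda>p::'b \<times> 'a. (fst p + T (snd p), snd p))"
  have "linear f" unfolding f_def
    by (rule linearI) (auto simp: linear_add[OF T] linear_cmul[OF T] algebra_simps)
  then have "f differentiable_on Y" by (rule linear_imp_differentiable_on)
  then have "negligible (f ` Y)" using nY by (intro negligible_differentiable_image_negligible) auto
  moreover have "X \<times> (UNIV :: 'a set) \<subseteq> f ` Y"
  proof
    fix p assume "p \<in> X \<times> (UNIV :: 'a set)"
    then obtain x a where p: "p = (x, a)" "x \<in> X" by auto
    have "p = f (x - T a, a)" "(x - T a, a) \<in> Y" using p by (auto simp: f_def Y_def)
    then show "p \<in> f ` Y" by blast
  qed
  ultimately have "negligible (X \<times> (UNIV :: 'a set))" by (rule negligible_subset)
  moreover have "X \<times> (UNIV :: 'a set) \<in> sets borel"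
  proof -
    have "X \<times> (UNIV :: 'a set) \<in> sets (lborel \<Otimes>\<^sub>M lborel)" using X by auto
    then show ?thesis unfolding lborel_prod sets_lborel .
  qed
  ultimately have "emeasure (lborel \<Otimes>\<^sub>M lborel) (X \<times> (UNIV :: 'a set)) = 0"
    by (simp add: negligible_borel_iff lborel_prod)
  \<comment> \<open>The whole space has infinite measure, so the other factor vanishes.\<close>
  then have "emeasure lborel X * emeasure lborel (UNIV :: 'a set) = 0"
    using X by (subst (asm) lborel.emeasure_pair_measure_Times) auto
  then have "emeasure lborel X = 0" by (simp add: emeasure_lborel_UNIV)
  then show ?thesis using X by (simp add: negligible_borel_iff)
qed

text \<open>An open set is a countable union of compact sets, hence so is a relatively closed subset
  of it, and continuous images of compact sets are compact.\<close>

lemma borel_image_closedin: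
  fixes f :: "'a::euclidean_space \<Rightarrow> 'b::euclidean_space"
  assumes S: "open S" and K: "closedin (top_of_set S) K" and f: "continuous_on S f"
  shows "f ` K \<in> sets borel"
proof -
  obtain C :: "nat \<Rightarrow> 'a set" where C: "\<And>n. compact (C n)" "\<And>n. C n \<subseteq> S" "\<Union>(range C) = S"
  proof (rule open_Union_compact_subsets[OF S])
    fix C :: "nat \<Rightarrow> 'a set"
    assume C: "\<And>n. compact (C n)" "\<And>n. C n \<subseteq> S" "\<Union>(range C) = S"
    show thesis by (rule that[OF C])
  qed
  obtain T where T: "closed T" "K = S \<inter> T" using K by (auto simp: closedin_closed)
  have "f ` K = (\<Union>n. f ` (C n \<inter> T))" unfolding T(2) using C(3) by blast
  moreover have "f ` (C n \<inter> T) \<in> sets borel" for n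
    using C(1,2) T(1) f
    by (intro borel_compact compact_continuous_image compact_Int_closed) (auto intro: continuous_on_subset)
  ultimately show ?thesis by auto
qed

definition coord_proj :: "'b::euclidean_space set \<Rightarrow> 'b \<Rightarrow> 'b" where
  "coord_proj D v = (\<Sum>e\<in>D. (v \<bullet> e) *\<^sub>R e)"

lemma linear_coord_proj: "linear (coord_proj D)"
  unfolding coord_proj_def
  by (intro linear_compose_sum ballI linearI) (auto simp: inner_add_left scaleR_add_left)

lemma coord_proj_inner:
  assumes "D \<subseteq> Basis" "e \<in> Basis" shows "coord_proj D v \<bullet> e = (if e \<in> D then v \<bullet> e else 0)"
proof -
  have fD: "finite D" using assms finite_subset finite_Basis by blast
  have "coord_proj D v \<bullet> e = (\<Sum>i\<in>D. if i = e then v \<bullet> e else 0)"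
    unfolding coord_proj_def inner_sum_left
    using assms by (intro sum.cong) (auto simp: inner_Basis)
  then show ?thesis using fD by simp
qed

lemma coord_proj_eq_iff:
  assumes "D \<subseteq> Basis" shows "coord_proj D v = coord_proj D u \<longleftrightarrow> (\<forall>e\<in>D. v \<bullet> e = u \<bullet> e)"
proof
  assume "coord_proj D v = coord_proj D u"
  then show "\<forall>e\<in>D. v \<bullet> e = u \<bullet> e" using coord_proj_inner[OF assms] assms by (metis subsetD)
next
  assume "\<forall>e\<in>D. v \<bullet> e = u \<bullet> e" then show "coord_proj D v = coord_proj D u" by (simp add: coord_proj_def)
qed

lemma coord_proj_in_span: "coord_proj D v \<in> span D"
  unfolding coord_proj_def by (intro span_sum span_scale span_base)

text \<open>The cylinder is the preimage, under the projection to the coordinates D, of the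
  projected image of K.\<close>

lemma borel_cylinder:
  fixes h :: "'a::euclidean_space \<Rightarrow> 'b::euclidean_space"
  assumes "open S" "closedin (top_of_set S) K" "continuous_on S h" "D \<subseteq> Basis"
  shows "{v. \<exists>z\<in>K. \<forall>e\<in>D. v \<bullet> e = h z \<bullet> e} \<in> sets borel"
proof -
  have c: "continuous_on A (coord_proj D)" for A
    by (simp add: linear_continuous_on linear_coord_proj linear_conv_bounded_linear[symmetric])
  have "continuous_on S (\<lambda>z. coord_proj D (h z))"
    by (rule continuous_on_compose2[OF c assms(3)]) auto
  then have "(\<lambda>z. coord_proj D (h z)) ` K \<in> sets borel" by (rule borel_image_closedin[OF assms(1,2)])
  moreover have "coord_proj D \<in> borel_measurable borel" by (rule borel_measurable_continuous_onI[OF c])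
  ultimately have "coord_proj D -` ((\<lambda>z. coord_proj D (h z)) ` K) \<inter> space borel \<in> sets borel"
    by (rule measurable_sets[rotated])
  moreover have "coord_proj D -` ((\<lambda>z. coord_proj D (h z)) ` K) \<inter> space borel = {v. \<exists>z\<in>K. \<forall>e\<in>D. v \<bullet> e = h z \<bullet> e}"
    using coord_proj_eq_iff[OF assms(4)] by (auto simp: image_iff)
  ultimately show ?thesis by simp
qed

text \<open>The D0-derivatives of h, projected to the coordinates D, fail to generate
  \<open>span D\<close>; w is a covector annihilating them. For empty D no point is critical, which
  starts the induction.\<close>

definition critical_at :: "'a::euclidean_space set \<Rightarrow> 'b::euclidean_space set \<Rightarrow> ('a \<Rightarrow> 'b) \<Rightarrow> 'a \<Rightarrow> bool" where
  "critical_at D0 D h z \<longleftrightarrow> (\<exists>w\<in>span D. w \<noteq> 0 \<and> (\<forall>b\<in>D0. frechet_derivative h (at z) b \<bullet> w = 0))"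

text \<open>Having norm 1 is a closed condition, unlike being nonzero. The critical values thereby
  become the image of a relatively closed set, as measurability requires.\<close>

lemma critical_at_unit:
  "critical_at D0 D h z \<longleftrightarrow> (\<exists>w\<in>span D. norm w = 1 \<and> (\<forall>b\<in>D0. frechet_derivative h (at z) b \<bullet> w = 0))"
proof
  assume "critical_at D0 D h z"
  then obtain w where w: "w \<in> span D" "w \<noteq> 0" "\<forall>b\<in>D0. frechet_derivative h (at z) b \<bullet> w = 0"
    by (auto simp: critical_at_def)
  then show "\<exists>w\<in>span D. norm w = 1 \<and> (\<forall>b\<in>D0. frechet_derivative h (at z) b \<bullet> w = 0)"
    by (intro bexI[of _ "w /\<^sub>R norm w"]) (auto intro: span_scale)
next
  assume "\<exists>w\<in>span D. norm w = 1 \<and> (\<forall>b\<in>D0. frechet_derivative h (at z) b \<bullet> w = 0)"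
  then obtain w where w: "w \<in> span D" "norm w = 1" "\<forall>b\<in>D0. frechet_derivative h (at z) b \<bullet> w = 0" by blast
  from w(2) have "w \<noteq> 0" by force
  with w show "critical_at D0 D h z" unfolding critical_at_def by blast
qed

text \<open>In coordinates where the e-component of h is the coordinate along b, fixing its value y
  leaves the map \<open>h2\<close>, considered in one direction less and with one component less. A
  critical point of h yields a critical point of \<open>h2\<close> with the same remaining
  components, so all slices of the Borel set of critical values are null by the induction
  hypothesis, and Fubini applies.\<close>

lemma sard_step:
  fixes h :: "'a::euclidean_space \<Rightarrow> 'b::euclidean_space"
  assumes D: "D \<subseteq> Basis" "D0 \<subseteq> Basis" "e \<in> D" "b \<in> D0" and V: "open V" "Cn_on k V h" "1 \<le> k" "a \<in> V"
    and nz: "frechet_derivative h (at a) b \<bullet> e \<noteq> 0"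
    and IH: "\<And>V (h :: 'a \<Rightarrow> 'b). open V \<Longrightarrow> Cn_on k V h \<Longrightarrow>
      negligible {v. \<exists>z\<in>V \<inter> span (D0 - {b}). critical_at (D0 - {b}) (D - {e}) h z \<and> (\<forall>e'\<in>D - {e}. v \<bullet> e' = h z \<bullet> e')}"
  obtains V' where "open V'" "a \<in> V'" "V' \<subseteq> V"
    "negligible {v. \<exists>z\<in>V' \<inter> span D0. critical_at D0 D h z \<and> (\<forall>e\<in>D. v \<bullet> e = h z \<bullet> e)}"
proof -
  have b: "b \<in> Basis" and e: "e \<in> Basis" using D by auto
  define g where "g = (\<lambda>x. h x \<bullet> e)"
  have g: "Cn_on k V g" unfolding g_def by (intro Cn_on_inner V Cn_on_const)
  have dh: "(h has_derivative frechet_derivative h (at x)) (at x)" if "x \<in> V" for x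
    using Cn_on_has_derivative[OF V(2,3) that] .
  have "frechet_derivative g (at x) v = frechet_derivative h (at x) v \<bullet> e" if "x \<in> V" for x v
    using frechet_derivative_at[OF has_derivative_inner_left[OF dh[OF that], of e]] by (simp add: g_def fun_eq_iff)
  then have "frechet_derivative g (at a) b \<noteq> 0" using nz V(4) by simp
  note nzg = this
  obtain V' W \<Phi> L where V': "open V'" "a \<in> V'" "V' \<subseteq> V" and W: "open W"
    and "\<And>x. x \<in> V' \<Longrightarrow> frechet_derivative g (at x) b \<noteq> 0"
    and \<Psi>W: "\<And>x. x \<in> V' \<Longrightarrow> x + (g x - x \<bullet> b) *\<^sub>R b \<in> W"
    and \<Phi>\<Psi>: "\<And>x. x \<in> V' \<Longrightarrow> \<Phi> (x + (g x - x \<bullet> b) *\<^sub>R b) = x"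
    and \<Phi>V: "\<And>y. y \<in> W \<Longrightarrow> \<Phi> y \<in> V'" and g\<Phi>: "\<And>y. y \<in> W \<Longrightarrow> g (\<Phi> y) = y \<bullet> b"
    and \<Phi>i: "\<And>y i. y \<in> W \<Longrightarrow> i \<in> Basis \<Longrightarrow> i \<noteq> b \<Longrightarrow> \<Phi> y \<bullet> i = y \<bullet> i"
    and \<Phi>: "Cn_on k W \<Phi>" and "0 \<le> L"
    and "\<And>y h. y \<in> W \<Longrightarrow> norm (frechet_derivative \<Phi> (at y) h) \<le> L * norm h"
    by (rule straighten[OF V(1,4) g V(3) b nzg]) blast
  have nzV': "frechet_derivative h (at x) b \<bullet> e \<noteq> 0" if "x \<in> V'" for x
    using \<open>\<And>x. x \<in> V' \<Longrightarrow> frechet_derivative g (at x) b \<noteq> 0\<close>[OF that]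
      \<open>\<And>x v. x \<in> V \<Longrightarrow> frechet_derivative g (at x) v = frechet_derivative h (at x) v \<bullet> e\<close> that V'(3) by auto
  define X where "X = {v. \<exists>z\<in>V' \<inter> span D0. critical_at D0 D h z \<and> (\<forall>e\<in>D. v \<bullet> e = h z \<bullet> e)}"
  have fD0: "finite D0" using D finite_subset finite_Basis by blast
  have "X \<in> sets borel"
  proof -
    define S where "S = V' \<times> (UNIV :: 'b set)"
    define K where "K = {p \<in> S. fst p \<in> span D0 \<and> snd p \<in> span D \<and> norm (snd p) = 1 \<and>
        (\<Sum>b\<in>D0. (frechet_derivative h (at (fst p)) b \<bullet> snd p)\<^sup>2) = 0}"
    have "open S" using V' by (simp add: S_def open_Times)
    have cd: "continuous_on S (\<lambda>p. frechet_derivative h (at (fst p)) b)" for b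
      by (rule continuous_on_compose2[OF Cn_on_1_continuous_derivative[OF V(2,3), of b]])
        (use V' in \<open>auto simp: S_def intro!: continuous_intros\<close>)
    have "closedin (top_of_set S) (S \<inter> (\<lambda>p. (fst p, snd p, norm (snd p), \<Sum>b\<in>D0. (frechet_derivative h (at (fst p)) b \<bullet> snd p)\<^sup>2))
         -` (span D0 \<times> span D \<times> {1} \<times> {0}))"
      by (intro continuous_closedin_preimage continuous_intros cd closed_Times closed_span)
    also have "S \<inter> (\<lambda>p. (fst p, snd p, norm (snd p), \<Sum>b\<in>D0. (frechet_derivative h (at (fst p)) b \<bullet> snd p)\<^sup>2))
         -` (span D0 \<times> span D \<times> {1} \<times> {0}) = K" by (auto simp: K_def)
    finally have cK: "closedin (top_of_set S) K" .
    have "continuous_on V' h" using Cn_on_continuous[OF V(2)] V'(3) continuous_on_subset by blast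
    then have "continuous_on S (\<lambda>p. h (fst p))"
      by (rule continuous_on_compose2) (auto simp: S_def intro!: continuous_intros)
    from borel_cylinder[OF \<open>open S\<close> cK this D(1)]
    have "{v. \<exists>p\<in>K. \<forall>e\<in>D. v \<bullet> e = h (fst p) \<bullet> e} \<in> sets borel" .
    moreover have "X = {v. \<exists>p\<in>K. \<forall>e\<in>D. v \<bullet> e = h (fst p) \<bullet> e}"
      unfolding X_def critical_at_unit K_def S_def using fD0
      by (auto simp: sum_nonneg_eq_0_iff)
    ultimately show ?thesis by simp
  qed
  \<comment> \<open>Adding v without its e-component leaves the e-component of u unchanged, so this
    slice lies over the single level \<open>y = u \<bullet> e\<close>.\<close>
  moreover have "negligible {v. u + (v - (v \<bullet> e) *\<^sub>R e) \<in> X}" for u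
  proof -
    define y where "y = u \<bullet> e"
    define V2 where "V2 = (\<lambda>x. x + y *\<^sub>R b) -` W"
    define h2 where "h2 = (\<lambda>x. h (\<Phi> (x + y *\<^sub>R b)))"
    have V2: "open V2" unfolding V2_def using W by (intro open_vimage continuous_intros) auto
    have \<Phi>1: "Cn_on k V2 (\<lambda>x. \<Phi> (x + y *\<^sub>R b))"
      by (rule Cn_on_compose[OF V2 W _ \<Phi>]) (auto simp: V2_def intro!: Cn_on_add Cn_on_id V2[unfolded V2_def])
    have h2: "Cn_on k V2 h2" unfolding h2_def
      by (rule Cn_on_compose[OF V2 V(1) \<Phi>1 V(2)]) (use \<Phi>V V' in \<open>auto simp: V2_def\<close>)
    define Z where "Z = {v. \<exists>z\<in>V2 \<inter> span (D0 - {b}). critical_at (D0 - {b}) (D - {e}) h2 z \<and> (\<forall>e'\<in>D - {e}. v \<bullet> e' = h2 z \<bullet> e')}"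
    have "negligible Z" unfolding Z_def by (rule IH[OF V2 h2])
    then have "negligible ((+) (- u) ` Z)" by (rule negligible_translation)
    moreover have "{v. u + (v - (v \<bullet> e) *\<^sub>R e) \<in> X} \<subseteq> (+) (- u) ` Z"
    proof
      fix v assume "v \<in> {v. u + (v - (v \<bullet> e) *\<^sub>R e) \<in> X}"
      then obtain z w where z: "z \<in> V'" "z \<in> span D0" and w: "w \<in> span D" "w \<noteq> 0"
        and zw: "\<forall>b\<in>D0. frechet_derivative h (at z) b \<bullet> w = 0"
        and ve: "\<forall>e'\<in>D. (u + (v - (v \<bullet> e) *\<^sub>R e)) \<bullet> e' = h z \<bullet> e'"
        unfolding X_def critical_at_def by blast
      have "(u + (v - (v \<bullet> e) *\<^sub>R e)) \<bullet> e = u \<bullet> e" using e by (simp add: inner_add_left inner_diff_left)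
      then have gy: "g z = y" using ve D(3) by (simp add: g_def y_def)
      define x where "x = z - (z \<bullet> b) *\<^sub>R b"
      have xz: "x + y *\<^sub>R b = z + (g z - z \<bullet> b) *\<^sub>R b" by (simp add: x_def gy algebra_simps)
      have xV2: "x \<in> V2" using \<Psi>W[OF z(1)] by (simp add: V2_def xz)
      have \<Phi>x: "\<Phi> (x + y *\<^sub>R b) = z" using \<Phi>\<Psi>[OF z(1)] by (simp add: xz)
      have xW: "x + y *\<^sub>R b \<in> W" using xV2 by (simp add: V2_def)
      have Db: "D0 - {b} \<subseteq> Basis" "D - {e} \<subseteq> Basis" using D by auto
      have "x \<in> span (D0 - {b})" unfolding mem_span_Basis_iff[OF Db(1)]
        using z(2) b unfolding mem_span_Basis_iff[OF D(2)]
        by (auto simp: x_def inner_diff_left inner_Basis)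
      moreover have "critical_at (D0 - {b}) (D - {e}) h2 x" unfolding critical_at_def
      proof (intro bexI conjI ballI)
        define w' where "w' = w - (w \<bullet> e) *\<^sub>R e"
        show "w' \<in> span (D - {e})" unfolding mem_span_Basis_iff[OF Db(2)]
          using w(1) e unfolding mem_span_Basis_iff[OF D(1)]
          by (auto simp: w'_def inner_diff_left inner_Basis)
        \<comment> \<open>Otherwise w is a nonzero multiple of e, and the derivative along b, whose
          e-component is nonzero, would not be orthogonal to it.\<close>
        show "w' \<noteq> 0"
        proof
          assume "w' = 0"
          then have we: "w = (w \<bullet> e) *\<^sub>R e" by (simp add: w'_def)
          then have "w \<bullet> e \<noteq> 0" using w(2) by force
          moreover have "(w \<bullet> e) * (frechet_derivative h (at z) b \<bullet> e) = 0"
            using zw D(4) we by (metis inner_scaleR_right)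
          ultimately show False using nzV'[OF z(1)] by simp
        qed
        fix b' assume b': "b' \<in> D0 - {b}"
        define q where "q = frechet_derivative \<Phi> (at (x + y *\<^sub>R b)) b'"
        have d\<Phi>: "(\<Phi> has_derivative frechet_derivative \<Phi> (at (x + y *\<^sub>R b))) (at (x + y *\<^sub>R b))"
          by (rule Cn_on_has_derivative[OF \<Phi> V(3) xW])
        have dh2: "(h2 has_derivative (\<lambda>v. frechet_derivative h (at z) (frechet_derivative \<Phi> (at (x + y *\<^sub>R b)) v))) (at x)"
        proof -
          have "((\<lambda>x. x + y *\<^sub>R b) has_derivative (\<lambda>v. v)) (at x)" by (auto intro!: derivative_eq_intros)
          from diff_chain_at[OF diff_chain_at[OF this d\<Phi>], of h "frechet_derivative h (at z)"]
          show ?thesis using dh[of z] z(1) V'(3) \<Phi>x by (auto simp: h2_def o_def)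
        qed
        then have h2q: "frechet_derivative h2 (at x) b' = frechet_derivative h (at z) q"
          using frechet_derivative_at by (metis q_def)
        have qi: "q \<bullet> i = b' \<bullet> i" if i: "i \<in> Basis" "i \<noteq> b" for i
        proof -
          have "((\<lambda>y. \<Phi> y \<bullet> i) has_derivative (\<lambda>v. frechet_derivative \<Phi> (at (x + y *\<^sub>R b)) v \<bullet> i)) (at (x + y *\<^sub>R b))"
            by (rule has_derivative_inner_left[OF d\<Phi>])
          then have "((\<lambda>y. y \<bullet> i) has_derivative (\<lambda>v. frechet_derivative \<Phi> (at (x + y *\<^sub>R b)) v \<bullet> i)) (at (x + y *\<^sub>R b))"
            by (rule has_derivative_transform_within_open[OF _ W xW]) (use \<Phi>i i in auto)
          moreover have "((\<lambda>y. y \<bullet> i) has_derivative (\<lambda>v. v \<bullet> i)) (at (x + y *\<^sub>R b))"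
            by (intro has_derivative_inner_left has_derivative_ident)
          ultimately have "(\<lambda>v. frechet_derivative \<Phi> (at (x + y *\<^sub>R b)) v \<bullet> i) = (\<lambda>v. v \<bullet> i)"
            by (rule has_derivative_unique)
          then show ?thesis by (metis q_def)
        qed
        \<comment> \<open>\<Phi> changes only the coordinate along b, so its derivative sends b' to
          a combination of b' and b; the derivatives of h along both are orthogonal to w.\<close>
        have q: "q = b' + (q \<bullet> b - b' \<bullet> b) *\<^sub>R b"
        proof (rule euclidean_eqI)
          fix i :: 'a assume "i \<in> Basis"
          then show "q \<bullet> i = (b' + (q \<bullet> b - b' \<bullet> b) *\<^sub>R b) \<bullet> i"
            using qi b by (cases "i = b") (auto simp: inner_add_left inner_Basis)
        qed
        have lin: "linear (frechet_derivative h (at z))" using dh[of z] z(1) V'(3) has_derivative_linear by blast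
        have 1: "frechet_derivative h (at z) q \<bullet> w = 0"
          by (subst q) (use zw b' D(4) in \<open>simp add: linear_add[OF lin] linear_cmul[OF lin] inner_add_left\<close>)
        \<comment> \<open>The e-component of h composed with \<Phi> is the coordinate along b, which
          is constant in the direction b'. Hence removing the e-component from w preserves
          orthogonality.\<close>
        have 2: "frechet_derivative h (at z) q \<bullet> e = 0"
        proof -
          have "((\<lambda>x. g (\<Phi> (x + y *\<^sub>R b))) has_derivative (\<lambda>v. frechet_derivative h (at z) (frechet_derivative \<Phi> (at (x + y *\<^sub>R b)) v) \<bullet> e)) (at x)"
            using has_derivative_inner_left[OF dh2, of e] by (simp add: g_def h2_def)
          then have "((\<lambda>x. (x + y *\<^sub>R b) \<bullet> b) has_derivative (\<lambda>v. frechet_derivative h (at z) (frechet_derivative \<Phi> (at (x + y *\<^sub>R b)) v) \<bullet> e)) (at x)"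
            by (rule has_derivative_transform_within_open[OF _ V2 xV2]) (simp add: g\<Phi> V2_def)
          moreover have "((\<lambda>x. (x + y *\<^sub>R b) \<bullet> b) has_derivative (\<lambda>v. v \<bullet> b)) (at x)"
            by (auto intro!: derivative_eq_intros)
          ultimately have "(\<lambda>v. frechet_derivative h (at z) (frechet_derivative \<Phi> (at (x + y *\<^sub>R b)) v) \<bullet> e) = (\<lambda>v. v \<bullet> b)"
            by (rule has_derivative_unique)
          then have "frechet_derivative h (at z) q \<bullet> e = b' \<bullet> b" by (metis q_def)
          then show ?thesis using b' b D(2) by (auto simp: inner_not_same_Basis)
        qed
        show "frechet_derivative h2 (at x) b' \<bullet> w' = 0"
          using 1 2 by (simp add: h2q w'_def inner_diff_right)
      qed
      moreover have "\<forall>e'\<in>D - {e}. (u + v) \<bullet> e' = h2 x \<bullet> e'"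
      proof
        fix e' assume e': "e' \<in> D - {e}"
        then have "(u + (v - (v \<bullet> e) *\<^sub>R e)) \<bullet> e' = (u + v) \<bullet> e'"
          using e D(1) by (auto simp: inner_add_left inner_diff_left inner_Basis)
        then show "(u + v) \<bullet> e' = h2 x \<bullet> e'" using ve e' by (simp add: h2_def \<Phi>x)
      qed
      ultimately have "u + v \<in> Z" using xV2 by (auto simp: Z_def)
      then show "v \<in> (+) (- u) ` Z" by (intro image_eqI[of _ _ "u + v"]) auto
    qed
    ultimately show ?thesis by (rule negligible_subset)
  qed
  moreover have "linear (\<lambda>v::'b. v - (v \<bullet> e) *\<^sub>R e)"
    by (rule linearI) (auto simp: inner_add_left algebra_simps)
  ultimately have "negligible X" by (intro negligible_if_slices[of "\<lambda>v::'b. v - (v \<bullet> e) *\<^sub>R e" X])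
  then show thesis using that[OF V'] by (simp add: X_def)
qed

text \<open>The condition on cardinalities survives the removal of one element from both D0 and D,
  which \<open>sard_step\<close> performs near points with some nonzero derivative. Where all
  derivatives vanish, the flat estimates apply: the pieces have dimension at most card D0 <= k +
  card D - 1 <= k card D.\<close>

theorem sard:
  fixes h :: "'a::euclidean_space \<Rightarrow> 'b::euclidean_space"
  assumes "D \<subseteq> Basis" "D0 \<subseteq> Basis" "open V" "Cn_on k V h" "1 \<le> k" "card D0 + 1 \<le> k + card D"
  shows "negligible {v. \<exists>z\<in>V \<inter> span D0. critical_at D0 D h z \<and> (\<forall>e\<in>D. v \<bullet> e = h z \<bullet> e)}"
proof -
  have "finite D" using assms(1) finite_subset finite_Basis by blast
  then show ?thesis using assms
  proof (induction D arbitrary: D0 V h rule: finite_psubset_induct)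
    case (psubset D)
    show ?case
    proof (cases "D = {}")
      case True
      then show ?thesis by (simp add: critical_at_def)
    next
      case False
      have fD0: "finite D0" using psubset.prems finite_subset finite_Basis by blast
      have D1: "1 \<le> card D" using False psubset.hyps by (simp add: Suc_le_eq card_gt_0_iff)
      have dh: "(h has_derivative frechet_derivative h (at x)) (at x)" if "x \<in> V" for x
        using Cn_on_has_derivative[OF psubset.prems(4,5) that] .
      define K0 where "K0 = {z\<in>V \<inter> span D0. \<forall>b\<in>D0. \<forall>e\<in>D. frechet_derivative h (at z) b \<bullet> e = 0}"
      define K1 where "K1 = (\<lambda>b e. {z\<in>V \<inter> span D0. critical_at D0 D h z \<and> frechet_derivative h (at z) b \<bullet> e \<noteq> 0})"
      have n0: "negligible {v. \<exists>z\<in>K0. \<forall>e\<in>D. v \<bullet> e = h z \<bullet> e}"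
      proof -
        \<comment> \<open>On K0 the derivative of h is unrestricted outside the coordinates D; after
          projection the whole derivative along D0 vanishes there.\<close>
        define hD where "hD = (\<lambda>x. coord_proj D (h x))"
        have hDe: "hD x \<bullet> e = h x \<bullet> e" if "e \<in> D" for x e
          using coord_proj_inner[OF psubset.prems(1)] that psubset.prems(1) by (auto simp: hD_def)
        have hD: "Cn_on k V hD" unfolding hD_def
          by (rule Cn_on_linear_compose[OF linear_coord_proj psubset.prems(3,4)])
        have crit: "frechet_derivative hD (at z) b = 0" if "z \<in> K0" "b \<in> D0" for z b
        proof -
          have "(hD has_derivative (\<lambda>v. coord_proj D (frechet_derivative h (at z) v))) (at z)"
            unfolding hD_def using that
            by (intro bounded_linear.has_derivative[OF _ dh])
              (auto simp: K0_def linear_conv_bounded_linear[symmetric] linear_coord_proj)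
          then have "frechet_derivative hD (at z) b = coord_proj D (frechet_derivative h (at z) b)"
            using frechet_derivative_at by metis
          also have "\<dots> = 0" using that by (simp add: coord_proj_def K0_def)
          finally show ?thesis .
        qed
        have K0: "K0 \<subseteq> V \<inter> span D0" by (auto simp: K0_def)
        have "negligible {v. \<exists>z\<in>K0. \<forall>e\<in>D. v \<bullet> e = hD z \<bullet> e}"
        proof (cases "k = 1")
          case True
          obtain Q where Q: "countable Q" "K0 \<subseteq> \<Union>Q"
            "\<And>E. E \<in> Q \<Longrightarrow> E \<subseteq> span D0 \<and> bounded E \<and>
            (\<forall>\<eta>>0. \<exists>\<delta>>0. \<forall>x\<in>E. \<forall>y\<in>E. norm (x - y) < \<delta> \<longrightarrow> norm (hD x - hD y) \<le> \<eta> * norm (x - y))"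
          proof (rule critical_cover_C1[OF psubset.prems(3,2) K0 hD[unfolded True] crit])
            fix Q assume Q: "countable Q" "K0 \<subseteq> \<Union>Q"
              "\<And>E. E \<in> Q \<Longrightarrow> E \<subseteq> span D0 \<and> bounded E \<and>
              (\<forall>\<eta>>0. \<exists>\<delta>>0. \<forall>x\<in>E. \<forall>y\<in>E. norm (x - y) < \<delta> \<longrightarrow> norm (hD x - hD y) \<le> \<eta> * norm (x - y))"
            show thesis by (rule that[OF Q])
          qed
          have "negligible (\<Union>E\<in>Q. {v. \<exists>x\<in>E. \<forall>e\<in>D. v \<bullet> e = hD x \<bullet> e})"
          proof (rule negligible_countable_Union)
            show "countable ((\<lambda>E. {v. \<exists>x\<in>E. \<forall>e\<in>D. v \<bullet> e = hD x \<bullet> e}) ` Q)" using Q(1) by simp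
            fix T assume "T \<in> (\<lambda>E. {v. \<exists>x\<in>E. \<forall>e\<in>D. v \<bullet> e = hD x \<bullet> e}) ` Q"
            then obtain E where E: "E \<in> Q" "T = {v. \<exists>x\<in>E. \<forall>e\<in>D. v \<bullet> e = hD x \<bullet> e}" by blast
            show "negligible T" unfolding E(2)
              by (rule flat_image_negligible_C1[OF psubset.prems(2) _ _ psubset.prems(1) False])
                (use Q(3)[OF E(1)] psubset.prems(6) True in auto)
          qed
          then show ?thesis by (rule negligible_subset) (use Q(2) in blast)
        next
          case False
          then obtain k' where k': "k = Suc k'" "1 \<le> k'" using psubset.prems(5) by (cases k) auto
          obtain Q :: "('a set \<times> 'a set \<times> ('a \<Rightarrow> 'b)) set" where Q: "countable Q" "hD ` K0 \<subseteq> (\<Union>(D', E, g)\<in>Q. g ` E)"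
            "\<And>D' E g. (D', E, g) \<in> Q \<Longrightarrow> D' \<subseteq> D0 \<and> E \<subseteq> span D' \<and> bounded E \<and>
            (\<exists>C\<ge>0. \<forall>x\<in>E. \<forall>y\<in>E. norm (g x - g y) \<le> C * norm (x - y) ^ Suc k')"
          proof (rule critical_cover[OF psubset.prems(3,2) K0 hD[unfolded k'(1)] crit])
            fix Q :: "('a set \<times> 'a set \<times> ('a \<Rightarrow> 'b)) set"
            assume Q: "countable Q" "hD ` K0 \<subseteq> (\<Union>(D', E, g)\<in>Q. g ` E)"
              "\<And>D' E g. (D', E, g) \<in> Q \<Longrightarrow> D' \<subseteq> D0 \<and> E \<subseteq> span D' \<and> bounded E \<and>
              (\<exists>C\<ge>0. \<forall>x\<in>E. \<forall>y\<in>E. norm (g x - g y) \<le> C * norm (x - y) ^ Suc k')"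
            show thesis by (rule that[OF Q])
          qed
          have "negligible (\<Union>(D', E, g)\<in>Q. {v. \<exists>x\<in>E. \<forall>e\<in>D. v \<bullet> e = g x \<bullet> e})"
          proof (rule negligible_countable_Union)
            show "countable ((\<lambda>(D', E, g). {v. \<exists>x\<in>E. \<forall>e\<in>D. v \<bullet> e = g x \<bullet> e}) ` Q)" using Q(1) by simp
            fix T assume "T \<in> (\<lambda>(D', E, g). {v. \<exists>x\<in>E. \<forall>e\<in>D. v \<bullet> e = g x \<bullet> e}) ` Q"
            then obtain D' E g where E: "(D', E, g) \<in> Q" "T = {v. \<exists>x\<in>E. \<forall>e\<in>D. v \<bullet> e = g x \<bullet> e}" by auto
            obtain C where C: "C \<ge> 0" "\<And>x y. x \<in> E \<Longrightarrow> y \<in> E \<Longrightarrow> norm (g x - g y) \<le> C * norm (x - y) ^ k"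
              using Q(3)[OF E(1)] k' by blast
            have "card D' \<le> card D0" using Q(3)[OF E(1)] fD0 by (simp add: card_mono)
            \<comment> \<open>This is (k - 1) (card D - 1) >= 0. Equality, the critical case of the
              volume estimate, occurs for card D = 1.\<close>
            moreover have "k + card D \<le> k * card D + 1"
            proof -
              obtain j where "card D = Suc j" using D1 by (cases "card D") auto
              then show ?thesis using k' by simp
            qed
            ultimately have dd: "card D' \<le> k * card D" using psubset.prems(6) by linarith
            have DB: "D' \<subseteq> Basis" using Q(3)[OF E(1)] psubset.prems(2) by blast
            show "negligible T" unfolding E(2)
              by (rule flat_image_negligible[OF DB _ _ psubset.prems(1) \<open>D \<noteq> {}\<close> C(1) _ dd C(2)])
                (use Q(3)[OF E(1)] k' in auto)
          qed
          moreover have "{v. \<exists>z\<in>K0. \<forall>e\<in>D. v \<bullet> e = hD z \<bullet> e} \<subseteq> (\<Union>(D', E, g)\<in>Q. {v. \<exists>x\<in>E. \<forall>e\<in>D. v \<bullet> e = g x \<bullet> e})"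
          proof
            fix v assume "v \<in> {v. \<exists>z\<in>K0. \<forall>e\<in>D. v \<bullet> e = hD z \<bullet> e}"
            then obtain z where z: "z \<in> K0" "\<forall>e\<in>D. v \<bullet> e = hD z \<bullet> e" by blast
            then have "hD z \<in> (\<Union>(D', E, g)\<in>Q. g ` E)" using Q(2) by blast
            then obtain D' E g x where "(D', E, g) \<in> Q" "x \<in> E" "hD z = g x" by auto
            then show "v \<in> (\<Union>(D', E, g)\<in>Q. {v. \<exists>x\<in>E. \<forall>e\<in>D. v \<bullet> e = g x \<bullet> e})"
              using z(2) by (intro UN_I[of "(D', E, g)"]) auto
          qed
          ultimately show ?thesis by (rule negligible_subset)
        qed
        then show ?thesis using hDe by simp
      qed
      have n1: "negligible {v. \<exists>z\<in>K1 b e. \<forall>e\<in>D. v \<bullet> e = h z \<bullet> e}" if be: "b \<in> D0" "e \<in> D" for b e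
      proof -
        have IH: "negligible {v. \<exists>z\<in>V \<inter> span (D0 - {b}). critical_at (D0 - {b}) (D - {e}) h z \<and> (\<forall>e'\<in>D - {e}. v \<bullet> e' = h z \<bullet> e')}"
          if "open V" "Cn_on k V h" for V and h :: "'a \<Rightarrow> 'b"
        proof (rule psubset.IH[OF _ _ _ that psubset.prems(5)])
          show "D - {e} \<subset> D" "D - {e} \<subseteq> Basis" "D0 - {b} \<subseteq> Basis" using be psubset.prems by auto
          have "card D0 = Suc (card (D0 - {b}))" "card D = Suc (card (D - {e}))"
            by (rule card.remove[OF fD0 be(1)], rule card.remove[OF psubset.hyps(1) be(2)])
          then show "card (D0 - {b}) + 1 \<le> k + card (D - {e})" using psubset.prems(6) by simp
        qed
        have "\<exists>V'. open V' \<and> a \<in> V' \<and>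
          negligible {v. \<exists>z\<in>V' \<inter> span D0. critical_at D0 D h z \<and> (\<forall>e\<in>D. v \<bullet> e = h z \<bullet> e)}" if "a \<in> K1 b e" for a
        proof -
          have a: "a \<in> V" "frechet_derivative h (at a) b \<bullet> e \<noteq> 0" using that by (auto simp: K1_def)
          show ?thesis
          proof (rule sard_step[OF psubset.prems(1,2) be(2,1) psubset.prems(3-5) a IH])
            fix V' assume "open V'" "a \<in> V'"
              "negligible {v. \<exists>z\<in>V' \<inter> span D0. critical_at D0 D h z \<and> (\<forall>e\<in>D. v \<bullet> e = h z \<bullet> e)}"
            then show ?thesis by (intro exI[of _ V'] conjI)
          qed
        qed
        then have "\<forall>a\<in>K1 b e. \<exists>V'. open V' \<and> a \<in> V' \<and>
          negligible {v. \<exists>z\<in>V' \<inter> span D0. critical_at D0 D h z \<and> (\<forall>e\<in>D. v \<bullet> e = h z \<bullet> e)}" by (rule ballI)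
        from bchoice[OF this] obtain V' where V'a: "\<forall>a\<in>K1 b e. open (V' a) \<and> a \<in> V' a \<and>
          negligible {v. \<exists>z\<in>V' a \<inter> span D0. critical_at D0 D h z \<and> (\<forall>e\<in>D. v \<bullet> e = h z \<bullet> e)}"
          by (elim exE) (rule that)
        have V'1: "open (V' a) \<and> a \<in> V' a" if "a \<in> K1 b e" for a
          using bspec[OF V'a that] by (elim conjE) (intro conjI)
        have V'2: "negligible {v. \<exists>z\<in>V' a \<inter> span D0. critical_at D0 D h z \<and> (\<forall>e\<in>D. v \<bullet> e = h z \<bullet> e)}"
          if "a \<in> K1 b e" for a using bspec[OF V'a that] by (elim conjE)
        obtain A0 where A0: "countable A0" "A0 \<subseteq> K1 b e" "K1 b e \<subseteq> (\<Union>a\<in>A0. V' a)"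
          by (rule countable_subcover[of "K1 b e" V', OF V'1])
        have "negligible (\<Union>a\<in>A0. {v. \<exists>z\<in>V' a \<inter> span D0. critical_at D0 D h z \<and> (\<forall>e\<in>D. v \<bullet> e = h z \<bullet> e)})"
          by (rule negligible_countable_Union) (use A0(1) V'2[OF subsetD[OF A0(2)]] in \<open>auto simp only: countable_image\<close>)
        moreover have "{v. \<exists>z\<in>K1 b e. \<forall>e\<in>D. v \<bullet> e = h z \<bullet> e} \<subseteq> (\<Union>a\<in>A0. {v. \<exists>z\<in>V' a \<inter> span D0. critical_at D0 D h z \<and> (\<forall>e\<in>D. v \<bullet> e = h z \<bullet> e)})"
        proof
          fix v assume "v \<in> {v. \<exists>z\<in>K1 b e. \<forall>e\<in>D. v \<bullet> e = h z \<bullet> e}"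
          then obtain z where z: "z \<in> K1 b e" "\<forall>e\<in>D. v \<bullet> e = h z \<bullet> e" by blast
          then obtain a where "a \<in> A0" "z \<in> V' a" using A0(3) by blast
          then show "v \<in> (\<Union>a\<in>A0. {v. \<exists>z\<in>V' a \<inter> span D0. critical_at D0 D h z \<and> (\<forall>e\<in>D. v \<bullet> e = h z \<bullet> e)})"
            using z by (auto simp: K1_def)
        qed
        ultimately show ?thesis by (rule negligible_subset)
      qed
      have "negligible ({v. \<exists>z\<in>K0. \<forall>e\<in>D. v \<bullet> e = h z \<bullet> e} \<union> (\<Union>(b, e)\<in>D0 \<times> D. {v. \<exists>z\<in>K1 b e. \<forall>e\<in>D. v \<bullet> e = h z \<bullet> e}))"
        using n0 n1 fD0 psubset.hyps by (intro negligible_Un negligible_Union) auto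
      moreover have "{v. \<exists>z\<in>V \<inter> span D0. critical_at D0 D h z \<and> (\<forall>e\<in>D. v \<bullet> e = h z \<bullet> e)}
         \<subseteq> {v. \<exists>z\<in>K0. \<forall>e\<in>D. v \<bullet> e = h z \<bullet> e} \<union> (\<Union>(b, e)\<in>D0 \<times> D. {v. \<exists>z\<in>K1 b e. \<forall>e\<in>D. v \<bullet> e = h z \<bullet> e})"
      proof
        fix v assume "v \<in> {v. \<exists>z\<in>V \<inter> span D0. critical_at D0 D h z \<and> (\<forall>e\<in>D. v \<bullet> e = h z \<bullet> e)}"
        then obtain z where z: "z \<in> V \<inter> span D0" "critical_at D0 D h z" "\<forall>e\<in>D. v \<bullet> e = h z \<bullet> e" by blast
        show "v \<in> {v. \<exists>z\<in>K0. \<forall>e\<in>D. v \<bullet> e = h z \<bullet> e} \<union> (\<Union>(b, e)\<in>D0 \<times> D. {v. \<exists>z\<in>K1 b e. \<forall>e\<in>D. v \<bullet> e = h z \<bullet> e})"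
        proof (cases "z \<in> K0")
          case True
          then show ?thesis using z(3) by blast
        next
          case False
          then obtain b e where be: "b \<in> D0" "e \<in> D" "frechet_derivative h (at z) b \<bullet> e \<noteq> 0" using z(1) by (auto simp: K0_def)
          then have "z \<in> K1 b e" using z by (simp add: K1_def)
          then show ?thesis using z(3) be(1,2) by blast
        qed
      qed
      ultimately show ?thesis by (rule negligible_subset)
    qed
  qed
qed

lemma span_Basis_coord:
  assumes "D \<subseteq> Basis" "w \<in> span D" shows "v \<bullet> w = (\<Sum>e\<in>D. (v \<bullet> e) * (w \<bullet> e))"
  unfolding euclidean_inner[of v w]
  using assms by (intro sum.mono_neutral_right) (auto simp: mem_span_Basis_iff)

text \<open>Moving the parameter along T translates the D-coordinates of H, so by
  Fubini it suffices to consider a single map of x and its critical values.\<close>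

lemma param_sard:
  fixes H :: "'x::euclidean_space \<times> 'p::euclidean_space \<Rightarrow> 'b::euclidean_space" and T :: "'b \<Rightarrow> 'p"
  assumes S: "open S" and H: "Cn_on k S H" "1 \<le> k" and D: "D \<subseteq> Basis"
    and dims: "DIM('x) + 1 \<le> k + card D" and T: "linear T"
    and inv: "\<And>x \<pi> v. (x, \<pi>) \<in> S \<Longrightarrow> (x, \<pi> + T v) \<in> S"
    and eq: "\<And>x \<pi> v e. (x, \<pi>) \<in> S \<Longrightarrow> e \<in> D \<Longrightarrow> H (x, \<pi> + T v) \<bullet> e = H (x, \<pi>) \<bullet> e + v \<bullet> e"
  shows "negligible {\<pi>. \<exists>x. (x, \<pi>) \<in> S \<and> (\<forall>e\<in>D. H (x, \<pi>) \<bullet> e = 0) \<and>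
     (\<exists>w\<in>span D. w \<noteq> 0 \<and> (\<forall>b\<in>Basis. frechet_derivative H (at (x, \<pi>)) (b, 0) \<bullet> w = 0))}"
    (is "negligible ?X")
proof (rule negligible_if_slices[OF T])
  have dH: "(H has_derivative frechet_derivative H (at p)) (at p)" if "p \<in> S" for p
    by (rule Cn_on_has_derivative[OF H that])
  have linH: "linear (frechet_derivative H (at p))" if "p \<in> S" for p
    using dH[OF that] has_derivative_linear by blast
  have fD: "finite D" using D finite_subset finite_Basis by blast
  show "?X \<in> sets borel"
  proof -
    \<comment> \<open>Points of S are paired with covectors, so that the bad parameters are the
      projection of a relatively closed set.\<close>
    define S' where "S' = S \<times> (UNIV :: 'b set)"
    have "open S'" using S by (simp add: S'_def open_Times)
    define F where "F = (\<lambda>p::('x \<times> 'p) \<times> 'b. (snd p, norm (snd p), \<Sum>e\<in>D. (H (fst p) \<bullet> e)\<^sup>2,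
        \<Sum>b\<in>Basis. (frechet_derivative H (at (fst p)) (b, 0) \<bullet> snd p)\<^sup>2))"
    have cd: "continuous_on S' (\<lambda>p. frechet_derivative H (at (fst p)) b)" for b
      by (rule continuous_on_compose2[OF Cn_on_1_continuous_derivative[OF H, of b]])
        (auto simp: S'_def intro!: continuous_intros)
    have cH: "continuous_on S' (\<lambda>p. H (fst p))"
      by (rule continuous_on_compose2[OF Cn_on_continuous[OF H(1)]])
        (auto simp: S'_def intro!: continuous_intros)
    have "continuous_on S' F" unfolding F_def by (intro continuous_intros cd cH)
    then have K: "closedin (top_of_set S') (S' \<inter> F -` (span D \<times> {1} \<times> {0} \<times> {0}))"
      by (rule continuous_closedin_preimage) (intro closed_Times closed_span closed_singleton)
    have "continuous_on S' (\<lambda>p. snd (fst p))" by (intro continuous_intros)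
    from borel_image_closedin[OF \<open>open S'\<close> K this]
    have "(\<lambda>p. snd (fst p)) ` (S' \<inter> F -` (span D \<times> {1} \<times> {0} \<times> {0})) \<in> sets borel" .
    moreover have "(\<lambda>p. snd (fst p)) ` (S' \<inter> F -` (span D \<times> {1} \<times> {0} \<times> {0})) = ?X"
    proof (intro equalityI subsetI)
      fix \<pi> assume "\<pi> \<in> (\<lambda>p. snd (fst p)) ` (S' \<inter> F -` (span D \<times> {1} \<times> {0} \<times> {0}))"
      then obtain x w where p: "((x, \<pi>), w) \<in> S'" "F ((x, \<pi>), w) \<in> span D \<times> {1} \<times> {0} \<times> {0}" by force
      then have "w \<in> span D" "norm w = 1" "\<forall>e\<in>D. H (x, \<pi>) \<bullet> e = 0"
         "\<forall>b\<in>Basis. frechet_derivative H (at (x, \<pi>)) (b, 0) \<bullet> w = 0"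
        using fD by (auto simp: F_def sum_nonneg_eq_0_iff)
      moreover have "w \<noteq> 0" using \<open>norm w = 1\<close> by force
      ultimately show "\<pi> \<in> ?X" using p(1) by (auto simp: S'_def)
    next
      fix \<pi> assume "\<pi> \<in> ?X"
      then obtain x w where p: "(x, \<pi>) \<in> S" "\<forall>e\<in>D. H (x, \<pi>) \<bullet> e = 0" "w \<in> span D" "w \<noteq> 0"
        "\<forall>b\<in>Basis. frechet_derivative H (at (x, \<pi>)) (b, 0) \<bullet> w = 0" by blast
      have "w /\<^sub>R norm w \<in> span D" "norm (w /\<^sub>R norm w) = 1"
        using p by (auto intro: span_scale)
      then have "F ((x, \<pi>), w /\<^sub>R norm w) \<in> span D \<times> {1} \<times> {0} \<times> {0}"
        using p by (auto simp: F_def)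
      moreover have "((x, \<pi>), w /\<^sub>R norm w) \<in> S'" using p by (simp add: S'_def)
      ultimately show "\<pi> \<in> (\<lambda>p. snd (fst p)) ` (S' \<inter> F -` (span D \<times> {1} \<times> {0} \<times> {0}))"
        by (intro image_eqI[of _ _ "((x, \<pi>), w /\<^sub>R norm w)"]) auto
    qed
    ultimately show ?thesis by simp
  qed
  fix \<pi> :: 'p
  define V where "V = (\<lambda>x. (x, \<pi>)) -` S"
  \<comment> \<open>With this sign \<open>H (x, \<pi> + T v)\<close> vanishes in the coordinates D
    exactly when v agrees with h x there; the bad v are thus critical values of h.\<close>
  define h where "h = (\<lambda>x. - H (x, \<pi>))"
  have V: "open V" unfolding V_def using S by (intro open_vimage continuous_intros) auto
  have "Cn_on k V (\<lambda>x. (x, \<pi>))" by (intro Cn_on_Pair V Cn_on_id Cn_on_const)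
  then have h: "Cn_on k V h" unfolding h_def
    by (intro Cn_on_minus V Cn_on_compose[OF V S _ H(1)]) (auto simp: V_def)
  have "negligible {v. \<exists>z\<in>V \<inter> span Basis. critical_at Basis D h z \<and> (\<forall>e\<in>D. v \<bullet> e = h z \<bullet> e)}"
    by (rule sard[OF D subset_refl V h H(2) dims])
  moreover have "{v. \<pi> + T v \<in> ?X} \<subseteq> {v. \<exists>z\<in>V \<inter> span Basis. critical_at Basis D h z \<and> (\<forall>e\<in>D. v \<bullet> e = h z \<bullet> e)}"
  proof
    fix v assume "v \<in> {v. \<pi> + T v \<in> ?X}"
    then obtain x w where x: "(x, \<pi> + T v) \<in> S" "\<forall>e\<in>D. H (x, \<pi> + T v) \<bullet> e = 0" and w: "w \<in> span D" "w \<noteq> 0"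
      "\<forall>b\<in>Basis. frechet_derivative H (at (x, \<pi> + T v)) (b, 0) \<bullet> w = 0" by blast
    have xS: "(x, \<pi>) \<in> S" using inv[OF x(1), of "- v"] by (simp add: linear_neg[OF T])
    then have xV: "x \<in> V" by (simp add: V_def)
    have "critical_at Basis D h x" unfolding critical_at_def
    proof (intro bexI[of _ w] conjI ballI w(1,2))
      fix b :: 'x assume b: "b \<in> Basis"
      have d0: "((\<lambda>x. (x, c)) has_derivative (\<lambda>b. (b, 0))) (at x)" for c :: 'p
        by (auto intro!: derivative_eq_intros)
      have "((\<lambda>x. H (x, \<pi> + T v) \<bullet> w) has_derivative (\<lambda>b. frechet_derivative H (at (x, \<pi> + T v)) (b, 0) \<bullet> w)) (at x)"
        using has_derivative_inner_left[OF diff_chain_at[OF d0 dH[OF x(1)]], of w] by (simp add: o_def)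
      moreover have "H (y, \<pi> + T v) \<bullet> w = - (h y \<bullet> w) + v \<bullet> w" if "y \<in> V" for y
        unfolding span_Basis_coord[OF D w(1)] h_def
        using eq[of y \<pi> _ v] that
        by (simp add: V_def distrib_right sum.distrib sum_negf)
      ultimately have "((\<lambda>x. - (h x \<bullet> w) + v \<bullet> w) has_derivative (\<lambda>b. frechet_derivative H (at (x, \<pi> + T v)) (b, 0) \<bullet> w)) (at x)"
        by (rule has_derivative_transform_within_open[OF _ V xV])
      moreover have "((\<lambda>x. - (h x \<bullet> w) + v \<bullet> w) has_derivative (\<lambda>b. - (frechet_derivative h (at x) b \<bullet> w) + 0)) (at x)"
        by (intro has_derivative_add has_derivative_minus has_derivative_inner_left has_derivative_const
            Cn_on_has_derivative[OF h H(2) xV])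
      ultimately have "(\<lambda>b. frechet_derivative H (at (x, \<pi> + T v)) (b, 0) \<bullet> w) = (\<lambda>b. - (frechet_derivative h (at x) b \<bullet> w) + 0)"
        by (rule has_derivative_unique)
      from fun_cong[OF this, of b] show "frechet_derivative h (at x) b \<bullet> w = 0" using w(3) b by simp
    qed
    moreover have "\<forall>e\<in>D. v \<bullet> e = h x \<bullet> e" 
    proof
      fix e assume "e \<in> D"
      then show "v \<bullet> e = h x \<bullet> e" using x(2) eq[OF xS, of e v] by (simp add: h_def add_eq_0_iff)
    qed
    ultimately show "v \<in> {v. \<exists>z\<in>V \<inter> span Basis. critical_at Basis D h z \<and> (\<forall>e\<in>D. v \<bullet> e = h z \<bullet> e)}"
      using xV by (auto simp: span_Basis)
  qed
  ultimately show "negligible {v. \<pi> + T v \<in> ?X}" by (rule negligible_subset)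
qed

section \<open>Matrices of given rank\<close>

lemma bounded_bilinear_matrix_mult:
  "bounded_bilinear ((**) :: real^'n^'m \<Rightarrow> real^'p^'n \<Rightarrow> real^'p^'m)"
proof -
  have "bilinear ((**) :: real^'n^'m \<Rightarrow> real^'p^'n \<Rightarrow> real^'p^'m)"
    unfolding bilinear_def
    by (intro conjI allI linearI; vector matrix_matrix_mult_def;
        simp add: algebra_simps sum.distrib sum_distrib_left)
  then show ?thesis by (simp add: bilinear_conv_bounded_bilinear)
qed

interpretation mm: bounded_bilinear "(**) :: real^'n^'m \<Rightarrow> real^'p^'n \<Rightarrow> real^'p^'m"
  by (rule bounded_bilinear_matrix_mult)

lemmas Cn_on_matrix_mult = Cn_on_bilinear[OF bounded_bilinear_matrix_mult]

lemma Cn_on_prod: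
  fixes f :: "'i \<Rightarrow> 'a::euclidean_space \<Rightarrow> real"
  assumes "open S" "\<And>i. i \<in> I \<Longrightarrow> Cn_on n S (f i)"
  shows "Cn_on n S (\<lambda>x. \<Prod>i\<in>I. f i x)"
  using assms(2)
  by (induction I rule: infinite_finite_induct) (auto intro!: Cn_on_mult assms(1))

lemma Cn_on_vec_nth: "open S \<Longrightarrow> Cn_on n S f \<Longrightarrow> Cn_on n S (\<lambda>x. f x $ i)"
  by (rule Cn_on_bounded_linear_compose[OF bounded_linear_vec_nth])

lemma Cn_on_vec_lambda:
  fixes f :: "'a::euclidean_space \<Rightarrow> 'i::finite \<Rightarrow> 'b::euclidean_space"
  assumes "open S" "\<And>i. Cn_on n S (\<lambda>x. f x i)"
  shows "Cn_on n S (\<lambda>x. \<chi> i. f x i)"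
proof (rule Cn_on_componentwise[OF assms(1), THEN iffD2], rule ballI)
  fix e :: "'b^'i" assume "e \<in> Basis"
  then obtain i b where "e = axis i b" by (auto simp: Basis_vec_def)
  moreover have "Cn_on n S (\<lambda>x. f x i \<bullet> b)" by (intro Cn_on_inner assms Cn_on_const)
  ultimately show "Cn_on n S (\<lambda>x. (\<chi> i. f x i) \<bullet> e)" by (simp add: inner_axis)
qed

lemma Cn_on_det:
  fixes f :: "'a::euclidean_space \<Rightarrow> real^'n^'n"
  assumes "open S" "Cn_on n S f"
  shows "Cn_on n S (\<lambda>x. det (f x))"
  unfolding det_def
  by (intro Cn_on_sum Cn_on_mult Cn_on_prod Cn_on_vec_nth Cn_on_const assms)

lemma
  fixes A :: "real^'n^'n"
  assumes "invertible A"
  shows matrix_inv_right: "A ** matrix_inv A = mat 1" and matrix_inv_left: "matrix_inv A ** A = mat 1"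
  using someI_ex[OF assms[unfolded invertible_def]] by (simp_all add: matrix_inv_def)

text \<open>Cramer's rule, applied to the columns of the identity. It exhibits the entries of the
  inverse as quotients of polynomials in the entries of A, from which smoothness follows.\<close>

lemma matrix_inv_component:
  fixes A :: "real^'n^'n"
  assumes "invertible A"
  shows "matrix_inv A = (\<chi> k j. det (\<chi> i j'. if j' = k then axis j 1 $ i else A $ i $ j') / det A)"
proof -
  have "A ** matrix_inv A = mat 1" using assms by (simp add: matrix_inv_right)
  then have "A *v (matrix_inv A *v axis j 1) = axis j 1" for j
    by (simp add: matrix_vector_mul_assoc)
  then have "matrix_inv A *v axis j 1 = (\<chi> k. det (\<chi> i j'. if j' = k then axis j 1 $ i else A $ i $ j') / det A)" for j
    using assms by (simp add: cramer invertible_det_nz)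
  then have "(matrix_inv A *v axis j 1) $ k = det (\<chi> i j'. if j' = k then axis j 1 $ i else A $ i $ j') / det A" for j k
    by simp
  then show ?thesis by (simp add: vec_eq_iff matrix_vector_mult_basis column_def)
qed

lemma Cn_on_matrix_inv:
  fixes f :: "'a::euclidean_space \<Rightarrow> real^'n^'n"
  assumes "open S" "Cn_on n S f" "\<And>x. x \<in> S \<Longrightarrow> invertible (f x)"
  shows "Cn_on n S (\<lambda>x. matrix_inv (f x))"
proof (rule Cn_on_cong[OF assms(1)])
  have "Cn_on n S (\<lambda>x. if j' = k then c else f x $ i $ j')" for j' k i c
    using assms by (cases "j' = k") (auto intro!: Cn_on_vec_nth)
  then show "Cn_on n S (\<lambda>x. \<chi> k j. det (\<chi> i j'. if j' = k then axis j 1 $ i else f x $ i $ j') / det (f x))"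
    using assms(3) by (intro Cn_on_vec_lambda Cn_on_divide Cn_on_det assms) (auto simp: invertible_det_nz)
  show "\<And>x. x \<in> S \<Longrightarrow> (\<chi> k j. det (\<chi> i j'. if j' = k then axis j 1 $ i else f x $ i $ j') / det (f x)) = matrix_inv (f x)"
    by (simp add: matrix_inv_component assms(3))
qed

lemma open_invertible:
  fixes f :: "'a::euclidean_space \<Rightarrow> real^'n^'n"
  assumes "open S" "continuous_on S f"
  shows "open {x \<in> S. invertible (f x)}"
proof -
  have "Cn_on 0 S (\<lambda>x. det (f x))" using assms by (intro Cn_on_det) auto
  then have "open (S \<inter> (\<lambda>x. det (f x)) -` (- {0}))"
    using assms by (intro continuous_open_preimage) auto
  moreover have "S \<inter> (\<lambda>x. det (f x)) -` (- {0}) = {x \<in> S. invertible (f x)}"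
    by (auto simp: invertible_det_nz)
  ultimately show ?thesis by simp
qed

text \<open>Differentiability is known from Cramer's rule; differentiating A A^-1 = 1 then
  determines the derivative.\<close>

lemma has_derivative_matrix_inv:
  fixes f :: "'a::euclidean_space \<Rightarrow> real^'n^'n"
  assumes S: "open S" "x \<in> S" and f: "Cn_on 1 S f" and inv: "\<And>x. x \<in> S \<Longrightarrow> invertible (f x)"
  shows "((\<lambda>x. matrix_inv (f x)) has_derivative
     (\<lambda>v. - (matrix_inv (f x) ** frechet_derivative f (at x) v ** matrix_inv (f x)))) (at x)"
proof -
  define Z where "Z = (\<lambda>x. matrix_inv (f x))"
  have df: "(f has_derivative frechet_derivative f (at x)) (at x)" using Cn_on_has_derivative[OF f _ S(2)] by simp
  have "Cn_on 1 S Z" unfolding Z_def by (rule Cn_on_matrix_inv[OF S(1) f inv])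
  then have dZ: "(Z has_derivative frechet_derivative Z (at x)) (at x)" using Cn_on_has_derivative S(2) by blast
  have "((\<lambda>x. f x ** Z x) has_derivative (\<lambda>v. f x ** frechet_derivative Z (at x) v + frechet_derivative f (at x) v ** Z x)) (at x)"
    by (rule mm.FDERIV[OF df dZ])
  then have "((\<lambda>x. mat 1) has_derivative (\<lambda>v. f x ** frechet_derivative Z (at x) v + frechet_derivative f (at x) v ** Z x)) (at x)"
    by (rule has_derivative_transform_within_open[OF _ S]) (simp add: Z_def inv matrix_inv_right)
  then have "(\<lambda>v. f x ** frechet_derivative Z (at x) v + frechet_derivative f (at x) v ** Z x) = (\<lambda>v. 0)"
    by (rule has_derivative_unique[OF _ has_derivative_const])
  then have z: "f x ** frechet_derivative Z (at x) v + frechet_derivative f (at x) v ** Z x = 0" for v by metis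
  have "frechet_derivative Z (at x) v = - (Z x ** frechet_derivative f (at x) v ** Z x)" for v
  proof -
    have "Z x ** (f x ** frechet_derivative Z (at x) v) = - (Z x ** (frechet_derivative f (at x) v ** Z x))"
      using arg_cong[OF z[of v], of "\<lambda>y. Z x ** y"] by (simp add: mm.add_right mm.zero_right add_eq_0_iff2)
    moreover have "Z x ** f x = mat 1" using inv[OF S(2)] by (simp add: Z_def matrix_inv_left)
    ultimately show ?thesis by (simp add: matrix_mul_assoc)
  qed
  then have "frechet_derivative Z (at x) = (\<lambda>v. - (Z x ** frechet_derivative f (at x) v ** Z x))" by (rule ext)
  then show ?thesis using dZ by (simp add: Z_def)
qed

text \<open>Left multiplication puts row \<open>\<sigma> j\<close> into position j for j in J, and
  zero elsewhere. The size of a minor depends on a rank and cannot be a type, so minors are handled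
  inside full-size matrices.\<close>

definition minor_sel :: "'n set \<Rightarrow> ('n \<Rightarrow> 'l) \<Rightarrow> real^'l^'n" where
  "minor_sel J \<sigma> = (\<chi> j i. if i = \<sigma> j then (if j \<in> J then 1 else 0) else 0)"

definition diag_sel :: "'n set \<Rightarrow> real^'n^'n" where
  "diag_sel J = (\<chi> j j'. if j = j' then (if j \<in> J then 1 else 0) else 0)"

text \<open>In block form with respect to the rows \<sigma> ` J and the columns J, where M has the blocks a, b, c, d:
  minor_aug is a extended by an identity block, minor_inv has the only nonzero block a^-1, and schur
  has the only nonzero block d - c a^-1 b.\<close>

definition minor_aug :: "'n set \<Rightarrow> ('n \<Rightarrow> 'l) \<Rightarrow> real^'n^'l \<Rightarrow> real^'n^'n" where
  "minor_aug J \<sigma> M = minor_sel J \<sigma> ** M ** diag_sel J + (mat 1 - diag_sel J)"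

definition minor_inv :: "'n set \<Rightarrow> ('n \<Rightarrow> 'l) \<Rightarrow> real^'n^'l \<Rightarrow> real^'l^'n" where
  "minor_inv J \<sigma> M = diag_sel J ** matrix_inv (minor_aug J \<sigma> M) ** minor_sel J \<sigma>"

definition schur :: "'n set \<Rightarrow> ('n \<Rightarrow> 'l) \<Rightarrow> real^'n^'l \<Rightarrow> real^'n^'l" where
  "schur J \<sigma> M = M - M ** minor_inv J \<sigma> M ** M"

text \<open>The elementary matrices of the block d. For \<sigma> injective on J their number is the
  codimension of the matrices of rank card J.\<close>

definition schur_basis :: "'n set \<Rightarrow> ('n \<Rightarrow> 'l) \<Rightarrow> (real^'n^'l) set" where
  "schur_basis J \<sigma> = (\<lambda>(i, j). axis i (axis j 1)) ` ((- \<sigma> ` J) \<times> (- J))"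

lemma mult_diag_sel_component: "(A ** diag_sel J) $ i $ j = (if j \<in> J then A $ i $ j else 0)"
  by (simp add: diag_sel_def matrix_matrix_mult_def if_distrib[of "\<lambda>x. _ * x"] cong: if_cong)

lemma diag_sel_mult_component: "(diag_sel J ** A) $ i $ j = (if i \<in> J then A $ i $ j else 0)"
  by (simp add: diag_sel_def matrix_matrix_mult_def if_distrib[of "\<lambda>x. x * _"] cong: if_cong)

lemma minor_sel_mult_component: "(minor_sel J \<sigma> ** A) $ j $ j' = (if j \<in> J then A $ \<sigma> j $ j' else 0)"
  by (simp add: minor_sel_def matrix_matrix_mult_def if_distrib[of "\<lambda>x. x * _"] cong: if_cong)

lemma diag_sel_idem: "diag_sel J ** diag_sel J = diag_sel J"
  by (auto simp: vec_eq_iff mult_diag_sel_component) (auto simp: diag_sel_def)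

lemma diag_minor_sel: "diag_sel J ** minor_sel J \<sigma> = minor_sel J \<sigma>"
  by (auto simp: vec_eq_iff diag_sel_mult_component) (auto simp: minor_sel_def)

lemma schur_basis_subset: "schur_basis J \<sigma> \<subseteq> (Basis :: (real^'n^'l) set)"
  by (auto simp: schur_basis_def)

lemma inner_axis_axis_matrix: "(A :: real^'n^'l) \<bullet> axis i (axis j 1) = A $ i $ j"
  by (simp add: inner_axis)

lemma card_schur_basis:
  assumes "inj_on \<sigma> J"
  shows "card (schur_basis J \<sigma> :: (real^'n^'l) set) = (CARD('l) - card J) * (CARD('n) - card J)"
proof -
  have "inj_on (\<lambda>(i, j). axis i (axis j 1) :: real^'n^'l) ((- \<sigma> ` J) \<times> (- J))"
    by (auto simp: inj_on_def axis_eq_axis)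
  then have "card (schur_basis J \<sigma> :: (real^'n^'l) set) = card (- \<sigma> ` J) * card (- J)"
    by (simp add: schur_basis_def card_image card_cartesian_product)
  then show ?thesis using assms by (simp add: Compl_eq_Diff_UNIV card_Diff_subset card_image)
qed

locale minor =
  fixes J :: "'n::finite set" and \<sigma> :: "'n \<Rightarrow> 'l::finite" and M :: "real^'n^'l"
  assumes inv: "invertible (minor_aug J \<sigma> M)"
begin

abbreviation "E \<equiv> diag_sel J"
abbreviation "T \<equiv> minor_sel J \<sigma>"
abbreviation "Z \<equiv> matrix_inv (minor_aug J \<sigma> M)"
abbreviation "Y \<equiv> minor_inv J \<sigma> M"

lemma Z: "Z ** minor_aug J \<sigma> M = mat 1" "minor_aug J \<sigma> M ** Z = mat 1"
  using inv by (simp_all add: matrix_inv_left matrix_inv_right)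

text \<open>Outside J the matrix \<open>minor_aug\<close> acts as the identity from both sides, and
  its inverse Z inherits this.\<close>

lemma aug_E: "minor_aug J \<sigma> M ** (mat 1 - E) = mat 1 - E"
  by (simp add: minor_aug_def mm.add_left mm.diff_left mm.diff_right matrix_mul_assoc[symmetric] diag_sel_idem)

lemma E_aug: "(mat 1 - E) ** minor_aug J \<sigma> M = mat 1 - E"
  by (simp add: minor_aug_def mm.add_right mm.diff_left mm.diff_right matrix_mul_assoc diag_sel_idem diag_minor_sel)

lemma Z_E: "Z ** (mat 1 - E) = mat 1 - E"
proof -
  have "Z ** (minor_aug J \<sigma> M ** (mat 1 - E)) = mat 1 - E" unfolding matrix_mul_assoc Z by simp
  then show ?thesis by (simp only: aug_E)
qed

lemma E_Z: "(mat 1 - E) ** Z = mat 1 - E"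
proof -
  have "((mat 1 - E) ** minor_aug J \<sigma> M) ** Z = mat 1 - E" unfolding matrix_mul_assoc[symmetric] Z by simp
  then show ?thesis by (simp only: E_aug)
qed

lemma TME: "T ** M ** E = minor_aug J \<sigma> M - (mat 1 - E)" by (simp add: minor_aug_def)

text \<open>In blocks, a^-1 a is the identity on the columns J. Its counterpart for rows is
  \<open>TMY\<close>; \<open>YMY\<close> follows because Y has nonzero rows only in J.\<close>

lemma YME: "Y ** M ** E = E"
proof -
  have "Y ** M ** E = E ** (Z ** (T ** M ** E))" by (simp add: minor_inv_def matrix_mul_assoc)
  also have "Z ** (T ** M ** E) = mat 1 - (mat 1 - E)"
    unfolding TME by (subst mm.diff_right) (simp only: Z Z_E)
  finally show ?thesis by (simp add: diag_sel_idem)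
qed

lemma EY: "E ** Y = Y" by (simp add: minor_inv_def matrix_mul_assoc diag_sel_idem)

lemma YMY: "Y ** M ** Y = Y"
proof -
  have "Y ** M ** Y = Y ** M ** E ** Y" using EY by (simp add: matrix_mul_assoc[symmetric])
  then show ?thesis by (simp add: YME EY)
qed

lemma TMY: "T ** M ** Y = T"
proof -
  have "T ** M ** Y = (T ** M ** E) ** Z ** T"
    by (simp add: minor_inv_def matrix_mul_assoc)
  also have "\<dots> = (mat 1 - (mat 1 - E) ** Z) ** T" by (simp only: TME mm.diff_left Z)
  also have "\<dots> = T" by (simp add: E_Z diag_minor_sel)
  finally show ?thesis .
qed

text \<open>Elimination leaves nothing in the minor's columns, by \<open>YME\<close>, nor in its
  rows, by \<open>TMY\<close>.\<close>

lemma schur_component: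
  assumes "j \<in> J \<or> i \<in> \<sigma> ` J" shows "schur J \<sigma> M $ i $ j = 0"
  using assms
proof
  assume j: "j \<in> J"
  have "schur J \<sigma> M ** E = M ** E - M ** (Y ** M ** E)" by (simp add: schur_def mm.diff_left matrix_mul_assoc)
  also have "\<dots> = 0" by (simp add: YME)
  finally have "(schur J \<sigma> M ** E) $ i $ j = 0" by simp
  then show ?thesis using j by (simp add: mult_diag_sel_component)
next
  assume "i \<in> \<sigma> ` J"
  then obtain j' where j': "j' \<in> J" "i = \<sigma> j'" by blast
  have "T ** schur J \<sigma> M = T ** M - (T ** M ** Y) ** M" by (simp add: schur_def mm.diff_right matrix_mul_assoc)
  also have "\<dots> = 0" by (simp add: TMY)
  finally have "(T ** schur J \<sigma> M) $ j' $ j = 0" by simp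
  then show ?thesis using j' by (simp add: minor_sel_mult_component)
qed

lemma schur_eq_0_iff: "schur J \<sigma> M = 0 \<longleftrightarrow> (\<forall>e\<in>schur_basis J \<sigma>. schur J \<sigma> M \<bullet> e = 0)"
  using schur_component by (fastforce simp: vec_eq_iff schur_basis_def inner_axis_axis_matrix)

end

lemma schur_basis_span_component:
  assumes "w \<in> span (schur_basis J \<sigma>)" "j \<in> J \<or> i \<in> \<sigma> ` J"
  shows "w $ i $ j = 0"
proof -
  have "axis i (axis j 1) \<in> (Basis :: (real^'a^'b) set)" by simp
  moreover have "axis i (axis j 1) \<notin> (schur_basis J \<sigma> :: (real^'a^'b) set)"
    using assms(2) by (auto simp: schur_basis_def axis_eq_axis)
  ultimately show ?thesis using assms(1) mem_span_Basis_iff[OF schur_basis_subset, of w] inner_axis_axis_matrix by metis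
qed

text \<open>Since w is supported in the block d, \<open>minor_sel\<close> annihilates it from the
  left and \<open>diag_sel\<close> from the right. These are the outer factors of
  \<open>minor_inv\<close>, so w drops out of every product with it, and only d itself is
  moved.\<close>

lemma
  assumes "w \<in> span (schur_basis J \<sigma>)"
  shows minor_aug_translate: "minor_aug J \<sigma> (M + w) = minor_aug J \<sigma> M"
    and schur_translate: "schur J \<sigma> (M + w) = schur J \<sigma> M + w"
    and quad_translate: "(M + w) ** minor_inv J \<sigma> (M + w) ** (M + w) = M ** minor_inv J \<sigma> M ** M"
proof -
  have wE: "w ** diag_sel J = 0"
    using schur_basis_span_component[OF assms] by (simp add: vec_eq_iff mult_diag_sel_component)
  have Tw: "minor_sel J \<sigma> ** w = 0"
    using schur_basis_span_component[OF assms] by (simp add: vec_eq_iff minor_sel_mult_component)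
  show a: "minor_aug J \<sigma> (M + w) = minor_aug J \<sigma> M"
    by (simp add: minor_aug_def mm.add_right mm.add_left Tw mm.zero_left)
  then have y: "minor_inv J \<sigma> (M + w) = minor_inv J \<sigma> M" by (simp add: minor_inv_def)
  have wY: "w ** minor_inv J \<sigma> M = 0" by (simp add: minor_inv_def matrix_mul_assoc wE mm.zero_left)
  have Yw: "minor_inv J \<sigma> M ** w = 0"
    by (simp add: minor_inv_def matrix_mul_assoc[symmetric] Tw mm.zero_right)
  show q: "(M + w) ** minor_inv J \<sigma> (M + w) ** (M + w) = M ** minor_inv J \<sigma> M ** M"
    unfolding y by (simp add: mm.add_left mm.add_right wY Yw matrix_mul_assoc[symmetric] mm.zero_right)
  show "schur J \<sigma> (M + w) = schur J \<sigma> M + w"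
    unfolding schur_def q by simp
qed


section \<open>Rank read off from the Schur complement\<close>

lemma diag_sel_vector: "(diag_sel J *v v) $ j = (if j \<in> J then v $ j else 0)"
  by (simp add: diag_sel_def matrix_vector_mult_def if_distrib[of "\<lambda>x. x * _"] cong: if_cong)

lemma rank_diag_sel: "rank (diag_sel J :: real^'n^'n) = card J"
proof -
  let ?d = "(\<lambda>j. axis j 1 :: real^'n) ` J"
  have d: "?d \<subseteq> Basis" by auto
  have "range ((*v) (diag_sel J :: real^'n^'n)) = {x. \<forall>i\<in>Basis. i \<notin> ?d \<longrightarrow> x \<bullet> i = 0}"
  proof (intro equalityI subsetI)
    fix x assume "x \<in> range ((*v) (diag_sel J :: real^'n^'n))"
    then obtain v where "x = diag_sel J *v v" by blast
    then show "x \<in> {x. \<forall>i\<in>Basis. i \<notin> ?d \<longrightarrow> x \<bullet> i = 0}"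
      by (auto simp: Basis_vec_def inner_axis diag_sel_vector axis_eq_axis)
  next
    fix x assume x: "x \<in> {x. \<forall>i\<in>Basis. i \<notin> ?d \<longrightarrow> x \<bullet> i = 0}"
    have "x $ j = 0" if "j \<notin> J" for j
    proof -
      have "axis j 1 \<in> (Basis :: (real^'n) set)" "axis j 1 \<notin> ?d" using that by (auto simp: axis_eq_axis)
      then have "x \<bullet> axis j 1 = 0" using x by blast
      then show ?thesis by (simp add: inner_axis)
    qed
    then have "x = diag_sel J *v x" by (simp add: vec_eq_iff diag_sel_vector)
    then show "x \<in> range ((*v) (diag_sel J :: real^'n^'n))" by blast
  qed
  then have "rank (diag_sel J :: real^'n^'n) = card ?d"
    using dim_substandard[OF d] by (simp add: rank_dim_range)
  also have "\<dots> = card J" by (intro card_image) (auto simp: inj_on_def axis_eq_axis)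
  finally show ?thesis .
qed

context minor
begin

lemma rank_minor_inv: "rank Y = card J"
proof (rule antisym)
  show "rank Y \<le> card J" using rank_mul_le_left[of E Y] by (simp add: EY rank_diag_sel)
  have "card J = rank (Y ** (M ** E))" using YME by (simp add: matrix_mul_assoc rank_diag_sel)
  also have "\<dots> \<le> rank Y" by (rule rank_mul_le_left)
  finally show "card J \<le> rank Y" .
qed

text \<open>By \<open>YMY\<close> the matrix \<open>M ** Y\<close> is a projection of rank at least
  card J. If M has rank card J, the two ranges coincide and the projection fixes the range of M, so
  M Y M = M. Conversely M Y M = M bounds the rank of M by that of Y, and the minor bounds it from
  below.\<close>

lemma rank_eq_iff: "rank M = card J \<longleftrightarrow> schur J \<sigma> M = 0"
proof
  assume r: "rank M = card J"
  have sub: "range ((*v) (M ** Y)) \<subseteq> range ((*v) M)"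
    by (auto simp flip: matrix_vector_mul_assoc)
  have "rank (M ** Y) = card J"
  proof (rule antisym)
    show "rank (M ** Y) \<le> card J" using rank_mul_le_left[of M Y] r by simp
    show "card J \<le> rank (M ** Y)"
      using rank_mul_le_right[of Y "M ** Y"] by (simp add: matrix_mul_assoc YMY rank_minor_inv)
  qed
  then have "range ((*v) (M ** Y)) = range ((*v) M)"
    using r by (intro subspace_dim_equal sub linear_subspace_image subspace_UNIV) (auto simp: rank_dim_range)
  then have "\<exists>u. M *v x = (M ** Y) *v u" for x by (metis rangeI imageE)
  moreover have "(M ** Y) *v ((M ** Y) *v u) = (M ** Y) *v u" for u
    using YMY by (simp add: matrix_vector_mul_assoc matrix_mul_assoc[symmetric])
  ultimately have "(M ** Y) *v (M *v x) = M *v x" for x by metis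
  then have "M ** Y ** M = M" by (simp add: matrix_eq matrix_vector_mul_assoc)
  then show "schur J \<sigma> M = 0" by (simp add: schur_def)
next
  assume "schur J \<sigma> M = 0"
  then have M: "M ** Y ** M = M" by (simp add: schur_def)
  show "rank M = card J"
  proof (rule antisym)
    have "rank M \<le> rank (M ** Y)" using rank_mul_le_left[of "M ** Y" M] M by simp
    also have "\<dots> \<le> rank Y" by (rule rank_mul_le_right)
    finally show "rank M \<le> card J" by (simp add: rank_minor_inv)
    have "card J = rank (Y ** (M ** E))" using YME by (simp add: matrix_mul_assoc rank_diag_sel)
    also have "\<dots> \<le> rank M" using rank_mul_le_right[of Y "M ** E"] rank_mul_le_left[of M E] by simp
    finally show "card J \<le> rank M" .
  qed
qed

end

lemma independent_columns_exist:
  fixes M :: "real^'n^'l"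
  obtains J where "card J = rank M" "inj_on (\<lambda>j. column j M) J" "independent ((\<lambda>j. column j M) ` J)"
    "columns M \<subseteq> span ((\<lambda>j. column j M) ` J)"
proof -
  obtain B where B: "B \<subseteq> columns M" "independent B" "columns M \<subseteq> span B" "card B = dim (columns M)"
    using basis_exists[of "columns M"] by blast
  have "B \<subseteq> (\<lambda>j. column j M) ` UNIV" using B(1) by (auto simp: columns_def)
  then obtain J where J: "inj_on (\<lambda>j. column j M) J" "B = (\<lambda>j. column j M) ` J"
    using subset_image_inj[of B "\<lambda>j. column j M" UNIV] by blast
  then have "card J = rank M" using B(4) by (simp add: column_rank_def card_image)
  then show thesis using that J B by blast
qed

text \<open>J indexes a maximal independent set of columns, and \<sigma> enumerates a maximal
  independent set of rows of the matrix restricted to these columns. A vector in the kernel of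
  \<open>minor_aug\<close> vanishes outside J and is orthogonal to the chosen rows, hence to all
  rows; independence of the columns makes it zero.\<close>

lemma minor_exists:
  fixes M :: "real^'n^'l"
  obtains J and \<sigma> :: "'n \<Rightarrow> 'l" where "card J = rank M" "inj_on \<sigma> J" "invertible (minor_aug J \<sigma> M)"
proof -
  obtain J where J: "card J = rank M" "inj_on (\<lambda>j. column j M) J" "independent ((\<lambda>j. column j M) ` J)"
    by (rule independent_columns_exist[of M])
  define M' where "M' = M ** diag_sel J"
  have Mv: "M *v v = (\<Sum>j\<in>J. (v $ j) *\<^sub>R column j M)" if "\<forall>j. j \<notin> J \<longrightarrow> v $ j = 0" for v
    unfolding matrix_mult_sum scalar_mult_eq_scaleR
    using that by (intro sum.mono_neutral_right) auto
  have indep: "v = 0" if v0: "\<forall>j. j \<notin> J \<longrightarrow> v $ j = 0" and "M *v v = 0" for v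
  proof -
    define u where "u = (\<lambda>c. v $ inv_into J (\<lambda>j. column j M) c)"
    have uj: "u (column j M) = v $ j" if "j \<in> J" for j
      using inv_into_f_f[OF J(2) that] by (simp add: u_def)
    have "(\<Sum>c\<in>(\<lambda>j. column j M) ` J. u c *\<^sub>R c) = (\<Sum>j\<in>J. (v $ j) *\<^sub>R column j M)"
      by (subst sum.reindex[OF J(2)]) (auto simp: uj intro!: sum.cong)
    also have "\<dots> = 0" using Mv[OF v0] \<open>M *v v = 0\<close> by simp
    finally have "u (column j M) = 0" if "j \<in> J" for j
      using independentD[OF J(3), of "(\<lambda>j. column j M) ` J" u] that by auto
    then have "v $ j = 0" if "j \<in> J" for j using that uj by simp
    then show ?thesis using v0 by (auto simp: vec_eq_iff)
  qed
  have ker: "v = 0" if v0: "\<forall>j. j \<notin> J \<longrightarrow> v $ j = 0" and "M' *v v = 0" for v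
  proof -
    have "diag_sel J *v v = v" using v0 by (auto simp: vec_eq_iff diag_sel_vector)
    then have "M' *v v = M *v v" by (simp add: M'_def flip: matrix_vector_mul_assoc)
    then show ?thesis using indep[OF v0] \<open>M' *v v = 0\<close> by simp
  qed
  have "rank M' = card J"
  proof (rule antisym)
    show "rank M' \<le> card J" using rank_mul_le_right[of M "diag_sel J"] by (simp add: M'_def rank_diag_sel)
    have sub: "(\<lambda>j. column j M) ` J \<subseteq> columns M'"
    proof
      fix c assume "c \<in> (\<lambda>j. column j M) ` J"
      then obtain j where j: "j \<in> J" "c = column j M" by blast
      have "column j M' = c" using j by (simp add: vec_eq_iff column_def M'_def mult_diag_sel_component)
      then show "c \<in> columns M'" by (auto simp: columns_def)
    qed
    have "card J = card ((\<lambda>j. column j M) ` J)" using J(2) by (simp add: card_image)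
    also have "\<dots> \<le> dim (columns M')"
      using independent_card_le_dim[OF sub J(3)] by simp
    finally show "card J \<le> rank M'" by (simp add: column_rank_def)
  qed
  obtain I where I: "card I = rank (transpose M')" "inj_on (\<lambda>i. column i (transpose M')) I"
     "columns (transpose M') \<subseteq> span ((\<lambda>i. column i (transpose M')) ` I)"
    by (rule independent_columns_exist[of "transpose M'"])
  have cI: "card I = card J" using I(1) \<open>rank M' = card J\<close> by (simp add: rank_transpose)
  obtain \<sigma> where \<sigma>: "bij_betw \<sigma> J I" using cI finite_same_card_bij[of J I] by auto
  have "v = 0" if "minor_aug J \<sigma> M *v v = 0" for v
  proof (rule ker)
    have comp: "(minor_aug J \<sigma> M *v v) $ j = (if j \<in> J then (M' *v v) $ \<sigma> j else v $ j)" for j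
    proof -
      have "minor_aug J \<sigma> M *v v = minor_sel J \<sigma> ** M' *v v + (v - diag_sel J *v v)"
        by (simp add: minor_aug_def M'_def matrix_mul_assoc matrix_vector_mult_add_rdistrib matrix_vector_mult_diff_rdistrib)
      moreover have "(minor_sel J \<sigma> ** M' *v v) $ j = (if j \<in> J then (M' *v v) $ \<sigma> j else 0)"
        by (simp add: matrix_vector_mult_def minor_sel_mult_component)
      ultimately show ?thesis by (simp add: diag_sel_vector)
    qed
    show "\<forall>j. j \<notin> J \<longrightarrow> v $ j = 0" using comp that by (metis zero_index)
    have I0: "(M' *v v) $ i = 0" if "i \<in> I" for i
    proof -
      obtain j where "j \<in> J" "i = \<sigma> j" using \<sigma> \<open>i \<in> I\<close> unfolding bij_betw_def by blast
      then show ?thesis using comp[of j] \<open>minor_aug J \<sigma> M *v v = 0\<close> by simp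
    qed
    have row: "(M' *v v) $ i = column i (transpose M') \<bullet> v" for i
      by (simp add: matrix_vector_mult_def column_def transpose_def inner_vec_def)
    have "y \<bullet> v = 0" if "y \<in> span ((\<lambda>i. column i (transpose M')) ` I)" for y
      using that
    proof (induction rule: span_induct)
      case base
      show ?case by (auto intro!: subspaceI simp: inner_add_left)
    next
      case (step y)
      then show ?case using I0 row by auto
    qed
    then have "(M' *v v) $ i = 0" for i using I(3) row by (auto simp: columns_def)
    then show "M' *v v = 0" by (simp add: vec_eq_iff)
  qed
  then have "invertible (minor_aug J \<sigma> M)"
    by (metis invertible_left_inverse matrix_left_invertible_ker)
  then show thesis using that J(1) \<sigma> by (auto simp: bij_betw_def)
qed

context minor
begin

text \<open>Expanding the product and solving for B leaves only terms that begin or end with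
  M.\<close>

lemma tangent_decomposition:
  assumes "(mat 1 - M ** Y) ** B ** (mat 1 - Y ** M) = 0"
  obtains X Y' where "B = X ** M + M ** Y'"
proof -
  have "B = (B ** Y) ** M + M ** (Y ** B - Y ** B ** Y ** M)"
    using assms by (simp add: mm.diff_left mm.diff_right matrix_mul_assoc algebra_simps)
  then show thesis by (rule that)
qed

text \<open>By \<open>TMY\<close> the left factor clears the selected rows, and by
  \<open>YME\<close> the right factor clears the columns J.\<close>

lemma compress_in_span: "(mat 1 - M ** Y) ** B ** (mat 1 - Y ** M) \<in> span (schur_basis J \<sigma>)"
proof -
  let ?A = "(mat 1 - M ** Y) ** B ** (mat 1 - Y ** M)"
  have "?A ** E = (mat 1 - M ** Y) ** B ** (E - Y ** M ** E)"
    by (simp add: matrix_mul_assoc[symmetric] mm.diff_left[of "mat 1"])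
  then have "?A ** E = 0" by (simp add: YME mm.zero_right)
  moreover have "T ** ?A = (T - T ** M ** Y) ** B ** (mat 1 - Y ** M)"
    by (simp add: matrix_mul_assoc mm.diff_right[of T])
  then have "T ** ?A = 0" by (simp add: TMY mm.zero_left)
  ultimately have "?A $ i $ j = 0" if "j \<in> J \<or> i \<in> \<sigma> ` J" for i j
    using that mult_diag_sel_component[of ?A J i j] minor_sel_mult_component[of J \<sigma> ?A _ j]
    by (metis (no_types, lifting) imageE zero_index)
  note comp = this
  show ?thesis
    unfolding mem_span_Basis_iff[OF schur_basis_subset]
  proof (intro ballI impI)
    fix e :: "real^'n^'l" assume e: "e \<in> Basis" "e \<notin> schur_basis J \<sigma>"
    obtain i j where ij: "e = axis i (axis j 1)" using e(1) by (auto simp: Basis_vec_def)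
    have "j \<in> J \<or> i \<in> \<sigma> ` J"
    proof (rule ccontr)
      assume "\<not> (j \<in> J \<or> i \<in> \<sigma> ` J)"
      then have "e \<in> schur_basis J \<sigma>"
        unfolding schur_basis_def ij by (intro image_eqI[of _ _ "(i, j)"]) auto
      then show False using e(2) by simp
    qed
    then show "?A \<bullet> e = 0" unfolding ij inner_axis_axis_matrix by (rule comp)
  qed
qed

end

lemma
  fixes f :: "'a::euclidean_space \<Rightarrow> real^'n^'l"
  assumes S: "open S" and f: "Cn_on k S f" and inv: "\<And>x. x \<in> S \<Longrightarrow> invertible (minor_aug J \<sigma> (f x))"
  shows Cn_on_minor_inv: "Cn_on k S (\<lambda>x. minor_inv J \<sigma> (f x))"
    and Cn_on_schur: "Cn_on k S (\<lambda>x. schur J \<sigma> (f x))"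
proof -
  have "Cn_on k S (\<lambda>x. minor_aug J \<sigma> (f x))"
    unfolding minor_aug_def by (intro Cn_on_add Cn_on_matrix_mult S f Cn_on_const)
  from Cn_on_matrix_inv[OF S this inv]
  show Y: "Cn_on k S (\<lambda>x. minor_inv J \<sigma> (f x))"
    unfolding minor_inv_def by (intro Cn_on_matrix_mult S Cn_on_const) auto
  show "Cn_on k S (\<lambda>x. schur J \<sigma> (f x))"
    unfolding schur_def by (intro Cn_on_diff Cn_on_matrix_mult S f Y)
qed

text \<open>Differentiating the inverse gives dY = - Y dM Y, since the padding is absorbed into the
  outer factors of Y; the product rule for M - M Y M then factors. By
  \<open>tangent_decomposition\<close>, matrices killed by this derivative have the form X M + M
  Y'.\<close>

lemma has_derivative_schur:
  fixes f :: "'a::euclidean_space \<Rightarrow> real^'n^'l"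
  assumes S: "open S" "x \<in> S" and f: "Cn_on 1 S f"
    and inv: "\<And>x. x \<in> S \<Longrightarrow> invertible (minor_aug J \<sigma> (f x))"
  shows "((\<lambda>x. schur J \<sigma> (f x)) has_derivative
     (\<lambda>v. (mat 1 - f x ** minor_inv J \<sigma> (f x)) ** frechet_derivative f (at x) v ** (mat 1 - minor_inv J \<sigma> (f x) ** f x))) (at x)"
proof -
  define f' where "f' = frechet_derivative f (at x)"
  define Y where "Y = minor_inv J \<sigma> (f x)"
  have df: "(f has_derivative f') (at x)" unfolding f'_def using Cn_on_has_derivative[OF f _ S(2)] by simp
  have ca: "Cn_on 1 S (\<lambda>x. minor_aug J \<sigma> (f x))"
    unfolding minor_aug_def by (intro Cn_on_add Cn_on_matrix_mult S f Cn_on_const)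
  have lin: "bounded_linear (\<lambda>A. minor_sel J \<sigma> ** A ** diag_sel J)"
    by (intro bounded_linear_compose[OF mm.bounded_linear_left] mm.bounded_linear_right)
  have da: "((\<lambda>x. minor_aug J \<sigma> (f x)) has_derivative (\<lambda>v. minor_sel J \<sigma> ** f' v ** diag_sel J + 0)) (at x)"
    unfolding minor_aug_def by (intro has_derivative_add bounded_linear.has_derivative[OF lin df] has_derivative_const)
  define Z where "Z = matrix_inv (minor_aug J \<sigma> (f x))"
  have dZ: "((\<lambda>x. matrix_inv (minor_aug J \<sigma> (f x))) has_derivative
      (\<lambda>v. - (Z ** (minor_sel J \<sigma> ** f' v ** diag_sel J) ** Z))) (at x)"
    using has_derivative_matrix_inv[OF S ca inv] by (simp add: Z_def frechet_derivative_at[OF da, symmetric])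
  have lin2: "bounded_linear (\<lambda>A. diag_sel J ** A ** minor_sel J \<sigma>)"
    by (intro bounded_linear_compose[OF mm.bounded_linear_left] mm.bounded_linear_right)
  have "((\<lambda>x. minor_inv J \<sigma> (f x)) has_derivative
      (\<lambda>v. diag_sel J ** (- (Z ** (minor_sel J \<sigma> ** f' v ** diag_sel J) ** Z)) ** minor_sel J \<sigma>)) (at x)"
    unfolding minor_inv_def by (rule bounded_linear.has_derivative[OF lin2 dZ])
  moreover have "diag_sel J ** (- (Z ** (minor_sel J \<sigma> ** B ** diag_sel J) ** Z)) ** minor_sel J \<sigma> = - (Y ** B ** Y)" for B
    by (simp add: Y_def minor_inv_def Z_def mm.minus_right mm.minus_left matrix_mul_assoc)
  ultimately have dY: "((\<lambda>x. minor_inv J \<sigma> (f x)) has_derivative (\<lambda>v. - (Y ** f' v ** Y))) (at x)" by simp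
  have "((\<lambda>x. schur J \<sigma> (f x)) has_derivative
     (\<lambda>v. f' v - ((f x ** Y) ** f' v + (f x ** (- (Y ** f' v ** Y)) + f' v ** Y) ** f x))) (at x)"
    unfolding schur_def
    using has_derivative_diff[OF df mm.FDERIV[OF mm.FDERIV[OF df dY] df]] by (simp add: Y_def)
  moreover have "f' v - ((f x ** Y) ** f' v + (f x ** (- (Y ** f' v ** Y)) + f' v ** Y) ** f x)
      = (mat 1 - f x ** Y) ** f' v ** (mat 1 - Y ** f x)" for v
    by (simp add: mm.diff_left mm.diff_right mm.add_left mm.add_right mm.minus_left mm.minus_right matrix_mul_assoc algebra_simps)
  ultimately show ?thesis by (simp add: Y_def f'_def)
qed

section \<open>Almost every linear perturbation is transverse to the matrices of fixed rank\<close>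

lemma Cn_on_jacobian:
  fixes G :: "real^'n \<Rightarrow> real^'l"
  assumes "open V" "Cn_on (Suc k) V G"
  shows "Cn_on k V (\<lambda>x. matrix (frechet_derivative G (at x)))"
  unfolding matrix_def
  by (intro Cn_on_vec_lambda Cn_on_vec_nth assms(1) Cn_on_derivative[OF assms(2)])

lemma rank_mult_invertible_right:
  fixes A :: "real^'n^'l" and N :: "real^'n^'n"
  assumes "invertible N" shows "rank (A ** N) = rank A"
proof (rule antisym)
  show "rank (A ** N) \<le> rank A" by (rule rank_mul_le_left)
  have "A = (A ** N) ** matrix_inv N"
    by (simp add: matrix_mul_assoc[symmetric] matrix_inv_right[OF assms])
  then show "rank A \<le> rank (A ** N)" by (metis rank_mul_le_left)
qed

lemma rank_mult_invertible_left:
  fixes A :: "real^'n^'l" and N :: "real^'l^'l"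
  assumes "invertible N" shows "rank (N ** A) = rank A"
proof (rule antisym)
  show "rank (N ** A) \<le> rank A" by (rule rank_mul_le_right)
  have "A = matrix_inv N ** (N ** A)"
    by (simp add: matrix_mul_assoc matrix_inv_left[OF assms])
  then show "rank A \<le> rank (N ** A)" by (metis rank_mul_le_right)
qed

lemma matrix_inv_invertible:
  fixes A :: "real^'n^'n" assumes "invertible A" shows "invertible (matrix_inv A)"
  using matrix_inv_left[OF assms] matrix_inv_right[OF assms] unfolding invertible_def by blast

text \<open>The matrices X M + M Y form the tangent space at M of the matrices of the same rank. For
  a linear map M' this is transversality to that stratum.\<close>

definition rank_transverse :: "real^'n^'l \<Rightarrow> ('v \<Rightarrow> real^'n^'l) \<Rightarrow> bool" where
  "rank_transverse M M' \<longleftrightarrow> (\<forall>B. \<exists>v X Y. B = M' v + X ** M + M ** Y)"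

text \<open>The triples (\<tau>, J, \<sigma>) are finite in number, and for each of them
  \<open>param_sard\<close> makes the bad parameters null. At a point where transversality fails,
  \<tau> comes from a minor of Df and (J, \<sigma>) from a minor of the normalized Jacobian.
  Normalization by a varying invertible matrix affects neither the rank nor transversality.\<close>

lemma rank_transverse_ae:
  fixes G :: "real^'n \<Rightarrow> real^'l" and f :: "real^'n \<Rightarrow> real^'m"
  assumes V: "open V" and G: "Cn_on (Suc k) V G" and f: "Cn_on (Suc k) V f" and "1 \<le> k"
    and inj: "\<And>x. x \<in> V \<Longrightarrow> inj (frechet_derivative f (at x))"
    and dims: "CARD('n) + 1 \<le> k + (CARD('l) - \<rho>) * (CARD('n) - \<rho>)"
  defines "Jac \<equiv> \<lambda>P x. matrix (frechet_derivative G (at x)) + P ** matrix (frechet_derivative f (at x))"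
  shows "negligible {P. \<exists>x\<in>V. rank (Jac P x) = \<rho> \<and> \<not> rank_transverse (Jac P x) (frechet_derivative (Jac P) (at x))}"
proof -
  define A where "A = (\<lambda>x. matrix (frechet_derivative f (at x)))"
  define A0 where "A0 = (\<lambda>x. matrix (frechet_derivative G (at x)))"
  have CA: "Cn_on k V A" "Cn_on k V A0" unfolding A_def A0_def by (intro Cn_on_jacobian V f G)+
  have Jac: "Jac P x = A0 x + P ** A x" for P x by (simp add: Jac_def A_def A0_def)
  have CJac: "Cn_on k V (Jac P)" for P
    unfolding Jac_def
    by (intro Cn_on_add Cn_on_matrix_mult V CA[unfolded A_def A0_def] Cn_on_const)
  \<comment> \<open>\<tau> selects n rows of Df; since f is an immersion, some selection is
    invertible at each given point.\<close>
  define N where "N = (\<lambda>(\<tau> :: 'n \<Rightarrow> 'm) x. minor_sel UNIV \<tau> ** A x)"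
  have CN: "Cn_on k V (N \<tau>)" for \<tau> unfolding N_def by (intro Cn_on_matrix_mult V CA Cn_on_const)
  define V0 where "V0 = (\<lambda>\<tau>. {x \<in> V. invertible (N \<tau> x)})"
  have V0: "open (V0 \<tau>)" for \<tau>
    unfolding V0_def by (rule open_invertible[OF V Cn_on_continuous[OF CN]])
  define Mt where "Mt = (\<lambda>\<tau> p. Jac (snd p) (fst p) ** matrix_inv (N \<tau> (fst p)))"
  have oV0: "open (V0 \<tau> \<times> (UNIV :: (real^'m^'l) set))" for \<tau> using V0 by (simp add: open_Times)
  have fstC: "Cn_on k (V0 \<tau> \<times> (UNIV :: (real^'m^'l) set)) (\<lambda>p. g (fst p))" if "Cn_on k (V0 \<tau>) g"
    for g :: "real^'n \<Rightarrow> 'c::euclidean_space" and \<tau>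
    by (rule Cn_on_compose[OF oV0 V0 _ that]) (auto intro!: Cn_on_fst Cn_on_id oV0)
  have V0V: "V0 \<tau> \<subseteq> V" for \<tau> by (auto simp: V0_def)
  have CMt: "Cn_on k (V0 \<tau> \<times> UNIV) (Mt \<tau>)" for \<tau>
  proof -
    have "Cn_on k (V0 \<tau>) (\<lambda>x. matrix_inv (N \<tau> x))"
      by (rule Cn_on_matrix_inv[OF V0 Cn_on_subset[OF CN V0V]]) (simp add: V0_def)
    then show ?thesis
      unfolding Mt_def Jac
      by (intro Cn_on_matrix_mult Cn_on_add oV0 fstC Cn_on_snd Cn_on_id Cn_on_subset[OF CA(1) V0V] Cn_on_subset[OF CA(2) V0V])
  qed
  define S where "S = (\<lambda>\<tau> J \<sigma>. {p \<in> V0 \<tau> \<times> UNIV. invertible (minor_aug J \<sigma> (Mt \<tau> p))})"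
  have SV0: "S \<tau> J \<sigma> \<subseteq> V0 \<tau> \<times> UNIV" for \<tau> J \<sigma> by (auto simp: S_def)
  have oS: "open (S \<tau> J \<sigma>)" for \<tau> J \<sigma>
  proof -
    have "Cn_on k (V0 \<tau> \<times> UNIV) (\<lambda>p. minor_aug J \<sigma> (Mt \<tau> p))"
      unfolding minor_aug_def by (intro Cn_on_add Cn_on_matrix_mult oV0 CMt Cn_on_const)
    then show ?thesis unfolding S_def by (intro open_invertible[OF oV0] Cn_on_continuous)
  qed
  define H where "H = (\<lambda>\<tau> J \<sigma> p. schur J \<sigma> (Mt \<tau> p))"
  have CH: "Cn_on k (S \<tau> J \<sigma>) (H \<tau> J \<sigma>)" for \<tau> J \<sigma>
    unfolding H_def by (rule Cn_on_schur[OF oS Cn_on_subset[OF CMt SV0]]) (simp add: S_def)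
  define X where "X = (\<lambda>\<tau> J \<sigma>. {P. \<exists>x. (x, P) \<in> S \<tau> J \<sigma> \<and> (\<forall>e\<in>schur_basis J \<sigma>. H \<tau> J \<sigma> (x, P) \<bullet> e = 0) \<and>
     (\<exists>w\<in>span (schur_basis J \<sigma>). w \<noteq> 0 \<and> (\<forall>b\<in>Basis. frechet_derivative (H \<tau> J \<sigma>) (at (x, P)) (b, 0) \<bullet> w = 0))})"
  have nX: "negligible (X \<tau> J \<sigma>)" if "card J = \<rho>" "inj_on \<sigma> J" for \<tau> J \<sigma>
    unfolding X_def
  proof (rule param_sard[OF oS CH \<open>1 \<le> k\<close> schur_basis_subset, where T = "\<lambda>v. coord_proj (schur_basis J \<sigma>) v ** minor_sel UNIV \<tau>"])
    show "DIM(real^'n) + 1 \<le> k + card (schur_basis J \<sigma> :: (real^'n^'l) set)"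
      using dims card_schur_basis[OF that(2)] that(1) by simp
    show "linear (\<lambda>v. coord_proj (schur_basis J \<sigma>) v ** minor_sel UNIV \<tau>)"
      using linear_compose[OF linear_coord_proj bounded_linear.linear[OF mm.bounded_linear_left]]
      by (simp add: o_def)
    fix x P and v :: "real^'n^'l" assume "(x, P) \<in> S \<tau> J \<sigma>"
    then have x: "invertible (N \<tau> x)" "(x, P) \<in> V0 \<tau> \<times> UNIV" "invertible (minor_aug J \<sigma> (Mt \<tau> (x, P)))"
      by (auto simp: S_def V0_def)
    let ?w = "coord_proj (schur_basis J \<sigma>) v"
    have w: "?w \<in> span (schur_basis J \<sigma>)" by (rule coord_proj_in_span)
    \<comment> \<open>The matrix added to P picks the rows \<tau> of Df, so it contributes
      \<open>?w ** N \<tau> x\<close> to the Jacobian and, after normalization, \<open>?w\<close>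
      itself.\<close>
    have "Mt \<tau> (x, P + ?w ** minor_sel UNIV \<tau>) = Mt \<tau> (x, P) + ?w ** (N \<tau> x ** matrix_inv (N \<tau> x))"
      by (simp add: Mt_def Jac N_def mm.add_left matrix_mul_assoc)
    then have Mt: "Mt \<tau> (x, P + ?w ** minor_sel UNIV \<tau>) = Mt \<tau> (x, P) + ?w"
      by (simp add: matrix_inv_right[OF x(1)])
    show "(x, P + ?w ** minor_sel UNIV \<tau>) \<in> S \<tau> J \<sigma>"
      using x by (simp add: S_def Mt minor_aug_translate[OF w])
    fix e assume "e \<in> schur_basis J \<sigma>"
    then show "H \<tau> J \<sigma> (x, P + ?w ** minor_sel UNIV \<tau>) \<bullet> e = H \<tau> J \<sigma> (x, P) \<bullet> e + v \<bullet> e"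
      using schur_basis_subset coord_proj_inner[OF schur_basis_subset, of e J \<sigma> v]
      by (auto simp: H_def Mt schur_translate[OF w] inner_add_left)
  qed
  have "negligible (\<Union>\<tau>. \<Union>(J, \<sigma>)\<in>{(J, \<sigma>). card J = \<rho> \<and> inj_on \<sigma> J}. X \<tau> J \<sigma>)"
    using nX by (intro negligible_Union) auto
  moreover have "P \<in> (\<Union>\<tau>. \<Union>(J, \<sigma>)\<in>{(J, \<sigma>). card J = \<rho> \<and> inj_on \<sigma> J}. X \<tau> J \<sigma>)"
    if x: "x \<in> V" "rank (Jac P x) = \<rho>" and nt: "\<not> rank_transverse (Jac P x) (frechet_derivative (Jac P) (at x))" for P x
  proof -
    have df: "(f has_derivative frechet_derivative f (at x)) (at x)" using Cn_on_has_derivative[OF f _ x(1)] by simp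
    have "(*v) (A x) = frechet_derivative f (at x)"
      unfolding A_def by (rule matrix_vector_mul(2)[OF has_derivative_linear[OF df]])
    then have "rank (A x) = CARD('n)" using inj[OF x(1)] by (simp add: full_rank_injective)
    obtain I and \<tau> :: "'n \<Rightarrow> 'm" where I: "card I = rank (A x)" "invertible (minor_aug I \<tau> (A x))"
      by (rule minor_exists[of "A x"])
    have "I = UNIV" using I(1) \<open>rank (A x) = CARD('n)\<close> by (simp add: card_eq_UNIV_imp_eq_UNIV)
    have dU: "diag_sel UNIV = (mat 1 :: real^'n^'n)" by (simp add: diag_sel_def mat_def vec_eq_iff)
    have Nx: "invertible (N \<tau> x)" using I(2) by (simp add: \<open>I = UNIV\<close> minor_aug_def dU N_def)
    have xV0: "x \<in> V0 \<tau>" using x Nx by (simp add: V0_def)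
    define M where "M = Mt \<tau> (x, P)"
    have Mt: "M = Jac P x ** matrix_inv (N \<tau> x)" by (simp add: M_def Mt_def)
    have rM: "rank M = \<rho>" using x(2) by (simp add: Mt rank_mult_invertible_right matrix_inv_invertible Nx)
    obtain J and \<sigma> :: "'n \<Rightarrow> 'l" where J: "card J = rank M" "inj_on \<sigma> J" "invertible (minor_aug J \<sigma> M)"
      by (rule minor_exists[of M])
    interpret minor J \<sigma> M by unfold_locales (rule J(3))
    have xS: "(x, P) \<in> S \<tau> J \<sigma>" using xV0 J(3) by (simp add: S_def M_def)
    have H0: "H \<tau> J \<sigma> (x, P) = 0" using rank_eq_iff J(1) by (simp add: H_def M_def)
    have "P \<in> X \<tau> J \<sigma>"
    proof (rule ccontr)
      assume nX: "P \<notin> X \<tau> J \<sigma>"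
      define m where "m = (\<lambda>v. frechet_derivative (Mt \<tau>) (at (x, P)) (v, 0))"
      define L where "L = (\<lambda>B. (mat 1 - M ** Y) ** B ** (mat 1 - Y ** M))"
      have linL: "linear L" unfolding L_def
        by (intro bounded_linear.linear bounded_linear_compose[OF mm.bounded_linear_left] mm.bounded_linear_right)
      have dMt: "(Mt \<tau> has_derivative frechet_derivative (Mt \<tau>) (at (x, P))) (at (x, P))"
        using Cn_on_has_derivative[OF CMt \<open>1 \<le> k\<close>, of "(x, P)" \<tau>] xV0 by simp
      have "linear (\<lambda>v::real^'n. (v, 0::real^'m^'l))" by (rule linearI) auto
      from linear_compose[OF this has_derivative_linear[OF dMt]]
      have linm: "linear m" by (simp add: m_def o_def)
      have dH: "frechet_derivative (H \<tau> J \<sigma>) (at (x, P)) (v, 0) = L (m v)" for v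
      proof -
        have C1: "Cn_on 1 (S \<tau> J \<sigma>) (Mt \<tau>)" by (rule Cn_on_le[OF Cn_on_subset[OF CMt SV0] \<open>1 \<le> k\<close>])
        have "(H \<tau> J \<sigma> has_derivative (\<lambda>v. L (frechet_derivative (Mt \<tau>) (at (x, P)) v))) (at (x, P))"
          using has_derivative_schur[OF oS xS C1, of J \<sigma>] by (simp add: S_def H_def L_def M_def)
        from frechet_derivative_at[OF this] show ?thesis by (simp add: m_def fun_eq_iff)
      qed
      \<comment> \<open>As P is assumed not to be bad, no nonzero covector in the block d
        annihilates the x-derivatives of the Schur complement, so they fill this block.\<close>
      define R where "R = range (\<lambda>v. L (m v))"
      have subR: "subspace R" unfolding R_def
        using linear_compose[OF linm linL] by (auto simp: o_def intro!: linear_subspace_image)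
      have RW: "R \<subseteq> span (schur_basis J \<sigma>)" unfolding R_def L_def using compress_in_span by blast
      have "span (schur_basis J \<sigma>) \<subseteq> R"
      proof (rule ccontr)
        assume "\<not> span (schur_basis J \<sigma>) \<subseteq> R"
        moreover have "span R = R" using subR by (simp add: span_eq_iff)
        ultimately have "span R \<subset> span (schur_basis J \<sigma>)" using RW by blast
        then obtain w where w: "w \<noteq> 0" "w \<in> span (schur_basis J \<sigma>)" "\<And>y. y \<in> span R \<Longrightarrow> orthogonal w y"
          using orthogonal_to_subspace_exists_gen by blast
        have "L (m b) \<bullet> w = 0" for b
          using w(3)[of "L (m b)"] span_base[of "L (m b)" R] by (auto simp: R_def orthogonal_def inner_commute)
        then have "P \<in> X \<tau> J \<sigma>" unfolding X_def mem_Collect_eq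
          by (intro exI[of _ x] conjI bexI[of _ w] ballI) (use xS H0 w(1,2) dH in auto)
        then show False using nX by simp
      qed
      have "rank_transverse (Jac P x) (frechet_derivative (Jac P) (at x))" unfolding rank_transverse_def
      proof
        fix B
        \<comment> \<open>The decomposition obtained for B N^-1 is multiplied by N. The derivative
          of N^-1 contributes a term that begins with the Jacobian, so it is absorbed into the
          summand M Y.\<close>
        define Ni where "Ni = matrix_inv (N \<tau> x)"
        have NiN: "Ni ** N \<tau> x = mat 1" "N \<tau> x ** Ni = mat 1"
          using Nx by (simp_all add: Ni_def matrix_inv_left matrix_inv_right)
        have "L (B ** Ni) \<in> R" using compress_in_span \<open>span (schur_basis J \<sigma>) \<subseteq> R\<close> unfolding L_def by blast
        then obtain v where "L (B ** Ni) = L (m v)" by (auto simp: R_def)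
        then have "L (B ** Ni - m v) = 0" by (simp add: linear_diff[OF linL])
        then obtain X' Y' where XY: "B ** Ni - m v = X' ** M + M ** Y'"
          unfolding L_def by (rule tangent_decomposition)
        have dJ: "(Jac P has_derivative frechet_derivative (Jac P) (at x)) (at x)"
          by (rule Cn_on_has_derivative[OF CJac \<open>1 \<le> k\<close> x(1)])
        have CN1: "Cn_on 1 (V0 \<tau>) (N \<tau>)" by (rule Cn_on_le[OF Cn_on_subset[OF CN V0V] \<open>1 \<le> k\<close>])
        define N' where "N' = frechet_derivative (N \<tau>) (at x)"
        have dNi: "((\<lambda>x. matrix_inv (N \<tau> x)) has_derivative (\<lambda>v. - (Ni ** N' v ** Ni))) (at x)"
          unfolding Ni_def N'_def by (rule has_derivative_matrix_inv[OF V0 xV0 CN1]) (simp add: V0_def)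
        have "((\<lambda>x. Mt \<tau> (x, P)) has_derivative (\<lambda>v. Jac P x ** (- (Ni ** N' v ** Ni)) + frechet_derivative (Jac P) (at x) v ** Ni)) (at x)"
          using mm.FDERIV[OF dJ dNi] by (simp add: Mt_def Ni_def)
        moreover have "((\<lambda>x. Mt \<tau> (x, P)) has_derivative m) (at x)"
        proof -
          have "((\<lambda>x. (x, P)) has_derivative (\<lambda>v. (v, 0))) (at x)" by (auto intro!: derivative_eq_intros)
          from diff_chain_at[OF this dMt] show ?thesis by (simp add: o_def m_def)
        qed
        ultimately have "(\<lambda>v. Jac P x ** (- (Ni ** N' v ** Ni)) + frechet_derivative (Jac P) (at x) v ** Ni) = m"
          by (rule has_derivative_unique)
        from fun_cong[OF this, of v]
        have m: "m v = frechet_derivative (Jac P) (at x) v ** Ni - Jac P x ** (Ni ** N' v ** Ni)"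
          by (simp add: mm.minus_right algebra_simps)
        have "B = (B ** Ni) ** N \<tau> x" by (simp add: matrix_mul_assoc[symmetric] NiN)
        also have "B ** Ni = m v + X' ** M + M ** Y'" using XY by (simp add: algebra_simps)
        also have "\<dots> ** N \<tau> x = frechet_derivative (Jac P) (at x) v + X' ** Jac P x + Jac P x ** (Ni ** Y' ** N \<tau> x - Ni ** N' v)"
          unfolding m Mt Ni_def[symmetric]
          by (simp add: mm.add_left mm.diff_left mm.diff_right matrix_mul_assoc[symmetric] NiN)
        finally show "\<exists>v X Y. B = frechet_derivative (Jac P) (at x) v + X ** Jac P x + Jac P x ** Y" by blast
      qed
      then show False using nt by simp
    qed
    then show ?thesis using J rM by blast
  qed
  then have "{P. \<exists>x\<in>V. rank (Jac P x) = \<rho> \<and> \<not> rank_transverse (Jac P x) (frechet_derivative (Jac P) (at x))}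
      \<subseteq> (\<Union>\<tau>. \<Union>(J, \<sigma>)\<in>{(J, \<sigma>). card J = \<rho> \<and> inj_on \<sigma> J}. X \<tau> J \<sigma>)" by blast
  ultimately show ?thesis by (rule negligible_subset)
qed

section \<open>Charts, tangent vectors and transversality\<close>

lemma Cr_on_CnD: "Cr_on r S f \<Longrightarrow> enat n \<le> r \<Longrightarrow> Cn_on n S f"
  by (simp add: Cr_on_def)

lemma Cr_on_cong: "open S \<Longrightarrow> Cr_on r S f \<Longrightarrow> (\<And>x. x \<in> S \<Longrightarrow> f x = g x) \<Longrightarrow> Cr_on r S g"
  unfolding Cr_on_def using Cn_on_cong by blast

lemma Cr_on_subset: "Cr_on r S f \<Longrightarrow> T \<subseteq> S \<Longrightarrow> Cr_on r T f"
  unfolding Cr_on_def using Cn_on_subset by blast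

lemma Cr_on_compose:
  assumes "open S" "open T" "Cr_on r S f" "Cr_on r T g" "\<And>x. x \<in> S \<Longrightarrow> f x \<in> T"
  shows "Cr_on r S (\<lambda>x. g (f x))"
  unfolding Cr_on_def
proof (intro allI impI)
  fix n assume n: "enat n \<le> r"
  show "Cn_on n S (\<lambda>x. g (f x))"
    by (rule Cn_on_compose[OF assms(1,2) Cr_on_CnD[OF assms(3) n] Cr_on_CnD[OF assms(4) n] assms(5)])
qed

lemma Cr_on_1: "Cr_on 1 S f \<longleftrightarrow> Cn_on 1 S f"
proof
  assume "Cr_on 1 S f" then show "Cn_on 1 S f" by (rule Cr_on_CnD) (simp add: one_enat_def)
next
  assume "Cn_on 1 S f" then show "Cr_on 1 S f"
    unfolding Cr_on_def by (metis Cn_on_le enat_ord_simps(1) one_enat_def)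
qed

locale atlas =
  fixes s :: enat and B :: "('b, 'd::euclidean_space) chart set"
  assumes atlas: "Cr_atlas s B" and s: "1 \<le> s"
begin

lemma inj_chart: "(U, \<phi>) \<in> B \<Longrightarrow> inj_on \<phi> U" and open_chart: "(U, \<phi>) \<in> B \<Longrightarrow> open (\<phi> ` U)"
  using atlas by (auto simp: Cr_atlas_def is_chart_def)

lemma open_overlap: "(U, \<phi>) \<in> B \<Longrightarrow> (V, \<psi>) \<in> B \<Longrightarrow> open (\<phi> ` (U \<inter> V))"
  using atlas unfolding Cr_atlas_def compatible_def by fast

lemma Cr_transition: "(U, \<phi>) \<in> B \<Longrightarrow> (V, \<psi>) \<in> B \<Longrightarrow> Cr_on s (\<phi> ` (U \<inter> V)) (\<psi> \<circ> inv_into U \<phi>)"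
  using atlas unfolding Cr_atlas_def compatible_def by fast

lemma Cn_transition: "(U, \<phi>) \<in> B \<Longrightarrow> (V, \<psi>) \<in> B \<Longrightarrow> Cn_on 1 (\<phi> ` (U \<inter> V)) (\<psi> \<circ> inv_into U \<phi>)"
  by (rule Cr_on_CnD[OF Cr_transition]) (use s in \<open>auto simp: one_enat_def\<close>)

lemma inv_chart: "(U, \<phi>) \<in> B \<Longrightarrow> p \<in> U \<Longrightarrow> inv_into U \<phi> (\<phi> p) = p"
  using inj_chart by (simp add: inv_into_f_f)

text \<open>The family of coordinate vectors with coordinate \<xi> in the chart (U, \<phi>) at p; it
  identifies tangent vectors at p with the model space. The value 0 away from the charts at p
  matches \<open>velocity\<close>.\<close>

definition tvec :: "'b set \<Rightarrow> ('b \<Rightarrow> 'd) \<Rightarrow> 'b \<Rightarrow> 'd \<Rightarrow> ('b, 'd) tangent_vector" where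
  "tvec U \<phi> p \<xi> = (\<lambda>(V, \<psi>). if (V, \<psi>) \<in> B \<and> p \<in> V
     then frechet_derivative (\<psi> \<circ> inv_into U \<phi>) (at (\<phi> p)) \<xi> else 0)"

lemma transition_derivative:
  assumes "(U, \<phi>) \<in> B" "(V, \<psi>) \<in> B" "p \<in> U" "p \<in> V"
  shows "((\<psi> \<circ> inv_into U \<phi>) has_derivative frechet_derivative (\<psi> \<circ> inv_into U \<phi>) (at (\<phi> p))) (at (\<phi> p))"
  using Cn_on_has_derivative[OF Cn_transition[OF assms(1,2)]] assms by simp

text \<open>The curve is known to lie in U only. Continuity in coordinates and openness of the
  overlap keep it in V for small times, where the chain rule for the transition map applies.\<close>

lemma curve_change_chart:
  assumes c: "(U, \<phi>) \<in> B" "(V, \<psi>) \<in> B" and p: "\<gamma> 0 \<in> U" "\<gamma> 0 \<in> V"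
    and ev: "eventually (\<lambda>t. \<gamma> t \<in> U) (nhds 0)" and d: "((\<phi> \<circ> \<gamma>) has_vector_derivative \<xi>) (at 0)"
  shows "((\<psi> \<circ> \<gamma>) has_vector_derivative frechet_derivative (\<psi> \<circ> inv_into U \<phi>) (at (\<phi> (\<gamma> 0))) \<xi>) (at 0)"
    and "eventually (\<lambda>t. \<gamma> t \<in> V) (nhds (0::real))"
proof -
  have cont: "continuous (at 0) (\<phi> \<circ> \<gamma>)" using d has_vector_derivative_continuous by blast
  have "eventually (\<lambda>t. (\<phi> \<circ> \<gamma>) t \<in> \<phi> ` (U \<inter> V)) (nhds 0)"
  proof -
    have "((\<phi> \<circ> \<gamma>) \<longlongrightarrow> (\<phi> \<circ> \<gamma>) 0) (nhds 0)"
      using cont unfolding isCont_def tendsto_at_iff_tendsto_nhds .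
    then show ?thesis by (rule topological_tendstoD[OF _ open_overlap[OF c]]) (use p in auto)
  qed
  then have ev2: "eventually (\<lambda>t. \<gamma> t \<in> U \<inter> V) (nhds 0)"
    using ev
  proof eventually_elim
    case (elim t)
    then show ?case using inj_onD[OF inj_chart[OF c(1)]] by fastforce
  qed
  then show "eventually (\<lambda>t. \<gamma> t \<in> V) (nhds 0)" by eventually_elim simp
  obtain S where S: "open S" "0 \<in> S" "\<And>t. t \<in> S \<Longrightarrow> \<gamma> t \<in> U \<inter> V" using ev2 unfolding eventually_nhds by blast
  have "((\<lambda>t. (\<psi> \<circ> inv_into U \<phi>) ((\<phi> \<circ> \<gamma>) t)) has_derivative
      (\<lambda>t. frechet_derivative (\<psi> \<circ> inv_into U \<phi>) (at (\<phi> (\<gamma> 0))) (t *\<^sub>R \<xi>))) (at 0)"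
    using diff_chain_at[OF d[unfolded has_vector_derivative_def], of "\<psi> \<circ> inv_into U \<phi>"] transition_derivative[OF c p]
    by (simp add: o_def)
  then have "((\<psi> \<circ> \<gamma>) has_derivative (\<lambda>t. frechet_derivative (\<psi> \<circ> inv_into U \<phi>) (at (\<phi> (\<gamma> 0))) (t *\<^sub>R \<xi>))) (at 0)"
    by (rule has_derivative_transform_within_open[OF _ S(1,2)]) (use S(3) inv_chart[OF c(1)] in auto)
  moreover have "linear (frechet_derivative (\<psi> \<circ> inv_into U \<phi>) (at (\<phi> (\<gamma> 0))))"
    using transition_derivative[OF c p] has_derivative_linear by blast
  ultimately show "((\<psi> \<circ> \<gamma>) has_vector_derivative frechet_derivative (\<psi> \<circ> inv_into U \<phi>) (at (\<phi> (\<gamma> 0))) \<xi>) (at 0)"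
    by (simp add: has_vector_derivative_def linear_cmul)
qed

lemma velocity_eq_tvec:
  assumes "(U, \<phi>) \<in> B" "\<gamma> 0 \<in> U" "eventually (\<lambda>t. \<gamma> t \<in> U) (nhds 0)" "((\<phi> \<circ> \<gamma>) has_vector_derivative \<xi>) (at 0)"
  shows "velocity B \<gamma> = tvec U \<phi> (\<gamma> 0) \<xi>"
proof (rule ext)
  fix c :: "('b, 'd) chart"
  obtain V \<psi> where c: "c = (V, \<psi>)" by (cases c)
  show "velocity B \<gamma> c = tvec U \<phi> (\<gamma> 0) \<xi> c"
    using vector_derivative_at[OF curve_change_chart(1)[OF assms(1) _ assms(2) _ assms(3,4), of V \<psi>]]
    by (simp add: c velocity_def tvec_def)
qed

lemma tvec_self:
  assumes "(U, \<phi>) \<in> B" "p \<in> U"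
  shows "tvec U \<phi> p \<xi> (U, \<phi>) = \<xi>"
proof -
  have "((\<lambda>x. x) has_derivative (\<lambda>x. x)) (at (\<phi> p))" by simp
  then have "((\<phi> \<circ> inv_into U \<phi>) has_derivative (\<lambda>x. x)) (at (\<phi> p))"
    by (rule has_derivative_transform_within_open[OF _ open_chart[OF assms(1)]])
      (use assms inv_chart in auto)
  from frechet_derivative_at[OF this] show ?thesis using assms by (simp add: tvec_def fun_eq_iff)
qed

lemma tvec_add:
  assumes "(U, \<phi>) \<in> B" "p \<in> U"
  shows "tvec U \<phi> p (\<xi> + \<eta>) = (\<lambda>c. tvec U \<phi> p \<xi> c + tvec U \<phi> p \<eta> c)"
proof (rule ext)
  fix c :: "('b, 'd) chart"
  obtain V \<psi> where c: "c = (V, \<psi>)" by (cases c)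
  show "tvec U \<phi> p (\<xi> + \<eta>) c = tvec U \<phi> p \<xi> c + tvec U \<phi> p \<eta> c"
    using linear_add[OF has_derivative_linear[OF transition_derivative[OF assms(1) _ assms(2), of V \<psi>]]]
    by (simp add: c tvec_def)
qed

lemma curve_atD:
  assumes "curve_at B Z p \<gamma>" "(U, \<phi>) \<in> B" "p \<in> U"
  obtains \<xi> where "\<gamma> 0 = p" "((\<phi> \<circ> \<gamma>) has_vector_derivative \<xi>) (at 0)" "eventually (\<lambda>t. \<gamma> t \<in> U) (nhds 0)"
    "velocity B \<gamma> = tvec U \<phi> p \<xi>"
proof -
  obtain V \<psi> \<epsilon> where c: "(V, \<psi>) \<in> B" "\<epsilon> > 0" "\<gamma> ` {-\<epsilon><..<\<epsilon>} \<subseteq> Z \<inter> V" "Cn_on 1 {-\<epsilon><..<\<epsilon>} (\<psi> \<circ> \<gamma>)" and p: "\<gamma> 0 = p"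
    using assms(1) unfolding curve_at_def Cr_on_1 by blast
  have pV: "\<gamma> 0 \<in> V" using c(2,3) by auto
  have evV: "eventually (\<lambda>t. \<gamma> t \<in> V) (nhds 0)"
    unfolding eventually_nhds using c(2,3) by (intro exI[of _ "{-\<epsilon><..<\<epsilon>}"]) auto
  obtain \<eta> where \<eta>: "((\<psi> \<circ> \<gamma>) has_vector_derivative \<eta>) (at 0)"
    using Cn_on_has_derivative[OF c(4), of 0] c(2)
    by (metis differentiableI greaterThanLessThan_iff le_numeral_extra(4) neg_less_0_iff_less vector_derivative_works)
  define \<xi> where "\<xi> = frechet_derivative (\<phi> \<circ> inv_into V \<psi>) (at (\<psi> (\<gamma> 0))) \<eta>"
  have d: "((\<phi> \<circ> \<gamma>) has_vector_derivative \<xi>) (at 0)" and ev: "eventually (\<lambda>t. \<gamma> t \<in> U) (nhds 0)"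
    unfolding \<xi>_def using curve_change_chart[OF c(1) assms(2) pV _ evV \<eta>] assms(3) p by auto
  have "velocity B \<gamma> = tvec U \<phi> p \<xi>" using velocity_eq_tvec[OF assms(2) _ ev d] assms(3) p by simp
  then show thesis using that p d ev by blast
qed

text \<open>A coordinate curve that stays in Z is pulled back to the manifold and realizes its
  coordinate velocity; all tangent vectors below are produced in this way.\<close>

lemma curve_at_in_chart:
  assumes c: "(U, \<phi>) \<in> B" "p \<in> U" and "\<epsilon> > 0" and \<alpha>: "Cn_on 1 {-\<epsilon><..<\<epsilon>} \<alpha>" "\<alpha> 0 = \<phi> p"
    "(\<alpha> has_vector_derivative \<xi>) (at 0)" and im: "\<And>t. \<bar>t\<bar> < \<epsilon> \<Longrightarrow> \<alpha> t \<in> \<phi> ` U \<and> inv_into U \<phi> (\<alpha> t) \<in> Z"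
  shows "tvec U \<phi> p \<xi> \<in> tangent_space B Z p"
proof -
  define \<gamma> where "\<gamma> = inv_into U \<phi> \<circ> \<alpha>"
  have \<phi>\<gamma>: "\<phi> (\<gamma> t) = \<alpha> t" "\<gamma> t \<in> U" if "\<bar>t\<bar> < \<epsilon>" for t
    using im[OF that] by (auto simp: \<gamma>_def f_inv_into_f inv_into_into)
  have \<gamma>0: "\<gamma> 0 = p" using inv_chart[OF c] by (simp add: \<gamma>_def \<alpha>(2))
  have o: "open {-\<epsilon><..<\<epsilon>}" "0 \<in> {-\<epsilon><..<\<epsilon>}" using \<open>\<epsilon> > 0\<close> by auto
  have "Cn_on 1 {-\<epsilon><..<\<epsilon>} (\<phi> \<circ> \<gamma>)"
    by (rule Cn_on_cong[OF o(1) \<alpha>(1)]) (use \<phi>\<gamma> in \<open>auto simp: abs_less_iff\<close>)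
  moreover have "\<gamma> ` {-\<epsilon><..<\<epsilon>} \<subseteq> Z \<inter> U"
    using im \<phi>\<gamma>(2) by (auto simp: \<gamma>_def abs_less_iff)
  ultimately have "curve_at B Z p \<gamma>"
    unfolding curve_at_def Cr_on_1 using \<gamma>0 c(1) \<open>\<epsilon> > 0\<close> by blast
  moreover have "((\<phi> \<circ> \<gamma>) has_vector_derivative \<xi>) (at 0)"
    using \<alpha>(3) unfolding has_vector_derivative_def
    by (rule has_derivative_transform_within_open[OF _ o]) (use \<phi>\<gamma> in \<open>auto simp: abs_less_iff\<close>)
  moreover have "eventually (\<lambda>t. \<gamma> t \<in> U) (nhds 0)"
    unfolding eventually_nhds using o \<phi>\<gamma>(2) by (intro exI[of _ "{-\<epsilon><..<\<epsilon>}"]) (auto simp: abs_less_iff)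
  ultimately have "velocity B \<gamma> = tvec U \<phi> p \<xi>" using velocity_eq_tvec[OF c(1)] \<gamma>0 c(2) by blast
  then show ?thesis unfolding tangent_space_def using \<open>curve_at B Z p \<gamma>\<close> by (intro CollectI exI[of _ \<gamma>]) simp
qed

text \<open>Straight coordinate lines realize every vector, as short pieces of them stay in the open
  chart image.\<close>

lemma tangent_space_points:
  assumes c: "(U, \<phi>) \<in> B" "p \<in> U"
  shows "tangent_space B (points B) p = range (tvec U \<phi> p)"
proof (intro equalityI subsetI)
  fix v assume "v \<in> tangent_space B (points B) p"
  then obtain \<gamma> where "v = velocity B \<gamma>" "curve_at B (points B) p \<gamma>" by (auto simp: tangent_space_def)
  then show "v \<in> range (tvec U \<phi> p)" using curve_atD[OF _ c] by (metis rangeI)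
next
  fix v assume "v \<in> range (tvec U \<phi> p)"
  then obtain \<xi> where v: "v = tvec U \<phi> p \<xi>" by blast
  define \<alpha> where "\<alpha> = (\<lambda>t::real. \<phi> p + t *\<^sub>R \<xi>)"
  have "open (\<alpha> -` (\<phi> ` U))" unfolding \<alpha>_def by (intro open_vimage open_chart[OF c(1)] continuous_intros)
  moreover have "0 \<in> \<alpha> -` (\<phi> ` U)" using c(2) by (simp add: \<alpha>_def)
  ultimately obtain \<epsilon> where \<epsilon>: "\<epsilon> > 0" "ball 0 \<epsilon> \<subseteq> \<alpha> -` (\<phi> ` U)" using openE by blast
  have "tvec U \<phi> p \<xi> \<in> tangent_space B (points B) p"
  proof (rule curve_at_in_chart[OF c \<epsilon>(1), of \<alpha>])
    show "Cn_on 1 {-\<epsilon><..<\<epsilon>} \<alpha>" unfolding \<alpha>_def by (intro Cn_on_add Cn_on_scaleR Cn_on_id Cn_on_const) auto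
    show "\<alpha> 0 = \<phi> p" by (simp add: \<alpha>_def)
    show "(\<alpha> has_vector_derivative \<xi>) (at 0)" unfolding \<alpha>_def by (auto intro!: derivative_eq_intros)
    show "\<alpha> t \<in> \<phi> ` U \<and> inv_into U \<phi> (\<alpha> t) \<in> points B" if "\<bar>t\<bar> < \<epsilon>" for t
    proof -
      have "\<alpha> t \<in> \<phi> ` U" using \<epsilon>(2) that by (auto simp: subset_iff)
      then show ?thesis using c(1) inv_into_into[of "\<alpha> t" \<phi> U] by (auto simp: points_def)
    qed
  qed
  then show "v \<in> tangent_space B (points B) p" by (simp add: v)
qed

lemma tangent_space_subset:
  assumes "(U, \<phi>) \<in> B" "p \<in> U"
  shows "tangent_space B Z p \<subseteq> range (tvec U \<phi> p)"
  unfolding tangent_space_def using curve_atD[OF _ assms] by fastforce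

end

text \<open>The tangent vectors of Z need only be exhibited, not characterized.\<close>

lemma transverseI:
  fixes A :: "('a, 'e::euclidean_space) chart set" and B :: "('b, 'd::euclidean_space) chart set"
  assumes A: "atlas r A" and B: "atlas s B"
    and crit: "\<And>q. q \<in> points A \<Longrightarrow> g q \<in> Z \<Longrightarrow>
      \<exists>U \<phi> U' \<theta>. (U, \<phi>) \<in> A \<and> q \<in> U \<and> (U', \<theta>) \<in> B \<and> g ` U \<subseteq> U' \<and>
        Cn_on 1 (\<phi> ` U) (\<theta> \<circ> g \<circ> inv_into U \<phi>) \<and>
        (\<forall>\<zeta>. \<exists>v \<eta>. \<zeta> = frechet_derivative (\<theta> \<circ> g \<circ> inv_into U \<phi>) (at (\<phi> q)) v + \<eta> \<and>
           atlas.tvec B U' \<theta> (g q) \<eta> \<in> tangent_space B Z (g q))"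
  shows "transverse A B g Z"
  unfolding transverse_def
proof (intro ballI impI)
  interpret A: atlas r A by fact
  interpret B: atlas s B by fact
  fix q assume q: "q \<in> points A" "g q \<in> Z"
  obtain U \<phi> U' \<theta> where c: "(U, \<phi>) \<in> A" "q \<in> U" and c': "(U', \<theta>) \<in> B" and gU: "g ` U \<subseteq> U'"
    and C1: "Cn_on 1 (\<phi> ` U) (\<theta> \<circ> g \<circ> inv_into U \<phi>)"
    and dec: "\<forall>\<zeta>. \<exists>v \<eta>. \<zeta> = frechet_derivative (\<theta> \<circ> g \<circ> inv_into U \<phi>) (at (\<phi> q)) v + \<eta> \<and>
           B.tvec U' \<theta> (g q) \<eta> \<in> tangent_space B Z (g q)"
    using crit[OF q] by blast
  define \<Theta> where "\<Theta> = frechet_derivative (\<theta> \<circ> g \<circ> inv_into U \<phi>) (at (\<phi> q))"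
  have gq: "g q \<in> U'" using gU c by auto
  have d\<Theta>: "((\<theta> \<circ> g \<circ> inv_into U \<phi>) has_derivative \<Theta>) (at (\<phi> q))"
    unfolding \<Theta>_def using Cn_on_has_derivative[OF C1] c by simp
  \<comment> \<open>The description in \<open>differential\<close> has a unique solution: by the
    chain rule every curve with the given velocity leads to the same image velocity.\<close>
  have diff: "differential A B g q (A.tvec U \<phi> q v) = B.tvec U' \<theta> (g q) (\<Theta> v)" for v
    unfolding differential_def
  proof (rule the_equality)
    have vel: "velocity B (g \<circ> \<gamma>) = B.tvec U' \<theta> (g q) (\<Theta> v)"
      if \<gamma>: "curve_at A (points A) q \<gamma>" "velocity A \<gamma> = A.tvec U \<phi> q v" for \<gamma>
    proof -
      obtain \<xi> where \<xi>: "\<gamma> 0 = q" "((\<phi> \<circ> \<gamma>) has_vector_derivative \<xi>) (at 0)"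
        "eventually (\<lambda>t. \<gamma> t \<in> U) (nhds 0)" "velocity A \<gamma> = A.tvec U \<phi> q \<xi>"
        using A.curve_atD[OF \<gamma>(1) c] by blast
      have "\<xi> = v" using \<xi>(4) \<gamma>(2) A.tvec_self[OF c] by metis
      obtain S where S: "open S" "0 \<in> S" "\<And>t. t \<in> S \<Longrightarrow> \<gamma> t \<in> U" using \<xi>(3) unfolding eventually_nhds by blast
      have "((\<lambda>t. (\<theta> \<circ> g \<circ> inv_into U \<phi>) ((\<phi> \<circ> \<gamma>) t)) has_derivative (\<lambda>t. \<Theta> (t *\<^sub>R \<xi>))) (at 0)"
        using diff_chain_at[OF \<xi>(2)[unfolded has_vector_derivative_def], of "\<theta> \<circ> g \<circ> inv_into U \<phi>" \<Theta>] d\<Theta> \<xi>(1)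
        by (simp add: o_def)
      then have "((\<theta> \<circ> (g \<circ> \<gamma>)) has_derivative (\<lambda>t. \<Theta> (t *\<^sub>R \<xi>))) (at 0)"
        by (rule has_derivative_transform_within_open[OF _ S(1,2)]) (use S(3) A.inv_chart[OF c(1)] in auto)
      then have "((\<theta> \<circ> (g \<circ> \<gamma>)) has_vector_derivative \<Theta> \<xi>) (at 0)"
        by (simp add: has_vector_derivative_def linear_cmul[OF has_derivative_linear[OF d\<Theta>]])
      moreover have "eventually (\<lambda>t. (g \<circ> \<gamma>) t \<in> U') (nhds 0)"
        using \<xi>(3) by eventually_elim (use gU in auto)
      ultimately show ?thesis
        using B.velocity_eq_tvec[OF c', of "g \<circ> \<gamma>"] gq \<xi>(1) \<open>\<xi> = v\<close> by simp
    qed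
    have "A.tvec U \<phi> q v \<in> tangent_space A (points A) q" using A.tangent_space_points[OF c] by blast
    then obtain \<gamma> where \<gamma>: "curve_at A (points A) q \<gamma>" "velocity A \<gamma> = A.tvec U \<phi> q v"
      by (auto simp: tangent_space_def)
    show "\<exists>\<gamma>. curve_at A (points A) q \<gamma> \<and> velocity A \<gamma> = A.tvec U \<phi> q v \<and> velocity B (g \<circ> \<gamma>) = B.tvec U' \<theta> (g q) (\<Theta> v)"
      using \<gamma> vel[OF \<gamma>] by blast
    show "w = B.tvec U' \<theta> (g q) (\<Theta> v)"
      if "\<exists>\<gamma>. curve_at A (points A) q \<gamma> \<and> velocity A \<gamma> = A.tvec U \<phi> q v \<and> velocity B (g \<circ> \<gamma>) = w" for w
      using that vel by blast
  qed
  have im: "differential A B g q ` tangent_space A (points A) q = range (\<lambda>v. B.tvec U' \<theta> (g q) (\<Theta> v))"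
    unfolding A.tangent_space_points[OF c] by (auto simp: diff image_image)
  show "{\<lambda>c. u c + w c | u w. u \<in> differential A B g q ` tangent_space A (points A) q \<and> w \<in> tangent_space B Z (g q)}
      = tangent_space B (points B) (g q)"
    unfolding im B.tangent_space_points[OF c' gq]
  proof (intro equalityI subsetI)
    fix y assume "y \<in> {\<lambda>c. u c + w c | u w. u \<in> range (\<lambda>v. B.tvec U' \<theta> (g q) (\<Theta> v)) \<and> w \<in> tangent_space B Z (g q)}"
    then obtain v w where y: "y = (\<lambda>c. B.tvec U' \<theta> (g q) (\<Theta> v) c + w c)" "w \<in> tangent_space B Z (g q)" by blast
    obtain \<eta> where "w = B.tvec U' \<theta> (g q) \<eta>" using B.tangent_space_subset[OF c' gq] y(2) by blast
    then have "y = B.tvec U' \<theta> (g q) (\<Theta> v + \<eta>)" using y(1) by (simp add: B.tvec_add[OF c' gq])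
    then show "y \<in> range (B.tvec U' \<theta> (g q))" by simp
  next
    fix y assume "y \<in> range (B.tvec U' \<theta> (g q))"
    then obtain \<zeta> where "y = B.tvec U' \<theta> (g q) \<zeta>" by blast
    moreover obtain v \<eta> where "\<zeta> = \<Theta> v + \<eta>" "B.tvec U' \<theta> (g q) \<eta> \<in> tangent_space B Z (g q)"
      using dec unfolding \<Theta>_def by blast
    ultimately have "y = (\<lambda>c. B.tvec U' \<theta> (g q) (\<Theta> v) c + B.tvec U' \<theta> (g q) \<eta> c)" by (simp add: B.tvec_add[OF c' gq])
    then show "y \<in> {\<lambda>c. u c + w c | u w. u \<in> range (\<lambda>v. B.tvec U' \<theta> (g q) (\<Theta> v)) \<and> w \<in> tangent_space B Z (g q)}"
      using \<open>B.tvec U' \<theta> (g q) \<eta> \<in> tangent_space B Z (g q)\<close> by blast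
  qed
qed

section \<open>Charts of the maximal atlas and uniqueness of the codimension\<close>

context atlas
begin

text \<open>A restricted chart followed by a C^s diffeomorphism of open sets remains compatible with
  the atlas. Slice charts are obtained in this form.\<close>

lemma maximal_atlas_compose:
  assumes c: "(U, \<phi>) \<in> B" and S: "open S" "S \<subseteq> \<phi> ` U" and T: "open T"
    and \<Psi>: "Cr_on s S \<Psi>" "\<And>x. x \<in> S \<Longrightarrow> \<Psi> x \<in> T" and \<Phi>: "Cr_on s T \<Phi>" "\<And>y. y \<in> T \<Longrightarrow> \<Phi> y \<in> S"
    and inv: "\<And>x. x \<in> S \<Longrightarrow> \<Phi> (\<Psi> x) = x" "\<And>y. y \<in> T \<Longrightarrow> \<Psi> (\<Phi> y) = y"
  shows "({p \<in> U. \<phi> p \<in> S}, \<lambda>p. \<Psi> (\<phi> p)) \<in> maximal_atlas s B"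
proof -
  let ?W = "{p \<in> U. \<phi> p \<in> S}" and ?\<psi> = "\<lambda>p. \<Psi> (\<phi> p)"
  have C0: "continuous_on R f" if "Cr_on s R f" for R and f :: "'d \<Rightarrow> 'd"
    using Cr_on_CnD[OF that, of 0] by (simp add: zero_enat_def[symmetric])
  have inj: "inj_on ?\<psi> ?W"
    by (rule inj_onI) (metis (no_types, lifting) c inj_chart inj_onD inv(1) mem_Collect_eq)
  have im: "?\<psi> ` (?W \<inter> {p. \<phi> p \<in> R}) = T \<inter> \<Phi> -` R" for R
  proof (intro equalityI subsetI)
    fix y assume "y \<in> ?\<psi> ` (?W \<inter> {p. \<phi> p \<in> R})"
    then show "y \<in> T \<inter> \<Phi> -` R" using \<Psi>(2) inv(1) by auto
  next
    fix y assume y: "y \<in> T \<inter> \<Phi> -` R"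
    then obtain p where "p \<in> U" "\<phi> p = \<Phi> y" using \<Phi>(2) S(2) by (metis IntD1 imageE subsetD)
    then show "y \<in> ?\<psi> ` (?W \<inter> {p. \<phi> p \<in> R})"
      using y \<Phi>(2) inv(2) by (intro image_eqI[of _ _ p]) auto
  qed
  have imW: "?\<psi> ` ?W = T" using im[of UNIV] by simp
  have invW: "inv_into ?W ?\<psi> y = inv_into U \<phi> (\<Phi> y)" if "y \<in> T" for y
  proof -
    have "\<Phi> y \<in> \<phi> ` U" using \<Phi>(2)[OF that] S(2) by blast
    then have p: "inv_into U \<phi> (\<Phi> y) \<in> U" "\<phi> (inv_into U \<phi> (\<Phi> y)) = \<Phi> y"
      by (auto intro: inv_into_into f_inv_into_f)
    show ?thesis by (rule inv_into_f_eq[OF inj]) (use p \<Phi>(2)[OF that] inv(2)[OF that] in auto)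
  qed
  have "compatible s (?W, ?\<psi>) d" if "d \<in> B" for d
  proof -
    obtain V \<theta> where d: "d = (V, \<theta>)" by (cases d)
    have dB: "(V, \<theta>) \<in> B" using that d by simp
    have o1: "open (\<phi> ` (U \<inter> V))" and o2: "open (\<theta> ` (V \<inter> U))"
      using open_overlap[OF c dB] open_overlap[OF dB c] by auto
    have t1: "Cr_on s (\<phi> ` (U \<inter> V)) (\<theta> \<circ> inv_into U \<phi>)" and t2: "Cr_on s (\<theta> ` (V \<inter> U)) (\<phi> \<circ> inv_into V \<theta>)"
      using Cr_transition[OF c dB] Cr_transition[OF dB c] by auto
    have e1: "?\<psi> ` (?W \<inter> V) = T \<inter> \<Phi> -` (\<phi> ` (U \<inter> V))"
    proof -
      have "?W \<inter> V = ?W \<inter> {p. \<phi> p \<in> \<phi> ` (U \<inter> V)}" using inj_onD[OF inj_chart[OF c]] by fastforce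
      then show ?thesis using im[of "\<phi> ` (U \<inter> V)"] by simp
    qed
    have O1: "open (T \<inter> \<Phi> -` (\<phi> ` (U \<inter> V)))"
      by (rule continuous_open_preimage[OF C0[OF \<Phi>(1)] T o1])
    have e2: "\<theta> ` (?W \<inter> V) = \<theta> ` (V \<inter> U) \<inter> (\<phi> \<circ> inv_into V \<theta>) -` S"
      using inv_chart[OF dB] by auto
    have O2: "open (\<theta> ` (V \<inter> U) \<inter> (\<phi> \<circ> inv_into V \<theta>) -` S)"
      by (rule continuous_open_preimage[OF C0[OF t2] o2 S(1)])
    have "Cr_on s (T \<inter> \<Phi> -` (\<phi> ` (U \<inter> V))) (\<lambda>y. (\<theta> \<circ> inv_into U \<phi>) (\<Phi> y))"
      by (rule Cr_on_compose[OF O1 o1 Cr_on_subset[OF \<Phi>(1)] t1]) auto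
    then have r1: "Cr_on s (T \<inter> \<Phi> -` (\<phi> ` (U \<inter> V))) (\<theta> \<circ> inv_into ?W ?\<psi>)"
      by (rule Cr_on_cong[OF O1]) (simp add: invW)
    have "Cr_on s (\<theta> ` (V \<inter> U) \<inter> (\<phi> \<circ> inv_into V \<theta>) -` S) (\<lambda>y. \<Psi> ((\<phi> \<circ> inv_into V \<theta>) y))"
      by (rule Cr_on_compose[OF O2 S(1) Cr_on_subset[OF t2] \<Psi>(1)]) auto
    then have r2: "Cr_on s (\<theta> ` (V \<inter> U) \<inter> (\<phi> \<circ> inv_into V \<theta>) -` S) (?\<psi> \<circ> inv_into V \<theta>)"
      by (simp add: o_def)
    show ?thesis unfolding d compatible_def split e1 e2 using O1 O2 r1 r2 by blast
  qed
  moreover have "is_chart (?W, ?\<psi>)" using inj imW T by (simp add: is_chart_def)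
  moreover have "?W \<subseteq> points B" using c by (auto simp: points_def)
  ultimately show ?thesis by (simp add: maximal_atlas_def)
qed

text \<open>The transition between two slice charts maps a nonempty open piece of L continuously and
  injectively into L', so invariance of domain compares the dimensions. Membership in the maximal
  atlas gives compatibility with charts of B, hence the detour through a chart of B at z.\<close>

lemma slice_dim_le:
  assumes c: "(V, \<psi>) \<in> maximal_atlas s B" "(V', \<psi>') \<in> maximal_atlas s B" and z: "z \<in> Z" "z \<in> V" "z \<in> V'"
    and L: "subspace L" "\<psi> ` (V \<inter> Z) = \<psi> ` V \<inter> L" and L': "subspace L'" "\<psi>' ` (V' \<inter> Z) = \<psi>' ` V' \<inter> L'"
  shows "dim L \<le> dim L'"
proof -
  have C0: "continuous_on R f" if "Cr_on s R f" for R and f :: "'d \<Rightarrow> 'd"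
    using Cr_on_CnD[OF that, of 0] by (simp add: zero_enat_def[symmetric])
  obtain U \<phi> where u: "(U, \<phi>) \<in> B" "z \<in> U" using c(1) z by (auto simp: maximal_atlas_def points_def)
  have comp: "compatible s (V, \<psi>) (U, \<phi>)" "compatible s (V', \<psi>') (U, \<phi>)"
    and inj: "inj_on \<psi> V" "inj_on \<psi>' V'"
    using c u by (auto simp: maximal_atlas_def is_chart_def)
  have o: "open (\<phi> ` (U \<inter> V))" "open (\<phi> ` (U \<inter> V'))" "open (\<psi> ` (V \<inter> U))"
    using comp by (auto simp: compatible_def Int_commute)
  have t1: "continuous_on (\<psi> ` (V \<inter> U)) (\<phi> \<circ> inv_into V \<psi>)"
    and t2: "continuous_on (\<phi> ` (V' \<inter> U)) (\<psi>' \<circ> inv_into U \<phi>)"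
    using comp unfolding compatible_def split by (blast intro: C0)+
  have "\<phi> ` (U \<inter> V \<inter> V') = \<phi> ` (U \<inter> V) \<inter> \<phi> ` (U \<inter> V')"
    using inj_on_image_Int[OF inj_chart[OF u(1)], of "U \<inter> V" "U \<inter> V'"] by (simp add: Int_ac)
  then have o3: "open (\<phi> ` (U \<inter> V \<inter> V'))" using o by (simp add: open_Int)
  have iV: "inv_into V \<psi> (\<psi> p) = p" if "p \<in> V" for p using inj(1) that by simp
  have N: "\<psi> ` (V \<inter> V' \<inter> U) = \<psi> ` (V \<inter> U) \<inter> (\<phi> \<circ> inv_into V \<psi>) -` (\<phi> ` (U \<inter> V \<inter> V'))"
    using iV inj_onD[OF inj_chart[OF u(1)]] by fastforce
  have oN: "open (\<psi> ` (V \<inter> V' \<inter> U))"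
    unfolding N by (rule continuous_open_preimage[OF t1 o(3) o3])
  define g where "g = (\<lambda>y. \<psi>' (inv_into V \<psi> y))"
  have cont: "continuous_on (\<psi> ` (V \<inter> V' \<inter> U)) g"
  proof -
    have "continuous_on (\<psi> ` (V \<inter> V' \<inter> U)) (\<lambda>y. (\<psi>' \<circ> inv_into U \<phi>) ((\<phi> \<circ> inv_into V \<psi>) y))"
      by (rule continuous_on_compose2[OF t2 continuous_on_subset[OF t1]]) (use iV in auto)
    then show ?thesis
      by (rule continuous_on_eq) (auto simp: g_def iV inv_chart[OF u(1)])
  qed
  define S where "S = L \<inter> \<psi> ` (V \<inter> V' \<inter> U)"
  have Sim: "y \<in> S \<Longrightarrow> \<exists>p\<in>Z \<inter> V \<inter> V' \<inter> U. y = \<psi> p" for y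
  proof -
    assume y: "y \<in> S"
    then obtain p where p: "p \<in> V \<inter> V' \<inter> U" "y = \<psi> p" "y \<in> L" by (auto simp: S_def)
    then have "y \<in> \<psi> ` (V \<inter> Z)" unfolding L(2) by blast
    then have "p \<in> Z" using p inj_onD[OF inj(1)] by fastforce
    then show ?thesis using p by blast
  qed
  show ?thesis
  proof (rule invariance_of_dimension_subspaces[of L S L' g])
    show "openin (top_of_set L) S" unfolding S_def using oN by (simp add: openin_open_Int)
    show "continuous_on S g" using cont continuous_on_subset S_def by blast
    show "g \<in> S \<rightarrow> L'"
    proof
      fix y assume "y \<in> S"
      then obtain p where p: "p \<in> Z \<inter> V \<inter> V' \<inter> U" "y = \<psi> p" using Sim by blast
      then have "g y \<in> \<psi>' ` (V' \<inter> Z)" by (auto simp: g_def iV)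
      then show "g y \<in> L'" unfolding L'(2) by blast
    qed
    show "inj_on g S"
    proof (rule inj_onI)
      fix y y' assume y: "y \<in> S" "y' \<in> S" "g y = g y'"
      then obtain p p' where p: "p \<in> V \<inter> V'" "y = \<psi> p" "p' \<in> V \<inter> V'" "y' = \<psi> p'" using Sim by blast
      then have "\<psi>' p = \<psi>' p'" using y(3) by (auto simp: g_def iV)
      then show "y = y'" using p inj_onD[OF inj(2)] by fastforce
    qed
    have "\<psi> z \<in> \<psi> ` (V \<inter> Z)" using z by blast
    then have "\<psi> z \<in> S" unfolding L(2) S_def using z u(2) by blast
    then show "S \<noteq> {}" by blast
  qed (use L L' in auto)
qed

text \<open>Slices at a common point have equal dimension. For empty Z every c would qualify, so a
  point of Z is what makes the description unique.\<close>

lemma submanifold_codim: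
  assumes Z: "submanifold s B Z c" "Z \<noteq> {}"
  shows "codim s B Z = c"
  unfolding codim_def
proof (rule the_equality)
  show "submanifold s B Z c" by fact
  fix c' assume Z': "submanifold s B Z c'"
  obtain z where z: "z \<in> Z" using Z(2) by blast
  obtain V \<psi> L where V: "(V, \<psi>) \<in> maximal_atlas s B" "z \<in> V" and L: "subspace L" "dim L + c = DIM('d)" "\<psi> ` (V \<inter> Z) = \<psi> ` V \<inter> L"
    using Z(1) z unfolding submanifold_def by blast
  obtain V' \<psi>' L' where V': "(V', \<psi>') \<in> maximal_atlas s B" "z \<in> V'" and L': "subspace L'" "dim L' + c' = DIM('d)" "\<psi>' ` (V' \<inter> Z) = \<psi>' ` V' \<inter> L'"
    using Z' z unfolding submanifold_def by blast
  have "dim L = dim L'"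
    using slice_dim_le[OF V(1) V'(1) z V(2) V'(2) L(1,3) L'(1,3)] slice_dim_le[OF V'(1) V(1) z V'(2) V(2) L'(1,3) L(1,3)]
    by simp
  then show "c' = c" using L(2) L'(2) by simp
qed

end

section \<open>The manifold of 1-jets\<close>

locale jet_base =
  fixes r :: enat and A :: "('a, real^'n) chart set"
  assumes Cr_atlas: "Cr_atlas r A" and r: "2 \<le> r"
begin

sublocale atlas r A
  by unfold_locales (use Cr_atlas r order_trans[of 1 "2::enat" r] in \<open>auto simp: one_enat_def numeral_eq_enat\<close>)

lemma Suc_le_r: "enat n \<le> r - 1 \<Longrightarrow> enat (Suc n) \<le> r"
  using r by (cases r) (auto simp: one_enat_def numeral_eq_enat)

lemma one_le_r1: "1 \<le> r - 1"
  using r by (cases r) (auto simp: one_enat_def numeral_eq_enat)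

lemma r1_le: "enat n \<le> r - 1 \<Longrightarrow> enat n \<le> r"
  using Suc_le_r[of n] by (meson enat_ord_simps(1) le_SucI order_refl order_trans)

definition jac :: "'a set \<Rightarrow> ('a \<Rightarrow> real^'n) \<Rightarrow> ('a \<Rightarrow> real^'p) \<Rightarrow> 'a \<Rightarrow> real^'n^'p" where
  "jac U \<phi> h q = matrix (frechet_derivative (h \<circ> inv_into U \<phi>) (at (\<phi> q)))"

text \<open>\<open>Cr_near\<close> provides one chart at q; the C^r transition map moves the
  property to any other.\<close>

lemma Cr_near_in_chart:
  assumes h: "Cr_near r A h q" and c: "(U, \<phi>) \<in> A" "q \<in> U"
  obtains T where "open T" "\<phi> q \<in> T" "T \<subseteq> \<phi> ` U" "Cr_on r T (h \<circ> inv_into U \<phi>)"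
proof -
  obtain V \<psi> T where V: "(V, \<psi>) \<in> A" "q \<in> V" and T: "open T" "\<psi> q \<in> T" "T \<subseteq> \<psi> ` V" "Cr_on r T (h \<circ> inv_into V \<psi>)"
    using h unfolding Cr_near_def by blast
  define \<tau> where "\<tau> = \<psi> \<circ> inv_into U \<phi>"
  have \<tau>: "Cr_on r (\<phi> ` (U \<inter> V)) \<tau>" unfolding \<tau>_def by (rule Cr_transition[OF c(1) V(1)])
  have o: "open (\<phi> ` (U \<inter> V))" by (rule open_overlap[OF c(1) V(1)])
  define T' where "T' = \<phi> ` (U \<inter> V) \<inter> \<tau> -` T"
  have cont: "continuous_on (\<phi> ` (U \<inter> V)) \<tau>"
    using Cr_on_CnD[OF \<tau>, of 0] by (simp add: zero_enat_def[symmetric])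
  have oT': "open T'" unfolding T'_def by (rule continuous_open_preimage[OF cont o T(1)])
  have "Cr_on r T' (\<lambda>x. (h \<circ> inv_into V \<psi>) (\<tau> x))"
    by (rule Cr_on_compose[OF oT' T(1) Cr_on_subset[OF \<tau>] T(4)]) (auto simp: T'_def)
  then have "Cr_on r T' (h \<circ> inv_into U \<phi>)"
    by (rule Cr_on_cong[OF oT']) (auto simp: T'_def \<tau>_def inv_chart[OF c(1)] inv_chart[OF V(1)])
  moreover have "\<phi> q \<in> T'" using c V T by (auto simp: T'_def \<tau>_def inv_chart)
  ultimately show thesis using that oT' by (auto simp: T'_def)
qed

lemma Cr_near_derivative:
  assumes h: "Cr_near r A h q" and c: "(U, \<phi>) \<in> A" "q \<in> U"
  shows "((h \<circ> inv_into U \<phi>) has_derivative frechet_derivative (h \<circ> inv_into U \<phi>) (at (\<phi> q))) (at (\<phi> q))"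
proof -
  obtain T where T: "open T" "\<phi> q \<in> T" "T \<subseteq> \<phi> ` U" "Cr_on r T (h \<circ> inv_into U \<phi>)"
    by (rule Cr_near_in_chart[OF assms])
  have "Cn_on 1 T (h \<circ> inv_into U \<phi>)" by (rule Cr_on_CnD[OF T(4)]) (use s in \<open>simp add: one_enat_def\<close>)
  then show ?thesis using Cn_on_has_derivative T(2) by blast
qed

lemma jac_works:
  fixes h :: "'a \<Rightarrow> real^'p"
  assumes "((h \<circ> inv_into U \<phi>) has_derivative D) (at (\<phi> q))"
  shows "(\<lambda>v. jac U \<phi> h q *v v) = D"
  using frechet_derivative_at[OF assms] matrix_vector_mul(2)[OF has_derivative_linear[OF assms]]
  by (simp add: jac_def)

lemma jac_change:
  fixes h :: "'a \<Rightarrow> real^'p"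
  assumes c: "(U, \<phi>) \<in> A" "(V, \<psi>) \<in> A" "q \<in> U" "q \<in> V"
    and h: "((h \<circ> inv_into U \<phi>) has_derivative D) (at (\<phi> q))"
  shows "((h \<circ> inv_into V \<psi>) has_derivative (\<lambda>v. D (frechet_derivative (\<phi> \<circ> inv_into V \<psi>) (at (\<psi> q)) v))) (at (\<psi> q))"
    and "jac V \<psi> h q = jac U \<phi> h q ** jac V \<psi> \<phi> q"
proof -
  define t where "t = frechet_derivative (\<phi> \<circ> inv_into V \<psi>) (at (\<psi> q))"
  have dt: "((\<phi> \<circ> inv_into V \<psi>) has_derivative t) (at (\<psi> q))"
    unfolding t_def by (rule transition_derivative[OF c(2,1,4,3)])
  have q: "(\<phi> \<circ> inv_into V \<psi>) (\<psi> q) = \<phi> q" using c inv_chart by simp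
  have "((h \<circ> inv_into U \<phi> \<circ> (\<phi> \<circ> inv_into V \<psi>)) has_derivative D \<circ> t) (at (\<psi> q))"
    by (rule diff_chain_at[OF dt]) (use h in \<open>simp only: q\<close>)
  then have d: "((h \<circ> inv_into V \<psi>) has_derivative D \<circ> t) (at (\<psi> q))"
    by (rule has_derivative_transform_within_open[OF _ open_overlap[OF c(2,1)]])
      (use c inv_chart in auto)
  then show "((h \<circ> inv_into V \<psi>) has_derivative (\<lambda>v. D (t v))) (at (\<psi> q))" by (simp add: o_def)
  have "jac V \<psi> h q = matrix (D \<circ> t)" using frechet_derivative_at[OF d] by (simp add: jac_def)
  also have "\<dots> = matrix D ** matrix t"
    by (rule matrix_compose[OF has_derivative_linear[OF dt] has_derivative_linear[OF h]])
  also have "matrix D = jac U \<phi> h q" using frechet_derivative_at[OF h] by (simp add: jac_def)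
  finally show "jac V \<psi> h q = jac U \<phi> h q ** jac V \<psi> \<phi> q" by (simp add: jac_def t_def)
qed

lemma jac_chart_self: "(U, \<phi>) \<in> A \<Longrightarrow> q \<in> U \<Longrightarrow> jac U \<phi> \<phi> q = mat 1"
proof -
  assume c: "(U, \<phi>) \<in> A" "q \<in> U"
  have "frechet_derivative (\<phi> \<circ> inv_into U \<phi>) (at (\<phi> q)) = id"
    using tvec_self[OF c] c by (simp add: tvec_def fun_eq_iff)
  then show ?thesis by (simp add: jac_def matrix_id_mat_1)
qed

lemma invertible_jac_transition:
  assumes c: "(U, \<phi>) \<in> A" "(V, \<psi>) \<in> A" "q \<in> U" "q \<in> V"
  shows "invertible (jac V \<psi> \<phi> q)"
proof -
  have "jac U \<phi> \<phi> q = jac V \<psi> \<phi> q ** jac U \<phi> \<psi> q"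
    by (rule jac_change(2)[OF c(2,1,4,3) transition_derivative[OF c(2,1,4,3)]])
  then show ?thesis using jac_chart_self[OF c(1,3)] invertible_right_inverse by metis
qed

text \<open>The coordinates are read from a representative picked by \<open>SOME\<close>. All
  representatives share value and chart derivative at q, so the choice does not matter.\<close>

lemma jet_coords_j1:
  fixes h :: "'a \<Rightarrow> real^'l"
  assumes c: "(U, \<phi>) \<in> A" "q \<in> U" and h: "Cr_near r A h q"
  shows "jet_coords (U, \<phi>) (j1 r A h q) = (\<phi> q, h q, jac U \<phi> h q)"
proof -
  define G where "G = snd (j1 r A h q)"
  have "h \<in> G" using h by (simp add: G_def j1_def)
  then have "(SOME g. g \<in> G) \<in> G" by (rule someI[of "\<lambda>g. g \<in> G"])
  then have "(SOME g. g \<in> G) q = h q"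
    "frechet_derivative ((SOME g. g \<in> G) \<circ> inv_into U \<phi>) (at (\<phi> q)) = frechet_derivative (h \<circ> inv_into U \<phi>) (at (\<phi> q))"
    using c by (auto simp: G_def j1_def)
  moreover have "j1 r A h q = (q, G)" by (simp add: G_def j1_def)
  ultimately show ?thesis by (simp add: jet_coords_def jac_def)
qed

lemma fst_j1 [simp]: "fst (j1 r A h q) = q" by (simp add: j1_def)

lemma J1E:
  assumes "j \<in> (J1 r A :: ('a, 'l::finite) jet set)"
  obtains h q where "j = j1 r A h q" "q \<in> points A" "Cr_near r A h q"
  using assms unfolding J1_def by blast

lemma j1_in_J1: "(U, \<phi>) \<in> A \<Longrightarrow> q \<in> U \<Longrightarrow> Cr_near r A h q \<Longrightarrow> j1 r A h q \<in> J1 r A"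
  unfolding J1_def points_def by blast

text \<open>Jets compare derivatives in all charts; by the chain rule agreement in one chart
  suffices.\<close>

lemma j1_eqI:
  fixes h h' :: "'a \<Rightarrow> real^'l"
  assumes c: "(U, \<phi>) \<in> A" "q \<in> U" and h: "Cr_near r A h q" "Cr_near r A h' q"
    and eq: "h q = h' q" "jac U \<phi> h q = jac U \<phi> h' q"
  shows "j1 r A h q = j1 r A h' q"
proof -
  have "frechet_derivative (h \<circ> inv_into V \<psi>) (at (\<psi> q)) = frechet_derivative (h' \<circ> inv_into V \<psi>) (at (\<psi> q))"
    if V: "(V, \<psi>) \<in> A" "q \<in> V" for V \<psi>
  proof -
    note d = Cr_near_derivative[OF h(1) c] Cr_near_derivative[OF h(2) c]
    have "jac V \<psi> h q = jac V \<psi> h' q"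
      using jac_change(2)[OF c(1) V(1) c(2) V(2) d(1)] jac_change(2)[OF c(1) V(1) c(2) V(2) d(2)] eq(2) by simp
    then show ?thesis
      using jac_works[OF Cr_near_derivative[OF h(1) V]] jac_works[OF Cr_near_derivative[OF h(2) V]] by simp
  qed
  then show ?thesis using eq(1) unfolding j1_def by auto
qed

text \<open>Every coordinate triple is attained, by a map that is affine in the chart.\<close>

lemma affine_jet:
  fixes M :: "real^'n^'l" and y :: "real^'l"
  assumes c: "(U, \<phi>) \<in> A" "q \<in> U"
  defines "h \<equiv> \<lambda>p. y + M *v (\<phi> p - \<phi> q)"
  shows "Cr_near r A h q" "h q = y" "jac U \<phi> h q = M"
proof -
  have o: "open (\<phi> ` U)" "\<phi> q \<in> \<phi> ` U" using open_chart[OF c(1)] c(2) by auto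
  have eq: "(h \<circ> inv_into U \<phi>) x = y + M *v (x - \<phi> q)" if "x \<in> \<phi> ` U" for x
    using that by (auto simp: h_def inv_chart[OF c(1)])
  have "Cr_on r (\<phi> ` U) (\<lambda>x. y + M *v (x - \<phi> q))"
    unfolding Cr_on_def
    by (intro allI impI Cn_on_add Cn_on_const o(1) Cn_on_linear_compose[OF matrix_vector_mul_linear] Cn_on_diff Cn_on_id)
  then have "Cr_on r (\<phi> ` U) (h \<circ> inv_into U \<phi>)" by (rule Cr_on_cong[OF o(1)]) (rule eq[symmetric])
  then show "Cr_near r A h q" unfolding Cr_near_def using c o by blast
  show "h q = y" by (simp add: h_def)
  have "((\<lambda>x. y + M *v (x - \<phi> q)) has_derivative (\<lambda>v. 0 + M *v (v - 0))) (at (\<phi> q))"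
    by (intro has_derivative_add has_derivative_const bounded_linear.has_derivative[OF matrix_vector_mul_bounded_linear]
        has_derivative_diff has_derivative_ident)
  then have "((h \<circ> inv_into U \<phi>) has_derivative (\<lambda>v. 0 + M *v (v - 0))) (at (\<phi> q))"
    by (rule has_derivative_transform_within_open[OF _ o]) (rule eq[symmetric])
  from jac_works[OF this] show "jac U \<phi> h q = M" by (simp add: fun_eq_iff matrix_eq)
qed

definition jdom :: "'a set \<Rightarrow> ('a, 'l::finite) jet set" where
  "jdom U = {j \<in> J1 r A. fst j \<in> U}"

lemma jet_atlas_iff: "c \<in> jet_atlas r A \<longleftrightarrow> (\<exists>U \<phi>. (U, \<phi>) \<in> A \<and> c = (jdom U, jet_coords (U, \<phi>)))"
  unfolding jet_atlas_def jdom_def by force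

text \<open>The inverse of the chart \<open>jet_coords (U, \<phi>)\<close>, written with an affine
  representative.\<close>

definition jet_at :: "'a set \<Rightarrow> ('a \<Rightarrow> real^'n) \<Rightarrow> real^'n \<Rightarrow> real^'l \<Rightarrow> real^'n^'l \<Rightarrow> ('a, 'l::finite) jet" where
  "jet_at U \<phi> x y M = (let q = inv_into U \<phi> x in j1 r A (\<lambda>p. y + M *v (\<phi> p - \<phi> q)) q)"

lemma jet_at:
  fixes M :: "real^'n^'l"
  assumes c: "(U, \<phi>) \<in> A" and x: "x \<in> \<phi> ` U"
  shows "jet_at U \<phi> x y M \<in> jdom U" "fst (jet_at U \<phi> x y M) = inv_into U \<phi> x"
    "jet_coords (U, \<phi>) (jet_at U \<phi> x y M) = (x, y, M)"
proof -
  define q where "q = inv_into U \<phi> x"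
  have q: "q \<in> U" "\<phi> q = x" using x by (auto simp: q_def inv_into_into f_inv_into_f)
  note a = affine_jet[OF c q(1), of y M]
  show "fst (jet_at U \<phi> x y M) = inv_into U \<phi> x" by (simp add: jet_at_def Let_def)
  then show "jet_at U \<phi> x y M \<in> jdom U"
    using j1_in_J1[OF c q(1) a(1)] q(1) by (simp add: jdom_def jet_at_def Let_def q_def)
  show "jet_coords (U, \<phi>) (jet_at U \<phi> x y M) = (x, y, M)"
    using jet_coords_j1[OF c q(1) a(1)] a(2,3) q(2) by (simp add: jet_at_def Let_def q_def)
qed

lemma inj_jet_coords:
  assumes c: "(U, \<phi>) \<in> A"
  shows "inj_on (jet_coords (U, \<phi>)) (jdom U :: ('a, 'l::finite) jet set)"
proof (rule inj_onI)
  fix j j' :: "('a, 'l) jet" assume j: "j \<in> jdom U" "j' \<in> jdom U" and eq: "jet_coords (U, \<phi>) j = jet_coords (U, \<phi>) j'"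
  obtain h q where h: "j = j1 r A h q" "Cr_near r A h q" using j(1) by (auto simp: jdom_def elim: J1E)
  obtain h' q' where h': "j' = j1 r A h' q'" "Cr_near r A h' q'" using j(2) by (auto simp: jdom_def elim: J1E)
  have q: "q \<in> U" "q' \<in> U" using j h(1) h'(1) by (auto simp: jdom_def)
  have e: "\<phi> q = \<phi> q'" "h q = h' q'" "jac U \<phi> h q = jac U \<phi> h' q'"
    using eq unfolding h(1) h'(1) jet_coords_j1[OF c q(1) h(2)] jet_coords_j1[OF c q(2) h'(2)] by auto
  have "q = q'" using inj_onD[OF inj_chart[OF c] e(1)] q by simp
  then show "j = j'" unfolding h(1) h'(1) using j1_eqI[OF c q(1) h(2)] h'(2) e by simp
qed

lemma jet_coords_fst:
  assumes c: "(U, \<phi>) \<in> A" and j: "j \<in> (jdom U :: ('a, 'l::finite) jet set)"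
  obtains y M where "jet_coords (U, \<phi>) j = (\<phi> (fst j), y, M)"
proof -
  obtain h q where h: "j = j1 r A h q" "Cr_near r A h q" using j by (auto simp: jdom_def elim: J1E)
  have "q \<in> U" using j h(1) by (simp add: jdom_def)
  then have "jet_coords (U, \<phi>) j = (\<phi> (fst j), h q, jac U \<phi> h q)"
    using jet_coords_j1[OF c _ h(2)] by (simp add: h(1))
  then show thesis by (rule that)
qed

lemma jet_coords_image:
  assumes c: "(U, \<phi>) \<in> A" and V: "V \<subseteq> U"
  shows "jet_coords (U, \<phi>) ` (jdom V :: ('a, 'l::finite) jet set) = \<phi> ` V \<times> UNIV \<times> UNIV"
proof (intro equalityI subsetI)
  fix p assume "p \<in> jet_coords (U, \<phi>) ` (jdom V :: ('a, 'l) jet set)"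
  then obtain j where j: "j \<in> jdom V" "p = jet_coords (U, \<phi>) j" by blast
  have "j \<in> jdom U" using j(1) V by (auto simp: jdom_def)
  then obtain y M where "jet_coords (U, \<phi>) j = (\<phi> (fst j), y, M)" by (rule jet_coords_fst[OF c])
  then show "p \<in> \<phi> ` V \<times> UNIV \<times> UNIV" using j by (auto simp: jdom_def)
next
  fix p :: "(real^'n) \<times> (real^'l) \<times> (real^'n^'l)" assume "p \<in> \<phi> ` V \<times> UNIV \<times> UNIV"
  then obtain q y M where p: "q \<in> V" "p = (\<phi> q, y, M)" by auto
  have "jet_at U \<phi> (\<phi> q) y M \<in> jdom V"
    using jet_at[OF c, of "\<phi> q" y M] p V inv_chart[OF c, of q] by (auto simp: jdom_def)
  then show "p \<in> jet_coords (U, \<phi>) ` (jdom V :: ('a, 'l) jet set)"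
    using jet_at(3)[OF c, of "\<phi> q" y M] p V by (metis image_eqI imageI subsetD)
qed

lemma inv_jet_coords:
  assumes c: "(U, \<phi>) \<in> A" and x: "x \<in> \<phi> ` U"
  shows "inv_into (jdom U) (jet_coords (U, \<phi>)) (x, y, M) = (jet_at U \<phi> x y M :: ('a, 'l::finite) jet)"
  by (rule inv_into_f_eq[OF inj_jet_coords[OF c]]) (use jet_at[OF c x] in auto)

lemma jet_coords_jet_at:
  fixes M :: "real^'n^'l"
  assumes c: "(U, \<phi>) \<in> A" "(V, \<psi>) \<in> A" and q: "q \<in> U \<inter> V"
  shows "jet_coords (V, \<psi>) (jet_at U \<phi> (\<phi> q) y M) = (\<psi> q, y, M ** jac V \<psi> \<phi> q)"
proof -
  have qU: "q \<in> U" "q \<in> V" using q by auto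
  note a = affine_jet[OF c(1) qU(1), of y M]
  have "jac V \<psi> (\<lambda>p. y + M *v (\<phi> p - \<phi> q)) q = M ** jac V \<psi> \<phi> q"
    using jac_change(2)[OF c qU Cr_near_derivative[OF a(1) c(1) qU(1)]] a(3) by simp
  then show ?thesis
    using jet_coords_j1[OF c(2) qU(2) a(1)] a(2) by (simp add: jet_at_def inv_chart[OF c(1) qU(1)] Let_def)
qed

text \<open>The matrix component is multiplied by the Jacobian of the inverse transition map, which
  has one order of differentiability less; this is the origin of r - 1.\<close>

lemma jet_transition:
  assumes c: "(U, \<phi>) \<in> A" "(V, \<psi>) \<in> A"
  shows "Cr_on (r - 1) (\<phi> ` (U \<inter> V) \<times> UNIV \<times> UNIV)
    (jet_coords (V, \<psi>) \<circ> inv_into (jdom U :: ('a, 'l::finite) jet set) (jet_coords (U, \<phi>)))"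
proof -
  let ?O = "\<phi> ` (U \<inter> V) \<times> (UNIV :: (real^'l) set) \<times> (UNIV :: (real^'n^'l) set)"
  have o: "open (\<phi> ` (U \<inter> V))" "open (\<psi> ` (V \<inter> U))" by (rule open_overlap[OF c]) (rule open_overlap[OF c(2,1)])
  have oO: "open ?O" using o by (simp add: open_Times)
  define \<tau> where "\<tau> = \<psi> \<circ> inv_into U \<phi>"
  define \<Lambda> where "\<Lambda> = (\<lambda>u. matrix (frechet_derivative (\<phi> \<circ> inv_into V \<psi>) (at u)))"
  have "Cr_on (r - 1) ?O (\<lambda>p. (\<tau> (fst p), fst (snd p), snd (snd p) ** \<Lambda> (\<tau> (fst p))))"
    unfolding Cr_on_def
  proof (intro allI impI)
    fix n assume n: "enat n \<le> r - 1"
    have \<tau>: "Cn_on n (\<phi> ` (U \<inter> V)) \<tau>" unfolding \<tau>_def by (rule Cr_on_CnD[OF Cr_transition[OF c] r1_le[OF n]])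
    have "Cn_on (Suc n) (\<psi> ` (V \<inter> U)) (\<phi> \<circ> inv_into V \<psi>)" by (rule Cr_on_CnD[OF Cr_transition[OF c(2,1)] Suc_le_r[OF n]])
    then have "Cn_on n (\<psi> ` (V \<inter> U)) \<Lambda>" unfolding \<Lambda>_def by (rule Cn_on_jacobian[OF o(2)])
    then have \<Lambda>\<tau>: "Cn_on n (\<phi> ` (U \<inter> V)) (\<lambda>x. \<Lambda> (\<tau> x))"
      by (rule Cn_on_compose[OF o \<tau>]) (auto simp: \<tau>_def inv_chart[OF c(1)])
    have f: "Cn_on n ?O (\<lambda>p. g (fst p))" if "Cn_on n (\<phi> ` (U \<inter> V)) g" for g :: "real^'n \<Rightarrow> 'z::euclidean_space"
      by (rule Cn_on_compose[OF oO o(1) Cn_on_fst[OF oO Cn_on_id[OF oO]] that]) auto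
    show "Cn_on n ?O (\<lambda>p. (\<tau> (fst p), fst (snd p), snd (snd p) ** \<Lambda> (\<tau> (fst p))))"
      by (intro Cn_on_Pair Cn_on_matrix_mult oO f \<tau> \<Lambda>\<tau> Cn_on_fst Cn_on_snd Cn_on_id)
  qed
  then show ?thesis
  proof (rule Cr_on_cong[OF oO])
    fix p assume "p \<in> ?O"
    then obtain q y M where p: "q \<in> U \<inter> V" "p = (\<phi> q, y, M)" by auto
    have "\<tau> (\<phi> q) = \<psi> q" using p(1) by (simp add: \<tau>_def inv_chart[OF c(1)])
    then show "(\<tau> (fst p), fst (snd p), snd (snd p) ** \<Lambda> (\<tau> (fst p))) =
       (jet_coords (V, \<psi>) \<circ> inv_into (jdom U :: ('a, 'l) jet set) (jet_coords (U, \<phi>))) p"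
      using p inv_jet_coords[OF c(1), of "\<phi> q" y M] jet_coords_jet_at[OF c p(1), of y M]
      by (simp add: \<Lambda>_def jac_def)
  qed
qed

lemma jdom_Int: "jdom U \<inter> jdom V = jdom (U \<inter> V)" by (auto simp: jdom_def)

lemma jet_atlas_Cr: "Cr_atlas (r - 1) (jet_atlas r A :: (('a, 'l::finite) jet, _) chart set)"
  unfolding Cr_atlas_def
proof (intro conjI ballI)
  fix c :: "(('a, 'l) jet, _) chart" assume "c \<in> jet_atlas r A"
  then obtain U \<phi> where U: "(U, \<phi>) \<in> A" "c = (jdom U, jet_coords (U, \<phi>))" by (auto simp: jet_atlas_iff)
  show "is_chart c" unfolding U(2) is_chart_def split jet_coords_image[OF U(1) subset_refl]
    by (intro conjI inj_jet_coords U(1) open_Times open_chart open_UNIV)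
  fix d :: "(('a, 'l) jet, _) chart" assume "d \<in> jet_atlas r A"
  then obtain V \<psi> where V: "(V, \<psi>) \<in> A" "d = (jdom V, jet_coords (V, \<psi>))" by (auto simp: jet_atlas_iff)
  show "compatible (r - 1) c d"
    unfolding U(2) V(2) compatible_def split jdom_Int jet_coords_image[OF U(1) Int_lower1] jet_coords_image[OF V(1) Int_lower2]
    using jet_transition[OF U(1) V(1), where ?'l = 'l] jet_transition[OF V(1) U(1), where ?'l = 'l]
      open_overlap[OF U(1) V(1)] open_overlap[OF V(1) U(1)]
    by (intro conjI open_Times open_UNIV) (simp_all only: Int_commute)
qed

lemma atlas_jets: "atlas (r - 1) (jet_atlas r A :: (('a, 'l::finite) jet, _) chart set)"
  by (rule atlas.intro[OF jet_atlas_Cr one_le_r1])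

text \<open>\<open>Sigma_jets\<close> asks for some chart. Jacobians in two charts differ by an
  invertible factor, so the rank is the same in all of them.\<close>

lemma Sigma_jets_iff:
  assumes c: "(U, \<phi>) \<in> A" and j: "j \<in> (jdom U :: ('a, 'l::finite) jet set)"
  shows "j \<in> Sigma_jets r A k \<longleftrightarrow> corank (snd (snd (jet_coords (U, \<phi>) j))) = k"
proof -
  obtain h q where h: "j = j1 r A h q" "Cr_near r A h q" using j by (auto simp: jdom_def elim: J1E)
  have q: "q \<in> U" using j h(1) by (simp add: jdom_def)
  have "corank (jac V \<psi> h q) = corank (jac U \<phi> h q)" if V: "(V, \<psi>) \<in> A" "q \<in> V" for V \<psi>
    using jac_change(2)[OF c V(1) q V(2) Cr_near_derivative[OF h(2) c q]]
    by (simp add: corank_def rank_mult_invertible_right[OF invertible_jac_transition[OF c V(1) q V(2)]])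
  then have eq: "corank (snd (snd (jet_coords (V, \<psi>) j))) = corank (snd (snd (jet_coords (U, \<phi>) j)))"
    if "(V, \<psi>) \<in> A" "q \<in> V" for V \<psi>
    using that jet_coords_j1[OF that h(2)] jet_coords_j1[OF c q h(2)] by (simp add: h(1))
  have jq: "fst j = q" "j \<in> J1 r A" using j h(1) by (auto simp: jdom_def)
  show ?thesis
  proof
    assume "j \<in> Sigma_jets r A k"
    then obtain c' where c': "c' \<in> A" "fst j \<in> fst c'" "corank (snd (snd (jet_coords c' j))) = k"
      unfolding Sigma_jets_def by blast
    obtain V \<psi> where "c' = (V, \<psi>)" by (cases c')
    then show "corank (snd (snd (jet_coords (U, \<phi>) j))) = k" using eq[of V \<psi>] c' jq(1) by simp
  next
    assume k: "corank (snd (snd (jet_coords (U, \<phi>) j))) = k"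
    have "fst j \<in> fst (U, \<phi>)" using q jq(1) by simp
    then show "j \<in> Sigma_jets r A k" unfolding Sigma_jets_def using c jq(2) k by blast
  qed
qed

end

section \<open>The corank strata and the transversality of jet extensions\<close>

lemma invertible_mat_1: "invertible (mat 1 :: real^'n^'n)"
  unfolding invertible_def by (rule exI[of _ "mat 1"]) simp

lemma open_invertible_affine: "open {t. invertible (mat 1 + t *\<^sub>R (X :: real^'n^'n))}"
  using open_invertible[of UNIV "\<lambda>t::real. mat 1 + t *\<^sub>R X"] by (simp add: continuous_intros)

lemma corank_eq_iff:
  fixes M :: "real^'n^'l"
  assumes "k \<le> min CARD('n) CARD('l)"
  shows "corank M = k \<longleftrightarrow> rank M = min CARD('n) CARD('l) - k"
  using rank_bound[of M] assms by (auto simp: corank_def)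

lemma dim_schur_slice:
  fixes W :: "(real^'n^'l) set"
  assumes W: "W \<subseteq> Basis"
  shows "dim {p :: (real^'n) \<times> (real^'l) \<times> (real^'n^'l). \<forall>e\<in>W. snd (snd p) \<bullet> e = 0} + card W
    = DIM((real^'n) \<times> (real^'l) \<times> (real^'n^'l))"
proof -
  let ?i = "\<lambda>e. (0, 0, e) :: (real^'n) \<times> (real^'l) \<times> (real^'n^'l)"
  define d where "d = Basis - ?i ` W"
  have iW: "?i ` W \<subseteq> Basis" using W by (auto simp: Basis_prod_def)
  have "{p. \<forall>e\<in>W. snd (snd p) \<bullet> e = 0} = {p. \<forall>i\<in>Basis. i \<notin> d \<longrightarrow> p \<bullet> i = 0}"
  proof -
    have "i \<in> Basis \<and> i \<notin> d \<longleftrightarrow> i \<in> ?i ` W" for i using iW by (auto simp: d_def)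
    then have "(\<forall>i\<in>Basis. i \<notin> d \<longrightarrow> p \<bullet> i = 0) \<longleftrightarrow> (\<forall>i\<in>?i ` W. p \<bullet> i = 0)" for p by blast
    then show ?thesis by (simp add: inner_prod_def)
  qed
  then have "dim {p :: (real^'n) \<times> (real^'l) \<times> (real^'n^'l). \<forall>e\<in>W. snd (snd p) \<bullet> e = 0} = card d"
    using dim_substandard[of d] by (simp add: d_def)
  moreover have "card (?i ` W) = card W" by (intro card_image) (auto simp: inj_on_def)
  moreover have "card d + card (?i ` W) = card (Basis :: ((real^'n) \<times> (real^'l) \<times> (real^'n^'l)) set)"
    unfolding d_def card_Diff_subset[OF finite_subset[OF iW finite_Basis] iW]
    using card_mono[OF finite_Basis iW] by (rule le_add_diff_inverse2)
  ultimately show ?thesis by simp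
qed

context jet_base
begin

text \<open>The slice chart keeps all entries of the matrix except for the block d, which it
  replaces by the Schur complement d - c a^-1 b. This change of coordinates is triangular, hence
  invertible by adding c a^-1 b back, and rank card J means that the new block vanishes.\<close>

lemma Sigma_submanifold:
  assumes k: "k \<le> min CARD('n) CARD('l)"
  defines "\<rho> \<equiv> min CARD('n) CARD('l) - k"
  shows "submanifold (r - 1) (jet_atlas r A) (Sigma_jets r A k :: ('a, 'l::finite) jet set)
     ((CARD('l) - \<rho>) * (CARD('n) - \<rho>))"
proof -
  let ?Z = "Sigma_jets r A k :: ('a, 'l) jet set"
  interpret J: atlas "r - 1" "jet_atlas r A :: (('a, 'l) jet, _) chart set" by (rule atlas_jets)
  have chart: "\<exists>U \<phi>. (U, \<phi>) \<in> A \<and> z \<in> jdom U" if zZ: "z \<in> ?Z" for z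
  proof -
    obtain c where c: "c \<in> A" "fst z \<in> fst c" "z \<in> J1 r A" using zZ unfolding Sigma_jets_def by blast
    obtain U \<phi> where "c = (U, \<phi>)" by (cases c)
    then show ?thesis using c by (auto simp: jdom_def)
  qed
  show ?thesis unfolding submanifold_def
  proof (intro conjI ballI)
    show "?Z \<subseteq> points (jet_atlas r A)"
    proof
      fix z assume "z \<in> ?Z"
      then obtain U \<phi> where U: "(U, \<phi>) \<in> A" "z \<in> jdom U" using chart by blast
      then have "(jdom U, jet_coords (U, \<phi>)) \<in> (jet_atlas r A :: (('a, 'l) jet, _) chart set)" by (auto simp: jet_atlas_iff)
      then show "z \<in> points (jet_atlas r A)" using U(2) unfolding points_def by blast
    qed
    fix z assume z: "z \<in> ?Z"
    obtain U \<phi> where U: "(U, \<phi>) \<in> A" and zU: "z \<in> jdom U" using chart[OF z] by blast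
    have cJ: "(jdom U, jet_coords (U, \<phi>)) \<in> (jet_atlas r A :: (('a, 'l) jet, _) chart set)" using U by (auto simp: jet_atlas_iff)
    define M0 where "M0 = snd (snd (jet_coords (U, \<phi>) z))"
    have "rank M0 = \<rho>" using Sigma_jets_iff[OF U zU, of k] z corank_eq_iff[OF k] by (simp add: M0_def \<rho>_def)
    obtain J and \<sigma> :: "'n \<Rightarrow> 'l" where J: "card J = rank M0" "inj_on \<sigma> J" "invertible (minor_aug J \<sigma> M0)"
      by (rule minor_exists[of M0])
    have cardJ: "card J = \<rho>" using J(1) \<open>rank M0 = \<rho>\<close> by simp
    define W where "W = (schur_basis J \<sigma> :: (real^'n^'l) set)"
    have WB: "W \<subseteq> Basis" unfolding W_def by (rule schur_basis_subset)
    define R where "R = \<phi> ` U \<times> (UNIV :: (real^'l) set) \<times> (UNIV :: (real^'n^'l) set)"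
    have oR: "open R" unfolding R_def by (intro open_Times open_chart[OF U] open_UNIV)
    define S where "S = {p \<in> R. invertible (minor_aug J \<sigma> (snd (snd p)))}"
    have CM: "Cn_on n T (\<lambda>p. snd (snd p))" if "open T" for n and T :: "((real^'n) \<times> (real^'l) \<times> (real^'n^'l)) set"
      using that by (intro Cn_on_snd Cn_on_id)
    have oS: "open S"
      unfolding S_def
    proof (rule open_invertible[OF oR], rule Cn_on_continuous)
      show "Cn_on 0 R (\<lambda>p. minor_aug J \<sigma> (snd (snd p)))"
        unfolding minor_aug_def by (intro Cn_on_add Cn_on_matrix_mult oR CM Cn_on_const)
    qed
    \<comment> \<open>The product has c a^-1 b in the block d; the projection retains this block
      alone, so that the remaining entries of M stay coordinates.\<close>
    define Q where "Q = (\<lambda>M. coord_proj W (M ** minor_inv J \<sigma> M ** M))"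
    have QW: "Q M \<in> span W" "- Q M \<in> span W" for M using coord_proj_in_span by (auto simp: Q_def intro: span_neg)
    \<comment> \<open>Q does not depend on the block d, the only one that subtracting Q changes;
      hence subtracting and adding Q are inverse to each other.\<close>
    have Qt: "Q (M + w) = Q M" if "w \<in> span W" for M w
      using quad_translate[of w J \<sigma> M] that by (simp add: Q_def W_def)
    have Qt': "Q (M - Q M) = Q M" "Q (M + Q M) = Q M" for M using Qt[OF QW(2), of M M] Qt[OF QW(1), of M M] by auto
    have at: "minor_aug J \<sigma> (M - Q M) = minor_aug J \<sigma> M" "minor_aug J \<sigma> (M + Q M) = minor_aug J \<sigma> M" for M
      using minor_aug_translate[of "- Q M" J \<sigma> M] minor_aug_translate[of "Q M" J \<sigma> M] QW by (auto simp: W_def)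
    define \<Psi> where "\<Psi> = (\<lambda>p :: (real^'n) \<times> (real^'l) \<times> (real^'n^'l). (fst p, fst (snd p), snd (snd p) - Q (snd (snd p))))"
    define \<Phi> where "\<Phi> = (\<lambda>p :: (real^'n) \<times> (real^'l) \<times> (real^'n^'l). (fst p, fst (snd p), snd (snd p) + Q (snd (snd p))))"
    have CQ: "Cn_on n S (\<lambda>p. Q (snd (snd p)))" for n
      unfolding Q_def
      by (intro Cn_on_linear_compose[OF linear_coord_proj] Cn_on_matrix_mult oS CM Cn_on_minor_inv) (auto simp: S_def)
    have C\<Psi>: "Cr_on (r - 1) S \<Psi>" "Cr_on (r - 1) S \<Phi>" unfolding Cr_on_def \<Psi>_def \<Phi>_def
      by (intro allI impI Cn_on_Pair Cn_on_fst Cn_on_snd Cn_on_id Cn_on_diff Cn_on_add CQ oS)+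
    define V where "V = {j \<in> jdom U. jet_coords (U, \<phi>) j \<in> S}"
    define \<psi> where "\<psi> = (\<lambda>j. \<Psi> (jet_coords (U, \<phi>) j))"
    have max: "(V, \<psi>) \<in> maximal_atlas (r - 1) (jet_atlas r A)"
      unfolding V_def \<psi>_def
    proof (rule J.maximal_atlas_compose[OF cJ oS _ oS C\<Psi>(1) _ C\<Psi>(2)])
      show "S \<subseteq> jet_coords (U, \<phi>) ` jdom U" unfolding jet_coords_image[OF U subset_refl] S_def R_def by auto
    qed (auto simp: S_def R_def \<Psi>_def \<Phi>_def at Qt')
    define L where "L = {p :: (real^'n) \<times> (real^'l) \<times> (real^'n^'l). \<forall>e\<in>W. snd (snd p) \<bullet> e = 0}"
    have subL: "subspace L" by (auto simp: L_def subspace_def inner_add_left)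
    have dimL: "dim L + (CARD('l) - \<rho>) * (CARD('n) - \<rho>) = DIM((real^'n) \<times> (real^'l) \<times> (real^'n^'l))"
      using dim_schur_slice[OF WB] card_schur_basis[OF J(2)] by (simp add: L_def W_def cardJ)
    have mem: "j \<in> ?Z \<longleftrightarrow> \<psi> j \<in> L" if j: "j \<in> V" for j
    proof -
      define M where "M = snd (snd (jet_coords (U, \<phi>) j))"
      have jU: "j \<in> jdom U" and "invertible (minor_aug J \<sigma> M)" using j by (auto simp: V_def S_def M_def)
      then interpret minor J \<sigma> M by unfold_locales
      have "j \<in> ?Z \<longleftrightarrow> rank M = card J"
        using Sigma_jets_iff[OF U jU, of k] corank_eq_iff[OF k] by (simp add: M_def cardJ \<rho>_def)
      also have "\<dots> \<longleftrightarrow> (\<forall>e\<in>W. schur J \<sigma> M \<bullet> e = 0)" unfolding rank_eq_iff schur_eq_0_iff W_def ..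
      also have "\<dots> \<longleftrightarrow> (\<forall>e\<in>W. (M - Q M) \<bullet> e = 0)"
        using coord_proj_inner[OF WB] WB by (auto simp: schur_def Q_def inner_diff_left subset_iff)
      also have "\<dots> \<longleftrightarrow> \<psi> j \<in> L" by (simp add: L_def \<psi>_def \<Psi>_def M_def)
      finally show ?thesis .
    qed
    have "jet_coords (U, \<phi>) z \<in> R"
      unfolding R_def jet_coords_image[OF U subset_refl, symmetric] using zU by (rule imageI)
    then have zV: "z \<in> V" using J(3) zU by (simp add: V_def S_def M0_def)
    have "\<psi> ` (V \<inter> ?Z) = \<psi> ` V \<inter> L" using mem by blast
    then show "\<exists>(V, \<psi>)\<in>maximal_atlas (r - 1) (jet_atlas r A). z \<in> V \<and>
        (\<exists>L. subspace L \<and> dim L + (CARD('l) - \<rho>) * (CARD('n) - \<rho>) = DIM((real^'n) \<times> (real^'l) \<times> (real^'n^'l)) \<and>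
           \<psi> ` (V \<inter> ?Z) = \<psi> ` V \<inter> L)"
      using max zV subL dimL by blast
  qed
qed

text \<open>The stratum restricts only the matrix component. The source and target components of
  \<zeta> are therefore corrected freely by \<eta>, and \<open>rank_transverse\<close> splits the
  matrix component into a derivative of the Jacobian and a direction X M + M Y. The latter is
  realized by a curve of jets in the stratum.\<close>

lemma jets_transverse:
  fixes G :: "'a \<Rightarrow> real^'l"
  assumes k: "k \<le> min CARD('n) CARD('l)" and G: "Cr_map r A G"
    and crit: "\<And>q. q \<in> points A \<Longrightarrow> \<exists>U \<phi>. (U, \<phi>) \<in> A \<and> q \<in> U \<and>
      (rank (jac U \<phi> G q) = min CARD('n) CARD('l) - k \<longrightarrow>
       rank_transverse (jac U \<phi> G q) (frechet_derivative (\<lambda>x. matrix (frechet_derivative (G \<circ> inv_into U \<phi>) (at x))) (at (\<phi> q))))"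
  shows "transverse A (jet_atlas r A) (j1 r A G) (Sigma_jets r A k)"
proof (rule transverseI[OF atlas_axioms atlas_jets])
  interpret J: atlas "r - 1" "jet_atlas r A :: (('a, 'l) jet, _) chart set" by (rule atlas_jets)
  fix q assume q: "q \<in> points A" "j1 r A G q \<in> Sigma_jets r A k"
  obtain U \<phi> where c: "(U, \<phi>) \<in> A" "q \<in> U" and tr: "rank (jac U \<phi> G q) = min CARD('n) CARD('l) - k \<longrightarrow>
       rank_transverse (jac U \<phi> G q) (frechet_derivative (\<lambda>x. matrix (frechet_derivative (G \<circ> inv_into U \<phi>) (at x))) (at (\<phi> q)))"
    using crit[OF q(1)] by blast
  have o: "open (\<phi> ` U)" by (rule open_chart[OF c(1)])
  have Gr: "Cr_on r (\<phi> ` U) (G \<circ> inv_into U \<phi>)" using G c(1) unfolding Cr_map_def by fast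
  have near: "Cr_near r A G p" if "p \<in> U" for p
    unfolding Cr_near_def using c(1) that o Gr by blast
  have dom: "j1 r A G p \<in> jdom U" if "p \<in> U" for p
    using j1_in_J1[OF c(1) that near[OF that]] that by (simp add: jdom_def)
  define g where "g = G \<circ> inv_into U \<phi>"
  have g2: "Cn_on (Suc 1) (\<phi> ` U) g" unfolding g_def by (rule Cr_on_CnD[OF Gr]) (use r in \<open>simp add: numeral_eq_enat numeral_2_eq_2\<close>)
  have g1: "Cn_on 1 (\<phi> ` U) g" by (rule Cn_on_SucD[OF g2])
  define m where "m = (\<lambda>x. matrix (frechet_derivative g (at x)))"
  have m1: "Cn_on 1 (\<phi> ` U) m" unfolding m_def by (rule Cn_on_jacobian[OF o g2])
  let ?\<theta> = "jet_coords (U, \<phi>)"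
  have \<theta>: "(?\<theta> \<circ> j1 r A G \<circ> inv_into U \<phi>) x = (x, g x, m x)" if "x \<in> \<phi> ` U" for x
    using that jet_coords_j1[OF c(1) _ near] inv_chart[OF c(1)] by (auto simp: g_def m_def jac_def)
  have "Cn_on 1 (\<phi> ` U) (\<lambda>x. (x, g x, m x))" by (intro Cn_on_Pair Cn_on_id o g1 m1)
  then have C1: "Cn_on 1 (\<phi> ` U) (?\<theta> \<circ> j1 r A G \<circ> inv_into U \<phi>)" by (rule Cn_on_cong[OF o]) (rule \<theta>[symmetric])
  have x: "\<phi> q \<in> \<phi> ` U" using c(2) by blast
  define g' where "g' = frechet_derivative g (at (\<phi> q))"
  define m' where "m' = frechet_derivative m (at (\<phi> q))"
  have dg: "(g has_derivative g') (at (\<phi> q))" unfolding g'_def using Cn_on_has_derivative[OF g1 _ x] by simp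
  have dm: "(m has_derivative m') (at (\<phi> q))" unfolding m'_def using Cn_on_has_derivative[OF m1 _ x] by simp
  have "((\<lambda>x. (x, g x, m x)) has_derivative (\<lambda>v. (v, g' v, m' v))) (at (\<phi> q))"
    by (intro has_derivative_Pair has_derivative_ident dg dm)
  then have "((?\<theta> \<circ> j1 r A G \<circ> inv_into U \<phi>) has_derivative (\<lambda>v. (v, g' v, m' v))) (at (\<phi> q))"
    by (rule has_derivative_transform_within_open[OF _ o x]) (rule \<theta>[symmetric])
  from frechet_derivative_at[OF this]
  have D: "frechet_derivative (?\<theta> \<circ> j1 r A G \<circ> inv_into U \<phi>) (at (\<phi> q)) = (\<lambda>v. (v, g' v, m' v))" by simp
  define M where "M = jac U \<phi> G q"
  have z: "?\<theta> (j1 r A G q) = (\<phi> q, G q, M)" unfolding M_def by (rule jet_coords_j1[OF c near[OF c(2)]])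
  have rM: "rank M = min CARD('n) CARD('l) - k"
    using Sigma_jets_iff[OF c(1) dom[OF c(2)], of k] q(2) corank_eq_iff[OF k] by (simp add: z)
  have rt: "rank_transverse M m'" using tr rM by (simp add: M_def m'_def m_def g_def)
  have cJ: "(jdom U, ?\<theta>) \<in> (jet_atlas r A :: (('a, 'l) jet, _) chart set)" using c(1) by (auto simp: jet_atlas_iff)
  have "\<exists>v \<eta>. \<zeta> = (v, g' v, m' v) + \<eta> \<and> J.tvec (jdom U) ?\<theta> (j1 r A G q) \<eta> \<in> tangent_space (jet_atlas r A) (Sigma_jets r A k) (j1 r A G q)" for \<zeta>
  proof -
    obtain \<zeta>1 \<zeta>2 \<zeta>3 where \<zeta>: "\<zeta> = (\<zeta>1, \<zeta>2, \<zeta>3)" by (cases \<zeta>) auto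
    obtain v X Y where v: "\<zeta>3 = m' v + X ** M + M ** Y" using rt unfolding rank_transverse_def by blast
    define \<eta>1 where "\<eta>1 = \<zeta>1 - v"
    define \<eta>2 where "\<eta>2 = \<zeta>2 - g' v"
    define \<eta> where "\<eta> = (\<eta>1, \<eta>2, X ** M + M ** Y)"
    have "\<zeta> = (v, g' v, m' v) + \<eta>" by (simp add: \<zeta> \<eta>_def \<eta>1_def \<eta>2_def v)
    moreover have "J.tvec (jdom U) ?\<theta> (j1 r A G q) \<eta> \<in> tangent_space (jet_atlas r A) (Sigma_jets r A k) (j1 r A G q)"
    proof -
      \<comment> \<open>The quadratic term completes the matrix to (1 + t X) M (1 + t Y), whose rank
        is that of M for small t, and does not change the velocity at 0.\<close>
      define \<alpha> where "\<alpha> = (\<lambda>t::real. (\<phi> q + t *\<^sub>R \<eta>1, G q + t *\<^sub>R \<eta>2, M + t *\<^sub>R (X ** M + M ** Y) + (t * t) *\<^sub>R (X ** M ** Y)))"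
      have fac: "M + t *\<^sub>R (X ** M + M ** Y) + (t * t) *\<^sub>R (X ** M ** Y) = (mat 1 + t *\<^sub>R X) ** M ** (mat 1 + t *\<^sub>R Y)" for t
        by (simp add: mm.add_left mm.add_right mm.scaleR_left mm.scaleR_right matrix_mul_assoc algebra_simps)
      define T where "T = (\<lambda>t. \<phi> q + t *\<^sub>R \<eta>1) -` (\<phi> ` U) \<inter> {t. invertible (mat 1 + t *\<^sub>R X)} \<inter> {t. invertible (mat 1 + t *\<^sub>R Y)}"
      have "open T" unfolding T_def by (intro open_Int open_invertible_affine open_vimage o continuous_intros)
      moreover have "0 \<in> T" using x by (simp add: T_def invertible_mat_1)
      ultimately obtain \<epsilon> where \<epsilon>: "\<epsilon> > 0" "ball 0 \<epsilon> \<subseteq> T" using openE by blast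
      show ?thesis
      proof (rule J.curve_at_in_chart[OF cJ dom[OF c(2)] \<epsilon>(1), of \<alpha>])
        have "open {-\<epsilon><..<\<epsilon>}" by simp
        then show "Cn_on 1 {-\<epsilon><..<\<epsilon>} \<alpha>" unfolding \<alpha>_def
          by (intro Cn_on_Pair Cn_on_add Cn_on_scaleR Cn_on_mult Cn_on_id Cn_on_const)
        show "\<alpha> 0 = ?\<theta> (j1 r A G q)" by (simp add: \<alpha>_def z)
        have "((\<lambda>t. M + t *\<^sub>R (X ** M + M ** Y) + (t * t) *\<^sub>R (X ** M ** Y)) has_vector_derivative (X ** M + M ** Y)) (at 0)"
          by (auto intro!: derivative_eq_intros)
        moreover have "((\<lambda>t. \<phi> q + t *\<^sub>R \<eta>1) has_vector_derivative \<eta>1) (at 0)" by (auto intro!: derivative_eq_intros)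
        moreover have "((\<lambda>t. G q + t *\<^sub>R \<eta>2) has_vector_derivative \<eta>2) (at 0)" by (auto intro!: derivative_eq_intros)
        ultimately show "(\<alpha> has_vector_derivative \<eta>) (at 0)"
          unfolding \<alpha>_def \<eta>_def by (intro has_vector_derivative_Pair)
        fix t :: real assume "\<bar>t\<bar> < \<epsilon>"
        then have t: "\<phi> q + t *\<^sub>R \<eta>1 \<in> \<phi> ` U" "invertible (mat 1 + t *\<^sub>R X)" "invertible (mat 1 + t *\<^sub>R Y)"
          using \<epsilon>(2) by (auto simp: T_def subset_iff)
        define M1 where "M1 = M + t *\<^sub>R (X ** M + M ** Y) + (t * t) *\<^sub>R (X ** M ** Y)"
        have r1: "rank M1 = rank M"
          unfolding M1_def fac by (simp add: rank_mult_invertible_right[OF t(3)] rank_mult_invertible_left[OF t(2)])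
        have \<alpha>t: "\<alpha> t = (\<phi> q + t *\<^sub>R \<eta>1, G q + t *\<^sub>R \<eta>2, M1)" by (simp add: \<alpha>_def M1_def)
        note j = jet_at[OF c(1) t(1), of "G q + t *\<^sub>R \<eta>2" M1]
        have "jet_at U \<phi> (\<phi> q + t *\<^sub>R \<eta>1) (G q + t *\<^sub>R \<eta>2) M1 \<in> Sigma_jets r A k"
          using Sigma_jets_iff[OF c(1) j(1), of k] corank_eq_iff[OF k] rM r1 by (simp add: j(3))
        then show "\<alpha> t \<in> ?\<theta> ` jdom U \<and> inv_into (jdom U) ?\<theta> (\<alpha> t) \<in> Sigma_jets r A k"
          unfolding \<alpha>t inv_jet_coords[OF c(1) t(1)] jet_coords_image[OF c(1) subset_refl] using t(1) by simp
      qed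
    qed
    ultimately show ?thesis by blast
  qed
  then show "\<exists>U \<phi> U' \<theta>. (U, \<phi>) \<in> A \<and> q \<in> U \<and> (U', \<theta>) \<in> jet_atlas r A \<and> j1 r A G ` U \<subseteq> U' \<and>
        Cn_on 1 (\<phi> ` U) (\<theta> \<circ> j1 r A G \<circ> inv_into U \<phi>) \<and>
        (\<forall>\<zeta>. \<exists>v \<eta>. \<zeta> = frechet_derivative (\<theta> \<circ> j1 r A G \<circ> inv_into U \<phi>) (at (\<phi> q)) v + \<eta> \<and>
           J.tvec U' \<theta> (j1 r A G q) \<eta> \<in> tangent_space (jet_atlas r A) (Sigma_jets r A k) (j1 r A G q))"
    using c cJ dom C1 by (intro exI[of _ U] exI[of _ \<phi>] exI[of _ "jdom U"] exI[of _ ?\<theta>]) (auto simp only: D image_subset_iff)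
qed

end

section \<open>Reduction to countably many charts and conclusion\<close>

lemma countable_charts:
  assumes "second_countable (atlas_topology A)"
  obtains A0 where "countable A0" "A0 \<subseteq> A" "points A = (\<Union>(U, \<phi>)\<in>A0. U)"
proof -
  let ?X = "atlas_topology A"
  have ts: "topspace ?X = points A"
  proof -
    have "topspace ?X = \<Union>{{p \<in> U. \<phi> p \<in> W} | U \<phi> W. (U, \<phi>) \<in> A \<and> open W}"
      unfolding atlas_topology_def by (rule topology_generated_by_topspace)
    also have "\<dots> = points A"
    proof (intro equalityI subsetI)
      fix x assume "x \<in> points A"
      then obtain U \<phi> where U: "(U, \<phi>) \<in> A" "x \<in> U" unfolding points_def by auto
      have "{p \<in> U. \<phi> p \<in> UNIV} \<in> {{p \<in> U. \<phi> p \<in> W} | U \<phi> W. (U, \<phi>) \<in> A \<and> open W}"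
        using U(1) open_UNIV by blast
      then show "x \<in> \<Union>{{p \<in> U. \<phi> p \<in> W} | U \<phi> W. (U, \<phi>) \<in> A \<and> open W}"
        by (rule UnionI) (use U(2) in simp)
    qed (auto simp: points_def)
    finally show ?thesis .
  qed
  have op: "openin ?X U" if "(U, \<phi>) \<in> A" for U \<phi>
  proof -
    have "U = {p \<in> U. \<phi> p \<in> UNIV}" by simp
    then have "U \<in> {{p \<in> U. \<phi> p \<in> W} | U \<phi> W. (U, \<phi>) \<in> A \<and> open W}" using that open_UNIV by blast
    then show ?thesis unfolding atlas_topology_def by (rule topology_generated_by_Basis)
  qed
  have "\<exists>\<V>. countable \<V> \<and> \<V> \<subseteq> fst ` A \<and> \<Union>\<V> = topspace ?X"
  proof (rule Lindelof_spaceD[OF second_countable_imp_Lindelof_space[OF assms]])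
    show "openin ?X U" if "U \<in> fst ` A" for U using op that by auto
    show "\<Union>(fst ` A) = topspace ?X" unfolding ts points_def by auto
  qed
  then obtain \<V> where V: "countable \<V>" "\<V> \<subseteq> fst ` A" "\<Union>\<V> = topspace ?X"
    by (elim exE conjE) (rule that)
  have "\<exists>A0. countable A0 \<and> A0 \<subseteq> A \<and> \<V> = fst ` A0"
    by (rule countable_subset_image[THEN iffD1, OF conjI[OF V(1,2)]])
  then obtain A0 where A0: "countable A0" "A0 \<subseteq> A" "\<V> = fst ` A0" by blast
  have "(\<Union>(U, \<phi>)\<in>A0. U) = \<Union>(fst ` A0)" by (simp add: case_prod_unfold)
  then have "points A = (\<Union>(U, \<phi>)\<in>A0. U)" using V(3) unfolding ts A0(3) by simp
  then show thesis using that A0 by blast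
qed

lemma matrix_add_compose:
  fixes a :: "real^'n \<Rightarrow> real^'l" and b :: "real^'n \<Rightarrow> real^'m" and \<pi> :: "real^'m \<Rightarrow> real^'l"
  assumes "linear b" "linear \<pi>"
  shows "matrix (\<lambda>v. a v + \<pi> (b v)) = matrix a + matrix \<pi> ** matrix b"
proof -
  have "matrix (\<lambda>v. a v + \<pi> (b v)) = matrix a + matrix (\<pi> \<circ> b)" by (simp add: matrix_def vec_eq_iff)
  then show ?thesis by (simp add: matrix_compose[OF assms])
qed

theorem theorem1:
  fixes A :: "('a, real^'n) chart set"
    and U :: "(real^'m) set"
    and f :: "'a \<Rightarrow> real^'m"
    and F :: "real^'m \<Rightarrow> real^'l"
    and k :: nat and r :: enat
  assumes "Cr_manifold r A"
    and "open U"
    and "Cr_immersion r A f" and "f ` points A \<subseteq> U"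
    and "Cr_on r U F"
    and "1 \<le> k" and "k \<le> min CARD('n) CARD('l)"
    and "r > enat (nat (max (int CARD('n) -
           int (codim (r - 1) (jet_atlas r A) (Sigma_jets r A k :: ('a, 'l) jet set))) 0 + 1))"
  shows "\<exists>S \<subseteq> {\<pi> :: real^'m \<Rightarrow> real^'l. linear \<pi>}.
           matrix ` S \<in> null_sets lebesgue \<and>
           (\<forall>\<pi> \<in> {\<pi>. linear \<pi>} - S.
              transverse A (jet_atlas r A) (j1 r A ((\<lambda>x. F x + \<pi> x) \<circ> f)) (Sigma_jets r A k))"
proof (cases "(Sigma_jets r A k :: ('a, 'l) jet set) = {}")
  case True
  \<comment> \<open>Here \<open>codim\<close> is unspecified, but transversality to an empty set is
    vacuous.\<close>
  then show ?thesis by (intro exI[of _ "{}"]) (simp add: transverse_def)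
next
  case False
  let ?Z = "Sigma_jets r A k :: ('a, 'l) jet set"
  define \<rho> where "\<rho> = min CARD('n) CARD('l) - k"
  define c where "c = codim (r - 1) (jet_atlas r A) ?Z"
  \<comment> \<open>The finite order at which Sard's theorem is applied: r >= s + 1 holds for
    infinite r as well, and the Jacobians are of class C^s.\<close>
  define s where "s = nat (max (int CARD('n) - int c) 0 + 1)"
  have sn: "1 \<le> s" "CARD('n) + 1 \<le> s + c" by (auto simp: s_def)
  have "enat s < r" using assms(8) by (simp add: s_def c_def)
  then have sr: "enat (Suc s) \<le> r" by (simp add: Suc_ile_eq)
  have "(2::enat) \<le> enat (Suc s)" using sn(1) by (simp add: numeral_eq_enat)
  then have "2 \<le> r" using sr by (rule order_trans)
  interpret jet_base r A
    by unfold_locales (use assms(1) \<open>2 \<le> r\<close> in \<open>auto simp: Cr_manifold_def\<close>)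
  interpret J: atlas "r - 1" "jet_atlas r A :: (('a, 'l) jet, _) chart set" by (rule atlas_jets)
  \<comment> \<open>Evaluating \<open>codim\<close> turns the hypothesis on r into the dimension
    condition of \<open>rank_transverse_ae\<close>.\<close>
  have c: "c = (CARD('l) - \<rho>) * (CARD('n) - \<rho>)"
    unfolding c_def \<rho>_def by (rule J.submanifold_codim[OF Sigma_submanifold[OF assms(7)] False])
  have f: "Cr_on r (\<phi> ` V) (f \<circ> inv_into V \<phi>)" if "(V, \<phi>) \<in> A" for V \<phi>
    using assms(3) that unfolding Cr_immersion_def Cr_map_def by fast
  have finj: "inj (frechet_derivative (f \<circ> inv_into V \<phi>) (at x))" if "(V, \<phi>) \<in> A" "x \<in> \<phi> ` V" for V \<phi> x
    using assms(3) that unfolding Cr_immersion_def by fast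
  have fU: "(f \<circ> inv_into V \<phi>) x \<in> U" if "(V, \<phi>) \<in> A" "x \<in> \<phi> ` V" for V \<phi> x
    using assms(4) that inv_into_into[OF that(2)] by (auto simp: points_def)
  define Ff where "Ff = (\<lambda>V (\<phi> :: 'a \<Rightarrow> real^'n) x. F ((f \<circ> inv_into V \<phi>) x))"
  have Ff: "Cr_on r (\<phi> ` V) (Ff V \<phi>)" if "(V, \<phi>) \<in> A" for V \<phi>
    unfolding Ff_def by (rule Cr_on_compose[OF open_chart[OF that] assms(2) f[OF that] assms(5) fU[OF that]])
  define Jac where "Jac = (\<lambda>V \<phi> P x. matrix (frechet_derivative (Ff V \<phi>) (at x)) +
      P ** matrix (frechet_derivative (f \<circ> inv_into V \<phi>) (at x)))"
  define bad where "bad = (\<lambda>(V, \<phi>). {P. \<exists>x\<in>\<phi> ` V. rank (Jac V \<phi> P x) = \<rho> \<and>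
      \<not> rank_transverse (Jac V \<phi> P x) (frechet_derivative (Jac V \<phi> P) (at x))})"
  have nbad: "negligible (bad (V, \<phi>))" if "(V, \<phi>) \<in> A" for V \<phi>
    unfolding bad_def Jac_def split
    by (rule rank_transverse_ae[OF open_chart[OF that] Cr_on_CnD[OF Ff[OF that] sr] Cr_on_CnD[OF f[OF that] sr] sn(1) finj[OF that]])
      (use sn(2) c in auto)
  obtain A0 where A0: "countable A0" "A0 \<subseteq> A" "points A = (\<Union>(U, \<phi>)\<in>A0. U)"
    using countable_charts assms(1) unfolding Cr_manifold_def by blast
  \<comment> \<open>Charts from the countable subfamily A0 already cover the manifold, so the union
    of their bad sets stays null.\<close>
  define S where "S = {\<pi> :: real^'m \<Rightarrow> real^'l. linear \<pi> \<and> matrix \<pi> \<in> (\<Union>c\<in>A0. bad c)}"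
  have "negligible (\<Union>c\<in>A0. bad c)"
    using A0(1,2) nbad by (intro negligible_countable_Union) auto
  then have "negligible (matrix ` S)" by (rule negligible_subset) (auto simp: S_def)
  then have "matrix ` S \<in> null_sets lebesgue" by (simp add: negligible_iff_null_sets)
  moreover have "transverse A (jet_atlas r A) (j1 r A ((\<lambda>x. F x + \<pi> x) \<circ> f)) (Sigma_jets r A k)"
    if \<pi>: "linear \<pi>" "\<pi> \<notin> S" for \<pi> :: "real^'m \<Rightarrow> real^'l"
  proof (rule jets_transverse[OF assms(7)])
    let ?G = "(\<lambda>x. F x + \<pi> x) \<circ> f"
    have G: "?G \<circ> inv_into V \<phi> = (\<lambda>x. Ff V \<phi> x + \<pi> ((f \<circ> inv_into V \<phi>) x))" for V \<phi>
      by (simp add: Ff_def o_def)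
    show "Cr_map r A ?G" unfolding Cr_map_def
    proof safe
      fix V \<phi> assume V: "(V, \<phi>) \<in> A"
      show "Cr_on r (\<phi> ` V) (?G \<circ> inv_into V \<phi>)" unfolding G Cr_on_def
        using Cr_on_CnD[OF Ff[OF V]] Cr_on_CnD[OF f[OF V]]
        by (intro allI impI Cn_on_add Cn_on_linear_compose[OF \<pi>(1)] open_chart[OF V])
    qed
    fix q assume "q \<in> points A"
    then obtain V \<phi> where V0: "(V, \<phi>) \<in> A0" "q \<in> V" unfolding A0(3) by auto
    then have V: "(V, \<phi>) \<in> A" using A0(2) by blast
    have o: "open (\<phi> ` V)" by (rule open_chart[OF V])
    have x: "\<phi> q \<in> \<phi> ` V" using V0(2) by blast
    \<comment> \<open>In a chart the Jacobian of the perturbed map is affine in the matrix of \<pi>,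
      the form in which the bad sets were estimated.\<close>
    have JG: "matrix (frechet_derivative (?G \<circ> inv_into V \<phi>) (at x)) = Jac V \<phi> (matrix \<pi>) x" if "x \<in> \<phi> ` V" for x
    proof -
      have d1: "(Ff V \<phi> has_derivative frechet_derivative (Ff V \<phi>) (at x)) (at x)"
        using Cn_on_has_derivative[OF Cr_on_CnD[OF Ff[OF V] sr] _ that] by simp
      have d2: "((f \<circ> inv_into V \<phi>) has_derivative frechet_derivative (f \<circ> inv_into V \<phi>) (at x)) (at x)"
        using Cn_on_has_derivative[OF Cr_on_CnD[OF f[OF V] sr] _ that] by simp
      have "((?G \<circ> inv_into V \<phi>) has_derivative (\<lambda>v. frechet_derivative (Ff V \<phi>) (at x) v + \<pi> (frechet_derivative (f \<circ> inv_into V \<phi>) (at x) v))) (at x)"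
        unfolding G using \<pi>(1)
        by (intro has_derivative_add d1 bounded_linear.has_derivative[OF _ d2]) (simp add: linear_conv_bounded_linear)
      from frechet_derivative_at[OF this]
      have fd: "frechet_derivative (?G \<circ> inv_into V \<phi>) (at x) =
        (\<lambda>v. frechet_derivative (Ff V \<phi>) (at x) v + \<pi> (frechet_derivative (f \<circ> inv_into V \<phi>) (at x) v))" by (rule sym)
      show ?thesis unfolding fd Jac_def by (rule matrix_add_compose[OF has_derivative_linear[OF d2] \<pi>(1)])
    qed
    have CJ: "Cn_on s (\<phi> ` V) (Jac V \<phi> (matrix \<pi>))"
      unfolding Jac_def
      by (intro Cn_on_add Cn_on_matrix_mult Cn_on_jacobian Cn_on_const o Cr_on_CnD[OF Ff[OF V] sr] Cr_on_CnD[OF f[OF V] sr])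
    have dJ: "Jac V \<phi> (matrix \<pi>) differentiable (at (\<phi> q))"
      using Cn_on_has_derivative[OF CJ sn(1) x] differentiableI by blast
    have "frechet_derivative (Jac V \<phi> (matrix \<pi>)) (at (\<phi> q)) =
        frechet_derivative (\<lambda>x. matrix (frechet_derivative (?G \<circ> inv_into V \<phi>) (at x))) (at (\<phi> q))"
      by (rule frechet_derivative_transform_within_open[OF dJ o x]) (rule JG[symmetric])
    moreover have "matrix \<pi> \<notin> bad (V, \<phi>)" using \<pi> V0(1) by (auto simp: S_def)
    ultimately show "\<exists>V \<phi>. (V, \<phi>) \<in> A \<and> q \<in> V \<and>
      (rank (jac V \<phi> ?G q) = min CARD('n) CARD('l) - k \<longrightarrow>
       rank_transverse (jac V \<phi> ?G q) (frechet_derivative (\<lambda>x. matrix (frechet_derivative (?G \<circ> inv_into V \<phi>) (at x))) (at (\<phi> q))))"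
      using V V0(2) x JG[OF x] by (intro exI[of _ V] exI[of _ \<phi>]) (auto simp: bad_def jac_def \<rho>_def)
  qed
  ultimately show ?thesis by (intro exI[of _ S]) (auto simp: S_def)
qed

end
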